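(* Let $\mathrm N_{n,k}=F_n/\gamma_{k+1}F_n$ be the free nilpotent group of rank $n$ and step $k$ with basis $X=\{x_1,\dots,x_n\}$. (1) If $k$ is even, then the group of central palindromic automorphisms of $\mathrm N_{n,k}$ is trivial. (2) If $k$ is odd, then the group of central palindromic automorphisms of $\mathrm N_{n,k}$ is non-trivial and has a non-trivial intersection with the group of normal automorphisms of $\mathrm N_{n,k}$.
   Context: $F_n$ is the free group on $x_1,\dots,x_n$ and $\gamma_mG$ is the $m$-th term of the lower central series of $G$ ($\gamma_1G=G$). The images of the $x_i$ in $\mathrm N_{n,k}$ are again denoted $x_i$. A word in $X^{\pm1}$ is a palindrome if it coincides letter by letter with its reverse word; an element of $\mathrm N_{n,k}$ is a palindrome if it can be represented by some word in the alphabet $X^{\pm1}$ which is a palindrome. An automorphism $\phi$ of $\mathrm N_{n,k}$ is palindromic if the image $x_i^\phi$ is a palindrome for every $1\le i\le n$. An automorphism of a group $G$ is central if it induces the identity on the central quotient $G/Z(G)$, where $Z(G)$ is the center of $G$, and normal if it sends each normal subgroup of $G$ onto itself. A central palindromic automorphism is one that is both central and palindromic.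
   Formalization: Part (1) is stated for rank n ≥ 2: for n = 1 and k even the group is infinite cyclic, and inversion is a non-trivial central palindromic automorphism, so the claim fails there. *)

theory Defs
  imports "HOL-Algebra.Coset" "HOL-Algebra.Generated_Groups" "HOL-Algebra.Bij"
begin

section \<open>Words and free groups\<close>

text \<open>The letter \<open>(i, True)\<close> stands for \<open>x\<^sub>i\<close> and \<open>(i, False)\<close> for its formal inverse.\<close>

type_synonym word = "(nat \<times> bool) list"

definition words :: "nat \<Rightarrow> word set" where
  "words n = lists ({1..n} \<times> UNIV)"

definition cancel :: "nat \<Rightarrow> (word \<times> word) set" where
  "cancel n = {(u @ [(i, b), (i, \<not> b)] @ v, u @ v) | u v i b.
     u \<in> words n \<and> v \<in> words n \<and> i \<in> {1..n}}"

definition free_rel :: "nat \<Rightarrow> (word \<times> word) set" where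
  "free_rel n = (cancel n \<union> (cancel n)\<inverse>)\<^sup>* \<inter> words n \<times> words n"

definition free_group :: "nat \<Rightarrow> word set monoid" where
  "free_group n =
     \<lparr>carrier = words n // free_rel n,
      mult = (\<lambda>A B. free_rel n `` {u @ v | u v. u \<in> A \<and> v \<in> B}),
      one = free_rel n `` {[]}\<rparr>"

definition free_gen :: "nat \<Rightarrow> nat \<Rightarrow> word set" where
  "free_gen n i = free_rel n `` {[(i, True)]}"


section \<open>Lower central series and free nilpotent groups\<close>

text \<open>The series starts with \<open>\<gamma>\<^sub>1 G = G\<close>; the value at index \<open>0\<close> is irrelevant.\<close>

fun lower_central :: "('a, 'b) monoid_scheme \<Rightarrow> nat \<Rightarrow> 'a set" where
  "lower_central G 0 = carrier G"
| "lower_central G (Suc 0) = carrier G"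
| "lower_central G (Suc (Suc m)) =
     generate G (\<Union>h \<in> lower_central G (Suc m). \<Union>g \<in> carrier G.
       {h \<otimes>\<^bsub>G\<^esub> g \<otimes>\<^bsub>G\<^esub> inv\<^bsub>G\<^esub> h \<otimes>\<^bsub>G\<^esub> inv\<^bsub>G\<^esub> g})"

definition free_nilpotent :: "nat \<Rightarrow> nat \<Rightarrow> word set set monoid" where
  "free_nilpotent n k = free_group n Mod lower_central (free_group n) (k + 1)"

definition nilpotent_gen :: "nat \<Rightarrow> nat \<Rightarrow> nat \<Rightarrow> word set set" where
  "nilpotent_gen n k i =
     lower_central (free_group n) (k + 1) #>\<^bsub>free_group n\<^esub> free_gen n i"


section \<open>Palindromes\<close>

fun letter_value :: "('a, 'b) monoid_scheme \<Rightarrow> (nat \<Rightarrow> 'a) \<Rightarrow> nat \<times> bool \<Rightarrow> 'a" where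
  "letter_value G x (i, b) = (if b then x i else inv\<^bsub>G\<^esub> (x i))"

definition word_value :: "('a, 'b) monoid_scheme \<Rightarrow> (nat \<Rightarrow> 'a) \<Rightarrow> word \<Rightarrow> 'a" where
  "word_value G x w = foldr (\<lambda>l g. letter_value G x l \<otimes>\<^bsub>G\<^esub> g) w \<one>\<^bsub>G\<^esub>"

definition palindrome_word :: "word \<Rightarrow> bool" where
  "palindrome_word w \<longleftrightarrow> rev w = w"

definition palindromes :: "nat \<Rightarrow> nat \<Rightarrow> word set set set" where
  "palindromes n k =
     {word_value (free_nilpotent n k) (nilpotent_gen n k) w | w.
        w \<in> words n \<and> palindrome_word w}"


section \<open>Classes of automorphisms\<close>

definition group_center :: "('a, 'b) monoid_scheme \<Rightarrow> 'a set" where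
  "group_center G = {z \<in> carrier G. \<forall>g \<in> carrier G. z \<otimes>\<^bsub>G\<^esub> g = g \<otimes>\<^bsub>G\<^esub> z}"

definition central_auts :: "('a, 'b) monoid_scheme \<Rightarrow> ('a \<Rightarrow> 'a) set" where
  "central_auts G = {\<phi> \<in> auto G. \<forall>g \<in> carrier G.
     group_center G #>\<^bsub>G\<^esub> \<phi> g = group_center G #>\<^bsub>G\<^esub> g}"

definition normal_auts :: "('a, 'b) monoid_scheme \<Rightarrow> ('a \<Rightarrow> 'a) set" where
  "normal_auts G = {\<phi> \<in> auto G. \<forall>H. H \<lhd> G \<longrightarrow> \<phi> ` H = H}"

definition palindromic_auts :: "nat \<Rightarrow> nat \<Rightarrow> (word set set \<Rightarrow> word set set) set" where
  "palindromic_auts n k = {\<phi> \<in> auto (free_nilpotent n k).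
     \<forall>i \<in> {1..n}. \<phi> (nilpotent_gen n k i) \<in> palindromes n k}"

definition central_palindromic_auts :: "nat \<Rightarrow> nat \<Rightarrow> (word set set \<Rightarrow> word set set) set" where
  "central_palindromic_auts n k = central_auts (free_nilpotent n k) \<inter> palindromic_auts n k"


section \<open>The constructions yield groups\<close>

lemma words_simps [simp]:
  "[] \<in> words n"
  "l # w \<in> words n \<longleftrightarrow> fst l \<in> {1..n} \<and> w \<in> words n"
  "u @ v \<in> words n \<longleftrightarrow> u \<in> words n \<and> v \<in> words n"
  by (auto simp: words_def mem_Times_iff)

lemma equiv_free_rel: "equiv (words n) (free_rel n)"
proof (rule equivI)
  show "sym (free_rel n)"
    unfolding free_rel_def
    by (intro sym_Int sym_rtrancl) (auto simp: sym_def)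
  show "trans (free_rel n)"
    unfolding free_rel_def
    by (intro trans_Int trans_rtrancl) (auto simp: trans_def)
qed (auto simp: free_rel_def refl_on_def)

lemma cancel_context:
  assumes "(a, b) \<in> cancel n" "u \<in> words n" "v \<in> words n"
  shows "(u @ a @ v, u @ b @ v) \<in> cancel n"
proof -
  obtain p q i c where "a = p @ [(i, c), (i, \<not> c)] @ q" "b = p @ q"
    "p \<in> words n" "q \<in> words n" "i \<in> {1..n}"
    using assms(1) unfolding cancel_def by blast
  then have "u @ a @ v = (u @ p) @ [(i, c), (i, \<not> c)] @ (q @ v)"
    "u @ b @ v = (u @ p) @ (q @ v)" "u @ p \<in> words n" "q @ v \<in> words n"
    using assms by auto
  then show ?thesis
    using \<open>i \<in> {1..n}\<close> unfolding cancel_def by blast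
qed

lemma free_rel_context:
  assumes "(a, b) \<in> free_rel n" "u \<in> words n" "v \<in> words n"
  shows "(u @ a @ v, u @ b @ v) \<in> free_rel n"
proof -
  have "(a, b) \<in> (cancel n \<union> (cancel n)\<inverse>)\<^sup>*"
    using assms(1) by (simp add: free_rel_def)
  then have "(u @ a @ v, u @ b @ v) \<in> (cancel n \<union> (cancel n)\<inverse>)\<^sup>*"
  proof (induction rule: rtrancl_induct)
    case (step y z)
    then have "(u @ y @ v, u @ z @ v) \<in> cancel n \<union> (cancel n)\<inverse>"
      using cancel_context assms by blast
    with step.IH show ?case by (rule rtrancl_into_rtrancl)
  qed simp
  then show ?thesis
    using assms by (auto simp: free_rel_def)
qed

lemma free_rel_append:
  assumes "(a, b) \<in> free_rel n" "(c, d) \<in> free_rel n"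
  shows "(a @ c, b @ d) \<in> free_rel n"
proof -
  have "b \<in> words n" "c \<in> words n" using assms by (auto simp: free_rel_def)
  then have "(a @ c, b @ c) \<in> free_rel n" "(b @ c, b @ d) \<in> free_rel n"
    using free_rel_context[OF assms(1), of "[]" c] free_rel_context[OF assms(2), of b "[]"]
    by auto
  then show ?thesis
    using equiv_free_rel by (meson equivE transD)
qed

lemma free_group_mult:
  assumes "u \<in> words n" "v \<in> words n"
  shows "free_rel n `` {u} \<otimes>\<^bsub>free_group n\<^esub> free_rel n `` {v} = free_rel n `` {u @ v}"
proof -
  have "(u, u) \<in> free_rel n" "(v, v) \<in> free_rel n"
    using assms by (auto simp: free_rel_def)
  moreover have "trans (free_rel n)" using equiv_free_rel by (meson equivE)
  moreover have "(u @ v, z) \<in> free_rel n"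
    if "(u, u') \<in> free_rel n" "(v, v') \<in> free_rel n" "(u' @ v', z) \<in> free_rel n" for u' v' z
    using free_rel_append[OF that(1,2)] that(3) \<open>trans (free_rel n)\<close> by (blast dest: transD)
  ultimately show ?thesis
    by (auto simp: free_group_def)
qed

lemma carrier_free_group:
  "carrier (free_group n) = (\<lambda>u. free_rel n `` {u}) ` words n"
  by (auto simp: free_group_def quotient_def)

definition inverse_word :: "word \<Rightarrow> word" where
  "inverse_word w = rev (map (\<lambda>(i, b). (i, \<not> b)) w)"

lemma inverse_word_words: "w \<in> words n \<Longrightarrow> inverse_word w \<in> words n"
  by (induction w) (auto simp: inverse_word_def)

lemma inverse_word_cancel:
  assumes "w \<in> words n"
  shows "(inverse_word w @ w, []) \<in> free_rel n"
  using assms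
proof (induction w)
  case Nil
  then show ?case by (simp add: inverse_word_def free_rel_def)
next
  case (Cons l w)
  obtain i b where l: "l = (i, b)" by fastforce
  have w: "w \<in> words n" "i \<in> {1..n}" "inverse_word w \<in> words n"
    using Cons.prems l inverse_word_words by auto
  have "(inverse_word w @ [(i, \<not> b), (i, \<not> \<not> b)] @ w, inverse_word w @ w) \<in> cancel n"
    using w unfolding cancel_def by blast
  then have "(inverse_word (l # w) @ l # w, inverse_word w @ w) \<in> free_rel n"
    using w by (auto simp: free_rel_def l inverse_word_def)
  then show ?case
    using Cons.IH[OF w(1)] equiv_free_rel by (meson equivE transD)
qed

lemma group_free_group: "group (free_group n)"
proof (rule groupI)
  have one: "\<one>\<^bsub>free_group n\<^esub> = free_rel n `` {[]}" by (simp add: free_group_def)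
  fix x assume "x \<in> carrier (free_group n)"
  then obtain u where u: "u \<in> words n" "x = free_rel n `` {u}"
    by (auto simp: carrier_free_group)
  have "free_rel n `` {inverse_word u} \<otimes>\<^bsub>free_group n\<^esub> x = \<one>\<^bsub>free_group n\<^esub>"
    using free_group_mult[of "inverse_word u" n u] inverse_word_cancel[of u n] u one
      equiv_class_eq[OF equiv_free_rel] by (simp add: inverse_word_words)
  then show "\<exists>y\<in>carrier (free_group n). y \<otimes>\<^bsub>free_group n\<^esub> x = \<one>\<^bsub>free_group n\<^esub>"
    using inverse_word_words[OF u(1)] by (auto simp: carrier_free_group)
  show "\<one>\<^bsub>free_group n\<^esub> \<otimes>\<^bsub>free_group n\<^esub> x = x"
    using free_group_mult[of "[]" n u] u one by simp
next
  show "\<one>\<^bsub>free_group n\<^esub> \<in> carrier (free_group n)"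
    by (auto simp: free_group_def quotient_def)
qed (auto simp: carrier_free_group free_group_mult)

lemma (in group) normal_lower_central: "lower_central G m \<lhd> G"
proof (induction m rule: nat_induct)
  case 0
  show ?case by (simp add: normal_inv_iff subgroup_self)
next
  case (Suc m)
  show ?case
  proof (cases m)
    case 0
    then show ?thesis by (simp add: normal_inv_iff subgroup_self)
  next
    case (Suc p)
    let ?c = "\<lambda>h g. h \<otimes> g \<otimes> inv h \<otimes> inv g"
    let ?S = "\<Union>h \<in> lower_central G (Suc p). \<Union>g \<in> carrier G. {?c h g}"
    have IH: "lower_central G (Suc p) \<lhd> G" using Suc.IH Suc by simp
    have sub: "h \<in> carrier G" if "h \<in> lower_central G (Suc p)" for h
      using that IH by (meson normal_imp_subgroup subgroup.mem_carrier)
    have conj: "x \<otimes> ?c h g \<otimes> inv x = ?c (x \<otimes> h \<otimes> inv x) (x \<otimes> g \<otimes> inv x)"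
      if "x \<in> carrier G" "h \<in> carrier G" "g \<in> carrier G" for x h g
    proof -
      have cancel: "inv x \<otimes> (x \<otimes> y) = y" if "y \<in> carrier G" for y
        using that \<open>x \<in> carrier G\<close> by (simp flip: m_assoc)
      show ?thesis
        using that by (simp add: m_assoc inv_mult_group cancel)
    qed
    have "generate G ?S \<lhd> G"
    proof (rule normal_generateI)
      show "?S \<subseteq> carrier G" using sub by auto
      fix s x assume "s \<in> ?S" and x: "x \<in> carrier G"
      then obtain h g where hg: "h \<in> lower_central G (Suc p)" "g \<in> carrier G" "s = ?c h g"
        by blast
      have "x \<otimes> h \<otimes> inv x \<in> lower_central G (Suc p)"
        using IH hg x by (simp add: normal_inv_iff)
      then show "x \<otimes> s \<otimes> inv x \<in> ?S"
        using conj[OF x sub[OF hg(1)] hg(2)] hg x by blast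
    qed
    then show ?thesis using Suc by simp
  qed
qed

lemma group_free_nilpotent: "group (free_nilpotent n k)"
  unfolding free_nilpotent_def
  by (intro normal.factorgroup_is_group group.normal_lower_central group_free_group)

lemma (in group) subgroup_normal_auts: "subgroup (normal_auts G) (AutoGroup G)"
proof -
  interpret A: group "AutoGroup G" by (rule AutoGroup)
  have Bij: "f \<in> Bij (carrier G)" if "f \<in> auto G" for f
    using that by (simp add: auto_def)
  have mult: "f \<otimes>\<^bsub>AutoGroup G\<^esub> g = compose (carrier G) f g"
    if "f \<in> auto G" "g \<in> auto G" for f g
    using that Bij by (simp add: AutoGroup_def BijGroup_def)
  have one: "\<one>\<^bsub>AutoGroup G\<^esub> = (\<lambda>x \<in> carrier G. x)"
    by (simp add: AutoGroup_def BijGroup_def)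
  have carrier: "carrier (AutoGroup G) = auto G" by (simp add: AutoGroup_def)
  have sub: "H \<subseteq> carrier G" if "H \<lhd> G" for H
    using that by (meson normal_imp_subgroup subgroup.subset)
  have img: "(f \<otimes>\<^bsub>AutoGroup G\<^esub> g) ` H = f ` g ` H"
    if "f \<in> auto G" "g \<in> auto G" "H \<lhd> G" for f g H
    using sub[OF that(3)] mult[OF that(1,2)] by (force simp: compose_def)
  show ?thesis
  proof (rule A.subgroupI)
    show "normal_auts G \<subseteq> carrier (AutoGroup G)" by (auto simp: normal_auts_def carrier)
    have id: "(\<lambda>x \<in> carrier G. x) ` H = H" if "H \<lhd> G" for H using sub[OF that] by force
    then have "(\<lambda>x \<in> carrier G. x) \<in> normal_auts G"
      unfolding normal_auts_def using id_in_auto by blast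
    then show "normal_auts G \<noteq> {}" by blast
    fix f assume f: "f \<in> normal_auts G"
    then have fa: "f \<in> auto G" by (simp add: normal_auts_def)
    then have ia: "inv\<^bsub>AutoGroup G\<^esub> f \<in> auto G" using A.inv_closed carrier by simp
    have "(inv\<^bsub>AutoGroup G\<^esub> f) ` H = H" if H: "H \<lhd> G" for H
    proof -
      have "(inv\<^bsub>AutoGroup G\<^esub> f) ` f ` H = \<one>\<^bsub>AutoGroup G\<^esub> ` H"
        using img[OF ia fa H] A.l_inv[of f] fa carrier by simp
      moreover have "f ` H = H" using f H by (simp add: normal_auts_def)
      ultimately show ?thesis using id[OF H] one by simp
    qed
    with ia show "inv\<^bsub>AutoGroup G\<^esub> f \<in> normal_auts G" by (simp add: normal_auts_def)
    fix g assume g: "g \<in> normal_auts G"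
    then have ga: "g \<in> auto G" by (simp add: normal_auts_def)
    have "f \<otimes>\<^bsub>AutoGroup G\<^esub> g \<in> auto G" using A.m_closed fa ga carrier by simp
    then show "f \<otimes>\<^bsub>AutoGroup G\<^esub> g \<in> normal_auts G"
      using img[OF fa ga] f g by (simp add: normal_auts_def)
  qed
qed

end

theory Submission
  imports Defs "HOL-Library.List_Lexorder" "HOL-Algebra.Zassenhaus"
begin

text \<open>Write \<open>F\<close> for the free group and \<open>N = F / \<gamma>\<^bsub>k+1\<^esub>F\<close>. The proof rests on the theorem of
  Magnus (\<open>magnus_theorem\<close>): under the embedding \<open>x\<^sub>i \<mapsto> 1 + X\<^sub>i\<close> of \<open>F\<close> into the noncommutative
  power series over the integers, \<open>\<gamma>\<^sub>m F\<close> consists of the elements \<open>1 + (terms of degree \<ge> m)\<close>.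
  Once this is known, statements about the last term \<open>\<gamma>\<^sub>k\<close> of \<open>N\<close> are statements about integer
  coefficients of words of length \<open>k\<close>, and three facts are read off from the Lie structure of
  leading parts.

  \<^item> If \<open>n \<ge> 2\<close>, a non-zero homogeneous leading part cannot commute with two different letters.
    So the center of \<open>N\<close> is \<open>\<gamma>\<^sub>k\<close>, and a central automorphism has the form \<open>x\<^sub>i \<mapsto> z\<^sub>i x\<^sub>i\<close> with
    \<open>z\<^sub>i \<in> \<gamma>\<^sub>k\<close> (\<open>central_aut_gen\<close>).
  \<^item> Reversing all words is an anti-automorphism that fixes the letters, so it multiplies a Lie
    element of degree \<open>m\<close> by \<open>(-1)\<^bsup>m+1\<^esup>\<close> (\<open>magnus_top_rev\<close>).
  \<^item> Coefficients are integers, so there is no torsion.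

  Let \<open>n \<ge> 2\<close> and \<open>k\<close> be even. If \<open>z\<^sub>i x\<^sub>i\<close> is a palindrome, the degree-\<open>k\<close> part of its expansion is
  that of \<open>z\<^sub>i\<close>, and it is both fixed and negated by reversal. Hence it is zero and \<open>z\<^sub>i = 1\<close>. (In
  rank one \<open>N\<close> is infinite cyclic and inversion is a central palindromic automorphism for every
  \<open>k\<close>.)

  Let \<open>k\<close> be odd. Then reversal fixes \<open>\<gamma>\<^sub>k\<close>, so \<open>z p z\<close> is a palindrome whenever \<open>p\<close> is one and
  \<open>z \<in> \<gamma>\<^sub>k\<close> (\<open>palindrome_sandwich\<close>). Two consequences follow. The inverse of a central palindromic
  automorphism \<open>x\<^sub>i \<mapsto> z\<^sub>i x\<^sub>i\<close> is palindromic, because \<open>z\<^sub>i\<inverse> x\<^sub>i = z\<^sub>i\<inverse> (z\<^sub>i x\<^sub>i) z\<^sub>i\<inverse>\<close>. And for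
  \<open>h \<in> \<gamma>\<^bsub>k-1\<^esub>\<close> conjugation by \<open>h\<^sup>2\<close>, which is a normal automorphism, is central and sends \<open>x\<^sub>i\<close> to
  the palindrome \<open>[h, x\<^sub>i] x\<^sub>i [h, x\<^sub>i]\<close>; it is non-trivial if \<open>h \<notin> \<gamma>\<^sub>k\<close>. When \<open>N\<close> is abelian
  (\<open>k = 1\<close> or \<open>n = 1\<close>) inversion serves as the example, and closure under inverses holds because
  a palindromic automorphism permutes the finitely many cosets of the squares that consist of
  palindromes.

  The theorem of Magnus itself is proved with Lyndon words. Each Lyndon word \<open>w\<close> has a bracketed
  commutator \<open>c\<^sub>w\<close>. In any group generated by the \<open>x\<^sub>i\<close> these generate \<open>\<gamma>\<^sub>m\<close> modulo \<open>\<gamma>\<^bsub>m+1\<^esub>\<close>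
  (\<open>lower_central_eq_lyndon_span\<close>), by rewriting with the Jacobi identity; and the expansion of
  \<open>c\<^sub>w\<close> in the free group is \<open>w\<close> plus larger words (\<open>magnus_lyndon_commutator\<close>), so an element of
  \<open>\<gamma>\<^sub>m\<close> with vanishing part of degree \<open>m\<close> lies in \<open>\<gamma>\<^bsub>m+1\<^esub>\<close>.\<close>


section \<open>Commutators and the lower central series\<close>

definition commutator :: "('a, 'b) monoid_scheme \<Rightarrow> 'a \<Rightarrow> 'a \<Rightarrow> 'a" where
  "commutator G a b = a \<otimes>\<^bsub>G\<^esub> b \<otimes>\<^bsub>G\<^esub> inv\<^bsub>G\<^esub> a \<otimes>\<^bsub>G\<^esub> inv\<^bsub>G\<^esub> b"

context group
begin

lemma mult_inv_cancel:
  assumes "a \<in> carrier G" "b \<in> carrier G"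
  shows "inv a \<otimes> (a \<otimes> b) = b" "a \<otimes> (inv a \<otimes> b) = b"
  using assms by (simp_all flip: m_assoc)

lemma commutator_closed [simp]:
  "a \<in> carrier G \<Longrightarrow> b \<in> carrier G \<Longrightarrow> commutator G a b \<in> carrier G"
  by (simp add: commutator_def)

lemma commutator_self: "a \<in> carrier G \<Longrightarrow> commutator G a a = \<one>"
  by (simp add: commutator_def m_assoc mult_inv_cancel)

lemma inv_commutator:
  "a \<in> carrier G \<Longrightarrow> b \<in> carrier G \<Longrightarrow> inv (commutator G a b) = commutator G b a"
  by (simp add: commutator_def m_assoc inv_mult_group)

lemma commutator_mult:
  "a \<in> carrier G \<Longrightarrow> b \<in> carrier G \<Longrightarrow> commutator G a b \<otimes> b \<otimes> a = a \<otimes> b"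
  by (simp add: commutator_def m_assoc)

lemma conj_eq_commutator_mult:
  "a \<in> carrier G \<Longrightarrow> b \<in> carrier G \<Longrightarrow> a \<otimes> b \<otimes> inv a = commutator G a b \<otimes> b"
  by (simp add: commutator_def m_assoc)

lemma commutator_eq_one_iff:
  assumes "a \<in> carrier G" "b \<in> carrier G"
  shows "commutator G a b = \<one> \<longleftrightarrow> a \<otimes> b = b \<otimes> a"
proof
  assume "commutator G a b = \<one>"
  then show "a \<otimes> b = b \<otimes> a" using commutator_mult[OF assms] assms by simp
next
  assume "a \<otimes> b = b \<otimes> a"
  then show "commutator G a b = \<one>" using assms by (simp add: commutator_def m_assoc mult_inv_cancel)
qed

lemma hall_witt:
  assumes "a \<in> carrier G" "b \<in> carrier G" "c \<in> carrier G"
  shows "commutator G (commutator G a b) (b \<otimes> c \<otimes> inv b) \<otimes>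
    commutator G (commutator G b c) (c \<otimes> a \<otimes> inv c) \<otimes>
    commutator G (commutator G c a) (a \<otimes> b \<otimes> inv a) = \<one>"
  using assms by (simp add: commutator_def m_assoc inv_mult_group mult_inv_cancel)

text \<open>This replaces bilinearity of the Lie bracket: whether commutators with \<open>b\<close> fall into a normal
  subgroup \<open>S\<close> can be checked on generators.\<close>

lemma subgroup_commutes_modulo:
  assumes "S \<lhd> G" "b \<in> carrier G"
  shows "subgroup {a \<in> carrier G. commutator G a b \<in> S} G"
proof -
  interpret S: normal S G by fact
  show ?thesis
  proof (rule subgroupI)
    have "\<one> \<in> {a \<in> carrier G. commutator G a b \<in> S}"
      using assms by (simp add: commutator_def)
    then show "{a \<in> carrier G. commutator G a b \<in> S} \<noteq> {}" by blast
    fix a assume "a \<in> {a \<in> carrier G. commutator G a b \<in> S}"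
    then have a: "a \<in> carrier G" "commutator G a b \<in> S" by auto
    have "commutator G (inv a) b = inv a \<otimes> inv (commutator G a b) \<otimes> a"
      using a(1) assms(2) by (simp add: commutator_def m_assoc inv_mult_group mult_inv_cancel)
    also have "\<dots> \<in> S"
      using a S.inv_op_closed1[of a "inv (commutator G a b)"] by simp
    finally show "inv a \<in> {a \<in> carrier G. commutator G a b \<in> S}" using a by simp
    fix a' assume "a' \<in> {a \<in> carrier G. commutator G a b \<in> S}"
    then have a': "a' \<in> carrier G" "commutator G a' b \<in> S" by auto
    have "commutator G (a \<otimes> a') b = (a \<otimes> commutator G a' b \<otimes> inv a) \<otimes> commutator G a b"
      using a(1) a'(1) assms(2) by (simp add: commutator_def m_assoc inv_mult_group mult_inv_cancel)
    also have "\<dots> \<in> S"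
      using a a' by (intro S.m_closed[OF S.inv_op_closed2]) auto
    finally show "a \<otimes> a' \<in> {a \<in> carrier G. commutator G a b \<in> S}" using a a' by simp
  qed auto
qed

lemma commutator_mem_sym:
  assumes "subgroup S G" "a \<in> carrier G" "b \<in> carrier G" "commutator G a b \<in> S"
  shows "commutator G b a \<in> S"
  using subgroup.m_inv_closed[OF assms(1,4)] assms(2,3) by (simp add: inv_commutator)

lemma commutator_mem_commute:
  assumes "subgroup S G" "a \<in> carrier G" "b \<in> carrier G"
  shows "commutator G a b \<in> S \<longleftrightarrow> commutator G b a \<in> S"
  using commutator_mem_sym assms by blast

lemma commutator_generate_left:
  assumes "S \<lhd> G" "b \<in> carrier G" "C \<subseteq> carrier G" "a \<in> generate G C"
    and "\<And>c. c \<in> C \<Longrightarrow> commutator G c b \<in> S"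
  shows "commutator G a b \<in> S"
proof -
  have "generate G C \<subseteq> {a \<in> carrier G. commutator G a b \<in> S}"
    using assms by (intro generate_subgroup_incl subgroup_commutes_modulo) auto
  with assms(4) show ?thesis by auto
qed

lemma commutator_generate_right:
  assumes "S \<lhd> G" "b \<in> carrier G" "C \<subseteq> carrier G" "a \<in> generate G C"
    and "\<And>c. c \<in> C \<Longrightarrow> commutator G b c \<in> S"
  shows "commutator G b a \<in> S"
proof -
  have S: "subgroup S G" using assms(1) by (rule normal_imp_subgroup)
  have "commutator G a b \<in> S"
    using assms commutator_mem_sym[OF S] by (intro commutator_generate_left[OF assms(1-4)]) auto
  moreover have "a \<in> carrier G" using assms generate_in_carrier by blast
  ultimately show ?thesis using commutator_mem_sym[OF S] assms(2) by blast
qed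

lemma commutator_mult_left_mem:
  assumes "S \<lhd> G" "a \<in> carrier G" "a' \<in> carrier G" "b \<in> carrier G"
    and "commutator G a b \<in> S" "commutator G a' b \<in> S"
  shows "commutator G (a \<otimes> a') b \<in> S"
  using subgroup.m_closed[OF subgroup_commutes_modulo[OF assms(1,4)], of a a'] assms by auto

lemma commutator_mult_right_mem:
  assumes "S \<lhd> G" "a \<in> carrier G" "b \<in> carrier G" "b' \<in> carrier G"
    and "commutator G a b \<in> S" "commutator G a b' \<in> S"
  shows "commutator G a (b \<otimes> b') \<in> S"
  using assms commutator_mult_left_mem[OF assms(1,3,4,2)] commutator_mem_sym[OF normal_imp_subgroup[OF assms(1)]]
  by (meson m_closed)

lemma subgroup_lower_central: "subgroup (lower_central G m) G"
  using normal_lower_central by (rule normal_imp_subgroup)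

lemma lower_central_subset: "a \<in> lower_central G m \<Longrightarrow> a \<in> carrier G"
  using subgroup_lower_central subgroup.mem_carrier by metis

lemma lower_central_Suc:
  assumes "m \<ge> 1"
  shows "lower_central G (Suc m) =
    generate G {commutator G h g | h g. h \<in> lower_central G m \<and> g \<in> carrier G}"
proof -
  obtain p where "m = Suc p" using assms by (cases m) auto
  moreover have "(\<Union>h \<in> lower_central G m. \<Union>g \<in> carrier G. {h \<otimes> g \<otimes> inv h \<otimes> inv g})
     = {commutator G h g | h g. h \<in> lower_central G m \<and> g \<in> carrier G}"
    by (auto simp: commutator_def)
  ultimately show ?thesis by simp
qed

lemma commutator_lower_central_Suc:
  assumes "m \<ge> 1" "h \<in> lower_central G m" "g \<in> carrier G"
  shows "commutator G h g \<in> lower_central G (Suc m)" "commutator G g h \<in> lower_central G (Suc m)"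
proof -
  show 1: "commutator G h g \<in> lower_central G (Suc m)"
    unfolding lower_central_Suc[OF assms(1)] using assms by (blast intro: generate.incl)
  show "commutator G g h \<in> lower_central G (Suc m)"
    using commutator_mem_sym[OF subgroup_lower_central _ _ 1] assms lower_central_subset by blast
qed

lemma lower_central_Suc_subset: "lower_central G (Suc m) \<subseteq> lower_central G m"
proof (cases "m = 0")
  case False
  interpret L: normal "lower_central G m" G by (rule normal_lower_central)
  have "commutator G h g \<in> lower_central G m" if "h \<in> lower_central G m" "g \<in> carrier G" for h g
  proof -
    have "commutator G h g = h \<otimes> (g \<otimes> inv h \<otimes> inv g)"
      using that by (simp add: commutator_def m_assoc)
    moreover have "g \<otimes> inv h \<otimes> inv g \<in> lower_central G m"
      using that by (intro L.inv_op_closed2) auto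
    ultimately show ?thesis using that by simp
  qed
  moreover have "lower_central G (Suc m) =
    generate G {commutator G h g | h g. h \<in> lower_central G m \<and> g \<in> carrier G}"
    using False by (intro lower_central_Suc) simp
  ultimately show ?thesis
    using generate_subgroup_incl[OF _ L.subgroup_axioms,
      of "{commutator G h g | h g. h \<in> lower_central G m \<and> g \<in> carrier G}"] by blast
qed simp

lemma lower_central_antimono: "m \<le> m' \<Longrightarrow> lower_central G m' \<subseteq> lower_central G m"
  using lift_Suc_antimono_le[of "lower_central G"] lower_central_Suc_subset by blast

text \<open>The lower central series is a central filtration: \<open>[\<gamma>\<^sub>i, \<gamma>\<^sub>j] \<subseteq> \<gamma>\<^bsub>i+j\<^esub>\<close>. By
  induction on \<open>i\<close> it is enough to treat \<open>[[h, g], b]\<close> with \<open>h \<in> \<gamma>\<^sub>i\<close> and \<open>b \<in> \<gamma>\<^sub>j\<close>; the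
  Hall--Witt identity writes it through commutators in which \<open>g\<close> has joined \<open>b\<close> or has moved
  outside.\<close>

lemma commutator_lower_central:
  assumes "i \<ge> 1" "j \<ge> 1" "a \<in> lower_central G i" "b \<in> lower_central G j"
  shows "commutator G a b \<in> lower_central G (i + j)"
  using assms
proof (induction i arbitrary: j a b rule: nat_induct_at_least)
  case base
  then show ?case using commutator_lower_central_Suc(2)[of j b a] by simp
next
  case (Suc i)
  interpret S: normal "lower_central G (Suc i + j)" G by (rule normal_lower_central)
  note sub = lower_central_subset
  have "commutator G (commutator G h g) b \<in> lower_central G (Suc i + j)"
    if hg: "h \<in> lower_central G i" "g \<in> carrier G" for h g
  proof -
    define z where "z = inv g \<otimes> b \<otimes> g"
    have h: "h \<in> carrier G" using hg sub by blast
    have z: "z \<in> lower_central G j" unfolding z_def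
      using Suc.prems hg by (intro normal.inv_op_closed1 normal_lower_central)
    then have zc: "z \<in> carrier G" by (rule sub)
    have b: "g \<otimes> z \<otimes> inv g = b" "b \<in> carrier G"
      using hg Suc.prems sub[of b j] by (auto simp: z_def m_assoc mult_inv_cancel)
    let ?p = "commutator G (commutator G g z) (z \<otimes> h \<otimes> inv z)"
    let ?q = "commutator G (commutator G z h) (h \<otimes> g \<otimes> inv h)"
    have "z \<otimes> h \<otimes> inv z \<in> lower_central G i"
      using zc hg by (intro normal.inv_op_closed2 normal_lower_central)
    moreover have gz: "commutator G g z \<in> lower_central G (Suc j)"
      using Suc.prems z hg by (intro commutator_lower_central_Suc)
    ultimately have "commutator G (z \<otimes> h \<otimes> inv z) (commutator G g z) \<in> lower_central G (i + Suc j)"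
      by (intro Suc.IH) simp_all
    then have p: "?p \<in> lower_central G (Suc i + j)"
      using h zc hg by (subst commutator_mem_commute[OF subgroup_lower_central]) auto
    have "commutator G h z \<in> lower_central G (i + j)"
      using Suc hg z by simp
    then have "commutator G z h \<in> lower_central G (i + j)"
      using h zc by (subst commutator_mem_commute[OF subgroup_lower_central]) auto
    then have q: "?q \<in> lower_central G (Suc i + j)"
      using commutator_lower_central_Suc(1)[of "i + j" "commutator G z h" "h \<otimes> g \<otimes> inv h"] Suc.hyps h hg by simp
    have c: "?p \<in> carrier G" "?q \<in> carrier G" "commutator G (commutator G h g) b \<in> carrier G"
      using h zc hg b by auto
    have "commutator G (commutator G h g) b \<otimes> (?p \<otimes> ?q) = \<one>"
      using hall_witt[OF h hg(2) zc] b c by (simp add: m_assoc)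
    then have "commutator G (commutator G h g) b = inv (?p \<otimes> ?q)"
      using c by (intro inv_equality[symmetric]) auto
    then show ?thesis using S.m_inv_closed[OF S.m_closed[OF p q]] by simp
  qed
  moreover have "a \<in> generate G {commutator G h g | h g. h \<in> lower_central G i \<and> g \<in> carrier G}"
    using Suc lower_central_Suc[of i] by simp
  ultimately show ?case
    using commutator_generate_left[OF normal_lower_central, of b
      "{commutator G h g | h g. h \<in> lower_central G i \<and> g \<in> carrier G}" a "Suc i + j"]
      Suc.prems sub by fastforce
qed

text \<open>Conjugation changes an element of \<open>\<gamma>\<^sub>m\<close> only by a factor in \<open>\<gamma>\<^bsub>m+1\<^esub>\<close>.\<close>

lemma normal_between_lower_central:
  assumes "m \<ge> 1" "subgroup S G" "lower_central G (Suc m) \<subseteq> S" "S \<subseteq> lower_central G m"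
  shows "S \<lhd> G"
  unfolding normal_inv_iff
proof (intro conjI ballI assms(2))
  fix g s assume g: "g \<in> carrier G" and s: "s \<in> S"
  have "s \<in> lower_central G m" using s assms(4) by blast
  then have "commutator G g s \<in> S" "s \<in> carrier G"
    using commutator_lower_central_Suc(2)[OF assms(1) _ g] assms(3) lower_central_subset by blast+
  then show "g \<otimes> s \<otimes> inv g \<in> S"
    using conj_eq_commutator_mult g s subgroup.m_closed[OF assms(2)] by simp
qed

text \<open>The Jacobi identity of the graded Lie ring \<open>\<Oplus> \<gamma>\<^sub>i / \<gamma>\<^bsub>i+1\<^esub>\<close>, stated as a membership so
  that no calculation modulo a subgroup is needed: conjugating an entry of a triple commutator
  changes it only by commutators of higher weight.\<close>

lemma jacobi_mem:
  assumes S: "S \<lhd> G" "lower_central G (Suc (i + j + l)) \<subseteq> S"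
    and pos: "i \<ge> 1" "j \<ge> 1" "l \<ge> 1"
    and mem: "a \<in> lower_central G i" "b \<in> lower_central G j" "c \<in> lower_central G l"
    and 1: "commutator G (commutator G a c) b \<in> S"
    and 2: "commutator G a (commutator G b c) \<in> S"
  shows "commutator G (commutator G a b) c \<in> S"
proof -
  have C: "a \<in> carrier G" "b \<in> carrier G" "c \<in> carrier G" using mem lower_central_subset by blast+
  interpret S: normal S G by fact
  note Ss = S.subgroup_axioms
  have deep: "x \<in> S" if "x \<in> lower_central G m" "m \<ge> Suc (i + j + l)" for x m
    using lower_central_antimono[OF that(2)] that(1) S(2) by blast
  have ab: "commutator G a b \<in> lower_central G (i + j)"
    and bc: "commutator G b c \<in> lower_central G (j + l)"
    and ca: "commutator G c a \<in> lower_central G (l + i)"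
    using mem pos commutator_lower_central by simp_all
  have cab: "commutator G (commutator G c a) b \<in> S"
    using subgroup.m_inv_closed[OF subgroup_commutes_modulo[OF S(1) C(2)], of "commutator G a c"] 1 C
    by (simp add: inv_commutator)
  have bca: "commutator G (commutator G b c) a \<in> S"
    using 2 C by (subst commutator_mem_commute[OF Ss]) auto
  let ?p = "commutator G (commutator G b c) (c \<otimes> a \<otimes> inv c)"
  let ?q = "commutator G (commutator G c a) (a \<otimes> b \<otimes> inv a)"
  let ?r = "commutator G (commutator G a b) (b \<otimes> c \<otimes> inv b)"
  have "commutator G (commutator G b c) (commutator G c a) \<in> S"
    using commutator_lower_central[OF _ _ bc ca] pos by (intro deep) auto
  then have p: "?p \<in> S"
    unfolding conj_eq_commutator_mult[OF C(3,1)]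
    using bca C by (intro commutator_mult_right_mem S) auto
  have "commutator G (commutator G c a) (commutator G a b) \<in> S"
    using commutator_lower_central[OF _ _ ca ab] pos by (intro deep) auto
  then have q: "?q \<in> S"
    unfolding conj_eq_commutator_mult[OF C(1,2)]
    using cab C by (intro commutator_mult_right_mem S) auto
  have "?r \<otimes> (?p \<otimes> ?q) = \<one>"
    using hall_witt[OF C] C by (simp add: m_assoc)
  then have "?r = inv (?p \<otimes> ?q)" using C by (intro inv_equality[symmetric]) auto
  then have r: "?r \<in> S" using S.m_inv_closed[OF S.m_closed[OF p q]] by simp
  have "commutator G (commutator G a b) (commutator G c b) \<in> S"
    using commutator_lower_central[OF _ _ ab, of "l + j" "commutator G c b"]
      commutator_lower_central[OF _ _ mem(3,2)] pos by (intro deep) auto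
  then have "commutator G (commutator G a b) (commutator G c b \<otimes> (b \<otimes> c \<otimes> inv b)) \<in> S"
    using r C commutator_mult_right_mem[OF S(1), of "commutator G a b" "commutator G c b" "b \<otimes> c \<otimes> inv b"]
    by simp
  moreover have "commutator G c b \<otimes> (b \<otimes> c \<otimes> inv b) = c"
    using C by (simp add: commutator_def m_assoc mult_inv_cancel)
  ultimately show ?thesis by simp
qed

end


section \<open>Lyndon words\<close>

lemma append_less_append_iff [simp]:
  fixes a b :: "'a::linorder list"
  shows "u @ a < u @ b \<longleftrightarrow> a < b"
  by (induction u) auto

lemma less_append: "b \<noteq> [] \<Longrightarrow> u < u @ (b :: 'a::linorder list)"
  by (induction u) (auto simp: neq_Nil_conv)

text \<open>If \<open>u\<close> is not a prefix of the larger word \<open>v\<close>, the two differ at some position, and what is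
  appended to them does not matter.\<close>

lemma append_less_append:
  fixes u v :: "'a::linorder list"
  shows "u < v \<Longrightarrow> (\<And>t. v \<noteq> u @ t) \<Longrightarrow> u @ a < v @ b"
proof (induction u arbitrary: v)
  case (Cons x u)
  then show ?case by (cases v) auto
qed auto

lemma append_less_append_length:
  fixes u v :: "'a::linorder list"
  assumes "u < v" "length v \<le> length u"
  shows "u @ a < v @ b"
  using assms by (intro append_less_append) auto

definition proper_suffixes :: "'a list \<Rightarrow> 'a list set" where
  "proper_suffixes w = {v. v \<noteq> [] \<and> (\<exists>u. u \<noteq> [] \<and> w = u @ v)}"

lemma proper_suffixes_appendI: "u \<noteq> [] \<Longrightarrow> v \<noteq> [] \<Longrightarrow> v \<in> proper_suffixes (u @ v)"
  by (auto simp: proper_suffixes_def)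

lemma proper_suffixes_append_left: "v \<in> proper_suffixes w \<Longrightarrow> v @ t \<in> proper_suffixes (w @ t)"
  by (auto simp: proper_suffixes_def)

lemma proper_suffixes_append_right: "t \<in> proper_suffixes v \<Longrightarrow> t \<in> proper_suffixes (u @ v)"
  unfolding proper_suffixes_def
  by (smt (verit) append_assoc append_is_Nil_conv mem_Collect_eq)

lemma proper_suffixes_append_cases:
  assumes "s \<in> proper_suffixes (u @ v)"
  obtains "s \<in> proper_suffixes v" | "s = v" | t where "t \<in> proper_suffixes u" "s = t @ v"
proof -
  obtain r where r: "u @ v = r @ s" "r \<noteq> []" "s \<noteq> []" using assms by (auto simp: proper_suffixes_def)
  from r(1) consider t where "u = r @ t" "s = t @ v" | t where "r = u @ t" "v = t @ s"
    by (auto simp: append_eq_append_conv2)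
  then show ?thesis
  proof cases
    case (1 t)
    then show ?thesis using r that(2,3) proper_suffixes_appendI[of r t] by (cases "t = []") auto
  next
    case (2 t)
    then show ?thesis using r that(1,2) proper_suffixes_appendI[of t s] by (cases "t = []") auto
  qed
qed

lemma length_proper_suffix: "v \<in> proper_suffixes w \<Longrightarrow> length v < length w"
  by (auto simp: proper_suffixes_def)

lemma finite_proper_suffixes: "finite (proper_suffixes w)"
proof (rule finite_subset)
  show "proper_suffixes w \<subseteq> (\<lambda>i. drop i w) ` {..length w}"
  proof
    fix v assume "v \<in> proper_suffixes w"
    then obtain u where "w = u @ v" by (auto simp: proper_suffixes_def)
    then have "v = drop (length u) w" "length u \<le> length w" by auto
    then show "v \<in> (\<lambda>i. drop i w) ` {..length w}" by blast
  qed
qed simp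

lemma proper_suffixes_nonempty: "length w \<ge> 2 \<Longrightarrow> proper_suffixes w \<noteq> {}"
  using proper_suffixes_appendI[of "[hd w]" "tl w"] by (cases w; cases "tl w") auto

definition lyndon :: "'a::linorder list \<Rightarrow> bool" where
  "lyndon w \<longleftrightarrow> w \<noteq> [] \<and> (\<forall>v \<in> proper_suffixes w. w < v)"

lemma lyndon_letter: "lyndon [i]"
  by (auto simp: lyndon_def proper_suffixes_def Cons_eq_append_conv)

text \<open>The essential inequality is \<open>uv < v\<close>. It is clear when \<open>u\<close> and \<open>v\<close> differ at some position; if
  \<open>v = ut\<close>, it amounts to \<open>v < t\<close>, which holds because \<open>v\<close> is Lyndon.\<close>

lemma lyndon_append:
  assumes "lyndon u" "lyndon v" "u < v"
  shows "lyndon (u @ v)"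
proof -
  have ne: "u \<noteq> []" "v \<noteq> []" using assms by (auto simp: lyndon_def)
  have uv: "u @ v < v"
  proof (cases "\<exists>t. v = u @ t")
    case True
    then obtain t where t: "v = u @ t" by blast
    with assms(3) have "t \<noteq> []" by auto
    then have "v < t" using assms(2) ne t unfolding lyndon_def by (auto intro: proper_suffixes_appendI)
    then show ?thesis using t by simp
  next
    case False
    then show ?thesis using append_less_append[of u v v "[]"] assms(3) by auto
  qed
  have "u @ v < s" if "s \<in> proper_suffixes (u @ v)" for s
    using that
  proof (cases rule: proper_suffixes_append_cases)
    case 1
    then show ?thesis using uv assms(2) by (auto simp: lyndon_def)
  next
    case (3 t)
    then have "u < t" "length t \<le> length u"
      using assms(1) length_proper_suffix by (auto simp: lyndon_def dest: less_imp_le_nat)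
    then show ?thesis using 3 by (simp add: append_less_append_length)
  qed (use uv in simp)
  then show ?thesis using ne by (auto simp: lyndon_def)
qed

text \<open>The standard factorization of a Lyndon word \<open>w\<close> is usually taken at its longest proper
  Lyndon suffix. That suffix is also the lexicographically least proper suffix. With the latter
  description one sees at once how the factorization of \<open>uv\<close> depends on that of \<open>u\<close>.\<close>

definition right_factor :: "'a::linorder list \<Rightarrow> 'a list" where
  "right_factor w = Min (proper_suffixes w)"

definition left_factor :: "'a::linorder list \<Rightarrow> 'a list" where
  "left_factor w = take (length w - length (right_factor w)) w"

lemma right_factor_mem: "length w \<ge> 2 \<Longrightarrow> right_factor w \<in> proper_suffixes w"
  unfolding right_factor_def by (intro Min_in finite_proper_suffixes proper_suffixes_nonempty)

lemma right_factor_le: "v \<in> proper_suffixes w \<Longrightarrow> right_factor w \<le> v"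
  unfolding right_factor_def by (intro Min_le finite_proper_suffixes)

lemma left_right_factor:
  assumes "length w \<ge> 2"
  shows "w = left_factor w @ right_factor w" "left_factor w \<noteq> []" "right_factor w \<noteq> []"
    "length (left_factor w) < length w" "length (right_factor w) < length w"
proof -
  obtain u where "right_factor w \<noteq> []" "u \<noteq> []" "w = u @ right_factor w"
    using right_factor_mem[OF assms] by (auto simp: proper_suffixes_def)
  moreover from this(3) have "u = left_factor w"
    unfolding left_factor_def by (metis append_eq_conv_conj length_append add_diff_cancel_right')
  ultimately show "w = left_factor w @ right_factor w" "left_factor w \<noteq> []" "right_factor w \<noteq> []"
    by auto
  then show "length (left_factor w) < length w" "length (right_factor w) < length w"
    by (metis length_append length_greater_0_conv less_add_same_cancel1 less_add_same_cancel2)+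
qed

text \<open>Let \<open>w = uv\<close> with least proper suffix \<open>v\<close>. The point is that \<open>u\<close> is Lyndon.
  A proper suffix \<open>s < u\<close> of \<open>u\<close> would have to be a
  prefix of \<open>u\<close>, for otherwise \<open>sv < uv\<close>. But if \<open>u = st\<close>, then \<open>uv < sv\<close> gives \<open>tv < v\<close>, against
  the minimality of \<open>v\<close>.\<close>

lemma lyndon_factors:
  assumes "lyndon w" "length w \<ge> 2"
  shows "lyndon (left_factor w)" "lyndon (right_factor w)" "left_factor w < right_factor w"
proof -
  define u v where "u = left_factor w" and "v = right_factor w"
  note w = left_right_factor[OF assms(2), folded u_def v_def]
  have v_less: "v < s" if "s \<in> proper_suffixes w" "s \<noteq> v" for s
    using right_factor_le[OF that(1)] that(2) by (simp add: v_def)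
  have "v < s" if "s \<in> proper_suffixes v" for s
    using v_less[of s] proper_suffixes_append_right[OF that, of u] length_proper_suffix[OF that] w(1)
    by auto
  then show "lyndon (right_factor w)" unfolding v_def[symmetric] lyndon_def using w(3) by blast
  have "u < s" if s: "s \<in> proper_suffixes u" for s
  proof (rule ccontr)
    assume "\<not> u < s"
    moreover have "s \<noteq> u" using length_proper_suffix[OF s] by auto
    ultimately have "s < u" by simp
    have sv: "s @ v \<in> proper_suffixes w"
      using proper_suffixes_append_left[OF s, of v] w(1) by simp
    then have "u @ v < s @ v" using assms(1) w(1) by (simp add: lyndon_def)
    then obtain t where t: "u = s @ t"
      using append_less_append[OF \<open>s < u\<close>, of v v] by (meson order_less_asym)
    then have "t @ v < v" using \<open>u @ v < s @ v\<close> by simp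
    moreover have "t @ v \<in> proper_suffixes w"
      using s t w(1,3) proper_suffixes_appendI[of s "t @ v"] by (simp add: proper_suffixes_def)
    ultimately show False using right_factor_le[of "t @ v" w] v_def by simp
  qed
  then show "lyndon (left_factor w)" unfolding u_def[symmetric] lyndon_def using w(2) by blast
  have "w < v" using assms(1) right_factor_mem[OF assms(2)] unfolding lyndon_def v_def by blast
  have "u < u @ v" using w(3) by (rule less_append)
  also have "u @ v < v" using \<open>w < v\<close> w(1) by metis
  finally show "left_factor w < right_factor w" by (simp add: u_def v_def)
qed

text \<open>A proper suffix of \<open>uv\<close> longer than \<open>v\<close> is \<open>tv\<close> for a proper suffix \<open>t\<close> of \<open>u\<close>, and it exceeds
  \<open>t\<close>, hence the right factor of \<open>u\<close>, hence \<open>v\<close>.\<close>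

lemma standard_factorization_append:
  assumes "lyndon v" "u \<noteq> []" "length u = 1 \<or> v \<le> right_factor u"
  shows "right_factor (u @ v) = v" "left_factor (u @ v) = u"
proof -
  have v: "v \<noteq> []" "\<And>s. s \<in> proper_suffixes v \<Longrightarrow> v < s" using assms(1) by (auto simp: lyndon_def)
  show *: "right_factor (u @ v) = v"
    unfolding right_factor_def
  proof (rule Min_eqI[OF finite_proper_suffixes])
    show "v \<in> proper_suffixes (u @ v)" using assms(2) v by (intro proper_suffixes_appendI)
    fix s assume "s \<in> proper_suffixes (u @ v)"
    then show "v \<le> s"
    proof (cases rule: proper_suffixes_append_cases)
      case 1
      then show ?thesis using v by fastforce
    next
      case (3 t)
      then have "length u \<noteq> 1" by (auto simp: proper_suffixes_def add_is_1)
      then have "v \<le> t" using assms(3) right_factor_le[OF 3(1)] by simp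
      also have "t < t @ v" using v by (intro less_append)
      finally show ?thesis using 3 by simp
    qed simp
  qed
  show "left_factor (u @ v) = u" by (simp add: left_factor_def *)
qed


section \<open>Lyndon commutators generate the lower central factors\<close>

function lyndon_commutator :: "('a, 'b) monoid_scheme \<Rightarrow> ('i::linorder \<Rightarrow> 'a) \<Rightarrow> 'i list \<Rightarrow> 'a" where
  "lyndon_commutator G x w = (if length w \<ge> 2
     then commutator G (lyndon_commutator G x (left_factor w)) (lyndon_commutator G x (right_factor w))
     else x (hd w))"
  by auto
termination
  by (relation "measure (\<lambda>(G, x, w). length w)") (auto simp: left_right_factor)

declare lyndon_commutator.simps [simp del]

lemma lyndon_commutator_letter [simp]: "lyndon_commutator G x [i] = x i"
  by (simp add: lyndon_commutator.simps)

text \<open>Including \<open>\<gamma>\<^bsub>m+1\<^esub>\<close> among the generators makes this the full preimage of a span in the abelian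
  quotient \<open>\<gamma>\<^sub>m / \<gamma>\<^bsub>m+1\<^esub>\<close>. The predicate \<open>P\<close> carries the bounds on the Lyndon words that the
  rewriting argument keeps track of.\<close>

definition (in group) lyndon_span :: "('i::linorder \<Rightarrow> 'a) \<Rightarrow> 'i set \<Rightarrow> nat \<Rightarrow> ('i list \<Rightarrow> bool) \<Rightarrow> 'a set" where
  "lyndon_span x I m P = generate G (lower_central G (Suc m) \<union>
     lyndon_commutator G x ` {w \<in> lists I. lyndon w \<and> length w = m \<and> P w})"

context group
begin

lemma lyndon_commutator_mem:
  assumes "x ` I \<subseteq> carrier G" "w \<in> lists I" "w \<noteq> []"
  shows "lyndon_commutator G x w \<in> lower_central G (length w)"
  using assms(2,3)
proof (induction "length w" arbitrary: w rule: less_induct)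
  case less
  show ?case
  proof (cases "length w \<ge> 2")
    case True
    note f = left_right_factor[OF True]
    have "left_factor w \<in> lists I" "right_factor w \<in> lists I"
      using less.prems(1) f(1) by (metis append_in_lists_conv)+
    then have "lyndon_commutator G x w \<in> lower_central G (length (left_factor w) + length (right_factor w))"
      using True f less.hyps
      by (subst lyndon_commutator.simps) (auto intro!: commutator_lower_central simp: Suc_le_eq)
    then show ?thesis using f(1) by (metis length_append)
  next
    case False
    then obtain i where "w = [i]" using less.prems by (cases w; cases "tl w") auto
    then show ?thesis using less.prems assms(1) by auto
  qed
qed

lemma lyndon_span_generators_subset:
  assumes "x ` I \<subseteq> carrier G" "m \<ge> 1"
  shows "lower_central G (Suc m) \<union> lyndon_commutator G x ` {w \<in> lists I. lyndon w \<and> length w = m \<and> P w}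
    \<subseteq> lower_central G m"
proof -
  have "lyndon_commutator G x w \<in> lower_central G m" if "w \<in> lists I" "lyndon w" "length w = m" for w
    using lyndon_commutator_mem[OF assms(1) that(1)] that by (simp add: lyndon_def)
  then show ?thesis using lower_central_Suc_subset by auto
qed

lemma lyndon_span_subset:
  assumes "x ` I \<subseteq> carrier G" "m \<ge> 1"
  shows "lyndon_span x I m P \<subseteq> lower_central G m"
  unfolding lyndon_span_def
  using lyndon_span_generators_subset[OF assms] subgroup_lower_central by (rule generate_subgroup_incl)

lemma lower_central_subset_lyndon_span: "lower_central G (Suc m) \<subseteq> lyndon_span x I m P"
  unfolding lyndon_span_def by (auto intro: generate.incl)

lemma lyndon_commutator_mem_span:
  "w \<in> lists I \<Longrightarrow> lyndon w \<Longrightarrow> P w \<Longrightarrow> lyndon_commutator G x w \<in> lyndon_span x I (length w) P"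
  unfolding lyndon_span_def by (auto intro: generate.incl)

lemma normal_lyndon_span:
  assumes "x ` I \<subseteq> carrier G" "m \<ge> 1"
  shows "lyndon_span x I m P \<lhd> G"
proof (rule normal_between_lower_central[OF assms(2)])
  have "lower_central G (Suc m) \<union> lyndon_commutator G x ` {w \<in> lists I. lyndon w \<and> length w = m \<and> P w}
    \<subseteq> carrier G"
    using lyndon_span_generators_subset[OF assms] lower_central_subset by blast
  then show "subgroup (lyndon_span x I m P) G"
    unfolding lyndon_span_def by (rule generate_is_subgroup)
qed (rule lower_central_subset_lyndon_span, rule lyndon_span_subset[OF assms])

lemma lyndon_span_mono: "(\<And>w. w \<in> lists I \<Longrightarrow> P w \<Longrightarrow> Q w) \<Longrightarrow> lyndon_span x I m P \<subseteq> lyndon_span x I m Q"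
  unfolding lyndon_span_def by (intro mono_generate) auto

lemma commutator_lyndon_span_left:
  assumes x: "x ` I \<subseteq> carrier G" "S \<lhd> G" "lower_central G (Suc (m + j)) \<subseteq> S"
    and "m \<ge> 1" "j \<ge> 1" "a \<in> lyndon_span x I m P" "b \<in> lower_central G j"
    and *: "\<And>w. w \<in> lists I \<Longrightarrow> lyndon w \<Longrightarrow> length w = m \<Longrightarrow> P w \<Longrightarrow> commutator G (lyndon_commutator G x w) b \<in> S"
  shows "commutator G a b \<in> S"
proof (rule commutator_generate_left[OF x(2)])
  show "a \<in> generate G (lower_central G (Suc m) \<union>
     lyndon_commutator G x ` {w \<in> lists I. lyndon w \<and> length w = m \<and> P w})"
    using assms(6) by (simp add: lyndon_span_def)
  show "b \<in> carrier G" using assms(7) lower_central_subset by blast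
  show "lower_central G (Suc m) \<union>
     lyndon_commutator G x ` {w \<in> lists I. lyndon w \<and> length w = m \<and> P w} \<subseteq> carrier G"
    using lyndon_span_generators_subset[OF x(1) assms(4)] lower_central_subset by blast
  show "commutator G c b \<in> S" if "c \<in> lower_central G (Suc m) \<union>
     lyndon_commutator G x ` {w \<in> lists I. lyndon w \<and> length w = m \<and> P w}" for c
    using that commutator_lower_central[OF _ assms(5) _ assms(7), of "Suc m" c] x(3) * by auto
qed

text \<open>This is the rewriting step behind the theorem of Chen, Fox and Lyndon. If \<open>(u, v)\<close> is the
  standard factorization of \<open>uv\<close>, then \<open>[c\<^sub>u, c\<^sub>v]\<close> is the Lyndon commutator of \<open>uv\<close>. Otherwise
  \<open>u\<close> has standard factorization \<open>(u', u'')\<close> with \<open>u' < u'' < v\<close>, and the Jacobi identity replaces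
  \<open>[[c\<^bsub>u'\<^esub>, c\<^bsub>u''\<^esub>], c\<^sub>v]\<close> by \<open>[[c\<^bsub>u'\<^esub>, c\<^sub>v], c\<^bsub>u''\<^esub>]\<close> and \<open>[c\<^bsub>u'\<^esub>, [c\<^bsub>u''\<^esub>, c\<^sub>v]]\<close>.
  The inner commutators are shorter, hence spanned by \<open>c\<^sub>w\<close> with \<open>w < v\<close>, which leaves brackets
  of two Lyndon commutators of the same total length whose indices are both smaller than \<open>v\<close>.
  The bound \<open>w < v\<close> in the conclusion is what makes the induction on \<open>(\<bar>u\<bar> + \<bar>v\<bar>, v)\<close> work.\<close>

lemma commutator_lyndon_mem_span:
  assumes x: "x ` I \<subseteq> carrier G" and I: "finite I"
    and "u \<in> lists I" "v \<in> lists I" "lyndon u" "lyndon v" "u < v"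
  shows "commutator G (lyndon_commutator G x u) (lyndon_commutator G x v)
    \<in> lyndon_span x I (length u + length v) (\<lambda>w. w < v)"
  using assms(3-)
proof (induction "(length u + length v, card {w \<in> lists I. length w \<le> length u + length v \<and> w < v})"
    arbitrary: u v rule: wf_induct_rule[OF wf_lex_prod[OF wf_less_than wf_less_than]])
  case 1
  note uv = 1(2-6)
  let ?c = "lyndon_commutator G x"
  define m where "m = length u + length v"
  let ?S = "lyndon_span x I m (\<lambda>w. w < v)"
  have ne: "u \<noteq> []" "v \<noteq> []" using uv by (auto simp: lyndon_def)
  have S: "?S \<lhd> G" using ne by (intro normal_lyndon_span[OF x]) (auto simp: m_def Suc_le_eq)
  interpret S: normal ?S G by (rule S)
  have c: "?c a \<in> carrier G" if "a \<in> lists I" "lyndon a" for a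
    using lyndon_commutator_mem[OF x, of a] that lower_central_subset by (auto simp: lyndon_def)
  have shorter: "commutator G (?c a) (?c b) \<in> lyndon_span x I (length a + length b) (\<lambda>w. w < b)"
    if "a \<in> lists I" "b \<in> lists I" "lyndon a" "lyndon b" "a < b" "length a + length b < m" for a b
    by (rule 1(1)) (use that in \<open>auto simp: m_def\<close>)
  have smaller: "commutator G (?c a) (?c b) \<in> ?S"
    if ab: "a \<in> lists I" "b \<in> lists I" "lyndon a" "lyndon b" "a < v" "b < v" "length a + length b = m" for a b
  proof -
    have less: "commutator G (?c a) (?c b) \<in> ?S"
      if ab: "a \<in> lists I" "b \<in> lists I" "lyndon a" "lyndon b" "b < v" "length a + length b = m" "a < b" for a b
    proof -
      have "length b \<le> m" using ab by simp
      \<comment> \<open>The lexicographic order is not well-founded on all words, so the induction measures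
        \<open>v\<close> by the number of smaller words of bounded length.\<close>
      have "card {w \<in> lists I. length w \<le> m \<and> w < b} < card {w \<in> lists I. length w \<le> m \<and> w < v}"
      proof (rule psubset_card_mono)
        have "{w \<in> lists I. length w \<le> m \<and> w < v} \<subseteq> {w. set w \<subseteq> I \<and> length w \<le> m}" by auto
        then show "finite {w \<in> lists I. length w \<le> m \<and> w < v}"
          using finite_lists_length_le[OF I] by (rule finite_subset)
        show "{w \<in> lists I. length w \<le> m \<and> w < b} \<subset> {w \<in> lists I. length w \<le> m \<and> w < v}"
          using ab(2,5) \<open>length b \<le> m\<close> by auto
      qed
      then have "commutator G (?c a) (?c b) \<in> lyndon_span x I (length a + length b) (\<lambda>w. w < b)"
        by (intro 1(1)) (use ab in \<open>auto simp: m_def\<close>)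
      also have "\<dots> \<subseteq> ?S"
        unfolding ab(6) using ab(5) by (intro lyndon_span_mono) auto
      finally show ?thesis .
    qed
    consider "a < b" | "a = b" | "b < a" by force
    then show ?thesis
    proof cases
      case 1
      then show ?thesis using ab less by blast
    next
      case 2
      then show ?thesis using ab c commutator_self by simp
    next
      case 3
      have "commutator G (?c b) (?c a) \<in> ?S" using ab 3 by (intro less) auto
      then show ?thesis using ab c by (subst commutator_mem_commute[OF S.subgroup_axioms]) auto
    qed
  qed
  show ?case
  proof (cases "length u = 1 \<or> v \<le> right_factor u")
    case True
    have "length (u @ v) \<ge> 2" using ne by (cases u; cases v) auto
    then have "?c (u @ v) = commutator G (?c u) (?c v)"
      using standard_factorization_append[OF uv(4) ne(1) True]
      by (subst lyndon_commutator.simps) simp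
    moreover have "u @ v < v"
      using lyndon_append[OF uv(3,4,5)] ne proper_suffixes_appendI[of u v] by (auto simp: lyndon_def)
    ultimately show ?thesis
      using lyndon_commutator_mem_span[of "u @ v" I "\<lambda>w. w < v" x] lyndon_append[OF uv(3,4,5)] uv
      by simp
  next
    case False
    define p q where "p = left_factor u" and "q = right_factor u"
    have len: "length u \<ge> 2" using False ne(1) by (cases u) (auto simp: Suc_le_eq)
    note u = left_right_factor[OF len, folded p_def q_def]
    note lyn = lyndon_factors[OF uv(3) len, folded p_def q_def]
    have qv: "q < v" using False by (auto simp: q_def not_le)
    then have pv: "p < v" using lyn(3) by simp
    have lists: "p \<in> lists I" "q \<in> lists I" using uv(1) u(1) by (metis append_in_lists_conv)+
    have m: "m = length p + length q + length v" using u(1) by (metis m_def length_append)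
    have mem: "?c p \<in> lower_central G (length p)" "?c q \<in> lower_central G (length q)"
      "?c v \<in> lower_central G (length v)"
      using lists uv(2) u ne by (auto intro!: lyndon_commutator_mem[OF x])
    have pos: "length p \<ge> 1" "length q \<ge> 1" "length v \<ge> 1" using u ne by (auto simp: Suc_le_eq)
    have deep: "lower_central G (Suc m) \<subseteq> ?S" by (rule lower_central_subset_lyndon_span)
    have "commutator G (commutator G (?c p) (?c v)) (?c q) \<in> ?S"
    proof (rule commutator_lyndon_span_left[OF x S _ _ pos(2) _ mem(2)])
      show "commutator G (?c p) (?c v) \<in> lyndon_span x I (length p + length v) (\<lambda>w. w < v)"
        using lists uv lyn pv pos m by (intro shorter) auto
      show "commutator G (?c w) (?c q) \<in> ?S"
        if "w \<in> lists I" "lyndon w" "length w = length p + length v" "w < v" for w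
        using that lists lyn qv m by (intro smaller) auto
    qed (use deep m pos in \<open>auto simp: add_ac\<close>)
    moreover have "commutator G (commutator G (?c q) (?c v)) (?c p) \<in> ?S"
    proof (rule commutator_lyndon_span_left[OF x S _ _ pos(1) _ mem(1)])
      show "commutator G (?c q) (?c v) \<in> lyndon_span x I (length q + length v) (\<lambda>w. w < v)"
        using lists uv lyn qv pos m by (intro shorter) auto
      show "commutator G (?c w) (?c p) \<in> ?S"
        if "w \<in> lists I" "lyndon w" "length w = length q + length v" "w < v" for w
        using that lists lyn pv m by (intro smaller) auto
    qed (use deep m pos in \<open>auto simp: add_ac\<close>)
    then have "commutator G (?c p) (commutator G (?c q) (?c v)) \<in> ?S"
      using c lists lyn uv by (subst commutator_mem_commute[OF S.subgroup_axioms]) auto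
    ultimately have "commutator G (commutator G (?c p) (?c q)) (?c v) \<in> ?S"
      using deep m by (intro jacobi_mem[OF S _ pos mem]) auto
    moreover have "?c u = commutator G (?c p) (?c q)"
      using len by (subst lyndon_commutator.simps) (simp add: p_def q_def)
    ultimately show ?thesis by (simp add: m_def)
  qed
qed

text \<open>Modulo \<open>\<gamma>\<^bsub>m+1\<^esub>\<close> the group \<open>\<gamma>\<^sub>m\<close> is generated by the Lyndon commutators of weight \<open>m\<close>: a
  commutator of a Lyndon commutator with a generator is a bracket of two Lyndon commutators.\<close>

lemma lower_central_eq_lyndon_span:
  assumes x: "x ` I \<subseteq> carrier G" and I: "finite I" and gen: "generate G (x ` I) = carrier G"
    and "m \<ge> 1"
  shows "lower_central G m = lyndon_span x I m (\<lambda>_. True)"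
  using assms(4)
proof (induction m rule: nat_induct_at_least)
  case base
  let ?S = "lyndon_span x I 1 (\<lambda>_. True)"
  have "x i \<in> ?S" if "i \<in> I" for i
    using lyndon_commutator_mem_span[of "[i]" I "\<lambda>_. True" x] that by (simp add: lyndon_letter)
  then have "generate G (x ` I) \<subseteq> ?S"
    using normal_lyndon_span[OF x, of 1] by (intro generate_subgroup_incl normal_imp_subgroup) auto
  then show ?case using gen lyndon_span_subset[OF x, of 1 "\<lambda>_. True"] by auto
next
  case (Suc m)
  let ?S = "lyndon_span x I (Suc m) (\<lambda>_. True)" and ?c = "lyndon_commutator G x"
  have S: "?S \<lhd> G" by (intro normal_lyndon_span[OF x]) simp
  note Ss = normal_imp_subgroup[OF S]
  have letter: "commutator G (?c w) (x i) \<in> ?S"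
    if w: "w \<in> lists I" "lyndon w" "length w = m" and i: "i \<in> I" for w i
  proof -
    have c: "?c w \<in> carrier G"
      using lyndon_commutator_mem[OF x w(1)] w(2) lower_central_subset by (auto simp: lyndon_def)
    have mono: "lyndon_span x I (Suc m) P \<subseteq> ?S" for P by (intro lyndon_span_mono) auto
    consider "w < [i]" | "w = [i]" | "[i] < w" by force
    then show ?thesis
    proof cases
      case 1
      then show ?thesis
        using commutator_lyndon_mem_span[OF x I w(1) _ w(2) lyndon_letter 1] i w(3) mono by auto
    next
      case 2
      then show ?thesis
        using c subgroup.one_closed[OF Ss] by (simp add: commutator_self)
    next
      case 3
      then have "commutator G (x i) (?c w) \<in> ?S"
        using commutator_lyndon_mem_span[OF x I _ w(1) lyndon_letter w(2) 3] i w(3) mono by auto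
      then show ?thesis using c x i by (subst commutator_mem_commute[OF Ss]) auto
    qed
  qed
  have "commutator G h g \<in> ?S" if h: "h \<in> lower_central G m" and g: "g \<in> carrier G" for h g
  proof (rule commutator_lyndon_span_left[OF x S, where j = 1])
    show "h \<in> lyndon_span x I m (\<lambda>_. True)" using h Suc by simp
    show "commutator G (?c w) g \<in> ?S" if w: "w \<in> lists I" "lyndon w" "length w = m" for w
    proof (rule commutator_generate_right[OF S])
      show "g \<in> generate G (x ` I)" using g gen by simp
      show "?c w \<in> carrier G"
        using lyndon_commutator_mem[OF x w(1)] w(2) lower_central_subset by (auto simp: lyndon_def)
    qed (use x w letter in auto)
  qed (use Suc.hyps g lower_central_subset_lyndon_span[of "Suc m"] in \<open>auto simp del: lower_central.simps(3)\<close>)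
  then have "lower_central G (Suc m) \<subseteq> ?S"
    unfolding lower_central_Suc[OF Suc.hyps] by (intro generate_subgroup_incl[OF _ Ss]) auto
  then show ?case using lyndon_span_subset[OF x, of "Suc m"] by auto
qed

end


section \<open>Noncommutative power series\<close>

text \<open>A function \<open>f\<close> on words stands for the formal power series \<open>\<Sum> f(w) w\<close> in noncommuting
  variables, and the product is the Cauchy product over all splittings of a word. The recursion
  on the word makes associativity a plain induction.\<close>

type_synonym 'i series = "'i list \<Rightarrow> int"

fun series_mult :: "'i series \<Rightarrow> 'i series \<Rightarrow> 'i series" where
  "series_mult f g [] = f [] * g []"
| "series_mult f g (a # w) = f [] * g (a # w) + series_mult (\<lambda>v. f (a # v)) g w"

definition series_one :: "'i series" where
  "series_one w = (if w = [] then 1 else 0)"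

lemma series_mult_eq_sum: "series_mult f g w = (\<Sum>t\<le>length w. f (take t w) * g (drop t w))"
  by (induction w arbitrary: f) (simp_all add: sum.atMost_Suc_shift del: sum.atMost_Suc)

lemma series_mult_add_left:
  "series_mult (\<lambda>v. f v + g v) h w = series_mult f h w + series_mult g h w"
  by (simp add: series_mult_eq_sum sum.distrib distrib_right)

lemma series_mult_diff_left:
  "series_mult (\<lambda>v. f v - g v) h w = series_mult f h w - series_mult g h w"
  by (simp add: series_mult_eq_sum sum_subtractf left_diff_distrib)

lemma series_mult_diff_right:
  "series_mult h (\<lambda>v. f v - g v) w = series_mult h f w - series_mult h g w"
  by (simp add: series_mult_eq_sum sum_subtractf right_diff_distrib)

lemma series_mult_scale_left: "series_mult (\<lambda>v. c * f v) g w = c * series_mult f g w"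
  by (simp add: series_mult_eq_sum sum_distrib_left mult.assoc)

lemma series_mult_zero_left: "series_mult (\<lambda>v. 0) g w = 0"
  by (simp add: series_mult_eq_sum)

lemma series_mult_assoc: "series_mult (series_mult f g) h = series_mult f (series_mult g h)"
proof
  fix w show "series_mult (series_mult f g) h w = series_mult f (series_mult g h) w"
  proof (induction w arbitrary: f)
    case (Cons a w)
    have "series_mult (\<lambda>v. series_mult f g (a # v)) h w =
        f [] * series_mult (\<lambda>v. g (a # v)) h w + series_mult (series_mult (\<lambda>v. f (a # v)) g) h w"
      by (simp add: series_mult_add_left series_mult_scale_left)
    then show ?case by (simp add: Cons.IH distrib_left mult.assoc)
  qed simp
qed

lemma series_mult_one_left [simp]: "series_mult series_one f = f"
proof
  fix w show "series_mult series_one f w = f w"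
    by (cases w) (simp_all add: series_one_def series_mult_zero_left)
qed

lemma series_mult_one_right [simp]: "series_mult f series_one = f"
proof
  fix w show "series_mult f series_one w = f w"
    by (induction w arbitrary: f) (simp_all add: series_one_def[abs_def])
qed

text \<open>Reversal of words is an anti-automorphism of the power series ring.\<close>

lemma series_mult_rev: "series_mult f g (rev w) = series_mult (\<lambda>v. g (rev v)) (\<lambda>v. f (rev v)) w"
proof -
  have "series_mult f g (rev w) = (\<Sum>t\<le>length w. f (rev (drop (length w - t) w)) * g (rev (take (length w - t) w)))"
    by (simp add: series_mult_eq_sum take_rev drop_rev)
  also have "\<dots> = (\<Sum>t\<le>length w. f (rev (drop t w)) * g (rev (take t w)))"
    by (rule sum.reindex_bij_witness[of _ "\<lambda>t. length w - t" "\<lambda>t. length w - t"]) auto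
  finally show ?thesis by (simp add: series_mult_eq_sum mult.commute)
qed

definition order_ge :: "nat \<Rightarrow> 'i series \<Rightarrow> bool" where
  "order_ge m f \<longleftrightarrow> (\<forall>w. length w < m \<longrightarrow> f w = 0)"

lemma series_mult_order:
  assumes "order_ge i f" "order_ge j g"
  shows "order_ge (i + j) (series_mult f g)"
    and "length w = i + j \<Longrightarrow> series_mult f g w = f (take i w) * g (drop i w)"
proof -
  have zero: "f (take t w) * g (drop t w) = 0" if "t \<le> length w" "t < i \<or> length w - t < j" for t w
    using assms that by (auto simp: order_ge_def)
  show "order_ge (i + j) (series_mult f g)"
    unfolding order_ge_def series_mult_eq_sum by (auto intro!: sum.neutral zero)
  assume w: "length w = i + j"
  have "series_mult f g w = (\<Sum>t\<le>length w. if t = i then f (take i w) * g (drop i w) else 0)"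
    unfolding series_mult_eq_sum
  proof (rule sum.cong)
    fix t assume "t \<in> {..length w}"
    then show "f (take t w) * g (drop t w) = (if t = i then f (take i w) * g (drop i w) else 0)"
      using zero[of t w] w by (cases t i rule: linorder_cases) auto
  qed simp
  then show "series_mult f g w = f (take i w) * g (drop i w)" using w by simp
qed


section \<open>The Magnus group and its filtration\<close>

definition magnus_group :: "'i series monoid" where
  "magnus_group = units_of \<lparr>carrier = UNIV, mult = series_mult, one = series_one\<rparr>"

lemma monoid_series: "monoid \<lparr>carrier = UNIV, mult = series_mult, one = series_one\<rparr>"
  by (rule monoidI) (auto simp: series_mult_assoc)

lemma group_magnus_group: "group magnus_group"
  unfolding magnus_group_def by (rule monoid.units_group[OF monoid_series])

interpretation magnus: group magnus_group by (rule group_magnus_group)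

lemma magnus_group_simps [simp]:
  "\<one>\<^bsub>magnus_group\<^esub> = series_one" "f \<otimes>\<^bsub>magnus_group\<^esub> g = series_mult f g"
  by (simp_all add: magnus_group_def units_of_def)

lemma magnus_groupI:
  assumes "series_mult f g = series_one" "series_mult g f = series_one"
  shows "f \<in> carrier magnus_group"
  using assms by (auto simp: magnus_group_def units_of_def Units_def)

definition magnus_filtration :: "nat \<Rightarrow> 'i series set" where
  "magnus_filtration m = {f \<in> carrier magnus_group. order_ge m (\<lambda>w. f w - series_one w)}"

lemma magnus_filtration_Nil: "f \<in> magnus_filtration m \<Longrightarrow> m \<ge> 1 \<Longrightarrow> f [] = 1"
  by (auto simp: magnus_filtration_def order_ge_def series_one_def split: if_splits)

lemma magnus_filtration_low:
  "f \<in> magnus_filtration m \<Longrightarrow> length w < m \<Longrightarrow> f w = series_one w"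
  by (auto simp: magnus_filtration_def order_ge_def)

lemma magnus_filtrationI:
  "f \<in> carrier magnus_group \<Longrightarrow> (\<And>w. length w < m \<Longrightarrow> f w = series_one w) \<Longrightarrow> f \<in> magnus_filtration m"
  by (auto simp: magnus_filtration_def order_ge_def)

lemma magnus_filtration_mult_low:
  assumes "f \<in> magnus_filtration m" "length w < m"
  shows "series_mult f g w = g w" "series_mult g f w = g w"
proof -
  let ?d = "\<lambda>w. f w - series_one w"
  have "order_ge m ?d" "order_ge 0 g" using assms by (auto simp: magnus_filtration_def order_ge_def)
  then have "order_ge m (series_mult ?d g)" "order_ge m (series_mult g ?d)"
    using series_mult_order(1) by fastforce+
  then show "series_mult f g w = g w" "series_mult g f w = g w"
    using assms(2) by (simp_all add: order_ge_def series_mult_diff_left series_mult_diff_right)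
qed

lemma magnus_filtration_mult_top:
  assumes "f \<in> magnus_filtration m" "length w = m"
  shows "series_mult f g w = g w + (f w - series_one w) * g []"
    "series_mult g f w = g w + g [] * (f w - series_one w)"
proof -
  let ?d = "\<lambda>w. f w - series_one w"
  have d: "order_ge m ?d" and g: "order_ge 0 g"
    using assms by (auto simp: magnus_filtration_def order_ge_def)
  show "series_mult f g w = g w + (f w - series_one w) * g []"
    "series_mult g f w = g w + g [] * (f w - series_one w)"
    using series_mult_order(2)[OF d g, of w] series_mult_order(2)[OF g d, of w] assms(2)
    by (simp_all add: series_mult_diff_left series_mult_diff_right)
qed

lemma subgroup_magnus_filtration: "subgroup (magnus_filtration m :: 'i series set) magnus_group"
proof (rule magnus.subgroupI)
  show "magnus_filtration m \<subseteq> (carrier magnus_group :: 'i series set)" by (auto simp: magnus_filtration_def)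
  have "series_one \<in> (magnus_filtration m :: 'i series set)"
    using magnus.one_closed by (auto intro: magnus_filtrationI)
  then show "magnus_filtration m \<noteq> ({} :: 'i series set)" by blast
  fix f :: "'i series" assume f: "f \<in> magnus_filtration m"
  then have fc: "f \<in> carrier magnus_group" by (simp add: magnus_filtration_def)
  then have "series_mult f (inv\<^bsub>magnus_group\<^esub> f) = series_one"
    using magnus.r_inv by simp
  then show "inv\<^bsub>magnus_group\<^esub> f \<in> magnus_filtration m"
    using magnus_filtration_mult_low(1)[OF f] fc by (intro magnus_filtrationI) (metis magnus.inv_closed)+
  fix g :: "'i series" assume g: "g \<in> magnus_filtration m"
  then have gc: "g \<in> carrier magnus_group" by (simp add: magnus_filtration_def)
  have "series_mult f g w = series_one w" if "length w < m" for w
    using magnus_filtration_mult_low(1)[OF f that] magnus_filtration_low[OF g that] by simp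
  then show "f \<otimes>\<^bsub>magnus_group\<^esub> g \<in> magnus_filtration m"
    using magnus.m_closed[OF fc gc] by (auto intro: magnus_filtrationI)
qed

text \<open>With \<open>c = [f, g]\<close> one has \<open>c - 1 = (fg - gf) (gf)\<inverse>\<close>. The first factor equals
  \<open>(f - 1)(g - 1) - (g - 1)(f - 1)\<close>, which has order at least \<open>i + j\<close>, and the second has constant
  term \<open>1\<close>. So the leading part of the commutator is the Lie bracket of the leading parts.\<close>

lemma commutator_leading_part:
  fixes f g :: "'i series"
  assumes f: "f \<in> magnus_filtration i" and g: "g \<in> magnus_filtration j" and pos: "i \<ge> 1" "j \<ge> 1"
  shows "order_ge (i + j) (\<lambda>w. commutator magnus_group f g w - series_one w)"
    and "length w = i + j \<Longrightarrow>
      commutator magnus_group f g w = f (take i w) * g (drop i w) - g (take j w) * f (drop j w)"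
proof -
  define p where "p w = series_mult f g w - series_mult g f w" for w
  define c where "c = commutator magnus_group f g"
  define r where "r = inv\<^bsub>magnus_group\<^esub> (series_mult g f)"
  have C: "f \<in> carrier magnus_group" "g \<in> carrier magnus_group"
    using f g by (auto simp: magnus_filtration_def)
  let ?f = "\<lambda>w. f w - series_one w" and ?g = "\<lambda>w. g w - series_one w"
  have fg: "order_ge i ?f" "order_ge j ?g" using f g by (auto simp: magnus_filtration_def)
  have p: "p w = series_mult ?f ?g w - series_mult ?g ?f w" for w
    by (simp add: p_def series_mult_diff_left series_mult_diff_right)
  have p_order: "order_ge (i + j) p"
    using series_mult_order(1)[OF fg] series_mult_order(1)[OF fg(2,1)]
    unfolding p[abs_def] by (auto simp: order_ge_def)
  have gf: "series_mult g f \<in> carrier magnus_group"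
    using magnus.m_closed[OF C(2,1)] by simp
  have rinv: "series_mult (series_mult g f) r = series_one"
    using magnus.r_inv[OF gf] by (simp add: r_def)
  have c: "c = series_mult (series_mult f g) r"
    using C magnus.inv_mult_group[OF C(2,1)] by (simp add: c_def commutator_def r_def series_mult_assoc)
  have "series_mult p r w = c w - series_one w" for w
    unfolding p_def by (simp add: series_mult_diff_left rinv flip: c)
  then have cp: "(\<lambda>w. commutator magnus_group f g w - series_one w) = series_mult p r"
    by (auto simp: c_def)
  have r0: "order_ge 0 r" by (simp add: order_ge_def)
  show "order_ge (i + j) (\<lambda>w. commutator magnus_group f g w - series_one w)"
    unfolding cp using series_mult_order(1)[OF p_order r0] by simp
  assume w: "length w = i + j"
  have "r [] = 1"
    using fun_cong[OF rinv, of "[]"] magnus_filtration_Nil[OF f pos(1)] magnus_filtration_Nil[OF g pos(2)]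
    by (simp add: series_one_def)
  then have "commutator magnus_group f g w - series_one w = p w"
    using series_mult_order(2)[OF p_order r0, of w] w by (simp add: fun_cong[OF cp])
  also have "\<dots> = f (take i w) * g (drop i w) - g (take j w) * f (drop j w)"
    unfolding p using w pos series_mult_order(2)[OF fg, of w] series_mult_order(2)[OF fg(2,1), of w]
    by (auto simp: series_one_def)
  finally show "commutator magnus_group f g w = f (take i w) * g (drop i w) - g (take j w) * f (drop j w)"
    using w pos by (cases "w = []") (simp_all add: series_one_def)
qed

lemma commutator_magnus_filtration:
  assumes "f \<in> magnus_filtration i" "g \<in> magnus_filtration j" "i \<ge> 1" "j \<ge> 1"
  shows "commutator magnus_group f g \<in> magnus_filtration (i + j)"
  using commutator_leading_part(1)[OF assms] assms
  by (simp add: magnus_filtration_def)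

definition magnus_gen :: "'i \<Rightarrow> 'i series" where
  "magnus_gen i w = (if w = [] \<or> w = [i] then 1 else 0)"

lemma magnus_gen_Nil [simp]: "magnus_gen i [] = 1"
  by (simp add: magnus_gen_def)

lemma magnus_gen_Cons: "magnus_gen i (a # w) = (if a = i \<and> w = [] then 1 else 0)"
  by (simp add: magnus_gen_def)

lemma magnus_gen_carrier [simp]: "magnus_gen i \<in> carrier magnus_group"
proof (rule magnus_groupI)
  \<comment> \<open>The inverse of \<open>1 + X\<^sub>i\<close> is the geometric series in \<open>- X\<^sub>i\<close>.\<close>
  let ?g = "\<lambda>w. if set w \<subseteq> {i} then (- 1) ^ length w else 0 :: int"
  have gen: "(\<lambda>v. magnus_gen i (a # v)) = (if a = i then series_one else (\<lambda>v. 0))" for a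
    by (auto simp: magnus_gen_def series_one_def)
  show "series_mult (magnus_gen i) ?g = series_one"
  proof
    fix w show "series_mult (magnus_gen i) ?g w = series_one w"
    proof (cases w)
      case (Cons a v)
      then show ?thesis by (cases "a = i") (simp_all add: gen series_mult_zero_left series_one_def)
    qed (simp add: series_one_def)
  qed
  have g: "(\<lambda>v. ?g (a # v)) = (if a = i then (\<lambda>v. (- 1) * ?g v) else (\<lambda>v. 0))" for a
    by auto
  show "series_mult ?g (magnus_gen i) = series_one"
  proof
    fix w show "series_mult ?g (magnus_gen i) w = series_one w"
    proof (induction w)
      case (Cons a w)
      have "series_mult (\<lambda>v. ?g (a # v)) (magnus_gen i) w = (if a = i then - series_one w else 0)"
        unfolding g using series_mult_scale_left[of "-1" ?g "magnus_gen i" w] Cons.IH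
        by (auto simp: series_mult_zero_left)
      then show ?case by (simp add: magnus_gen_Cons series_one_def)
    qed (simp add: series_one_def)
  qed
qed

lemma magnus_filtration_1: "f \<in> magnus_filtration 1 \<longleftrightarrow> f \<in> carrier magnus_group \<and> f [] = 1"
  by (auto simp: magnus_filtration_def order_ge_def series_one_def)

lemma magnus_gen_filtration: "magnus_gen i \<in> magnus_filtration 1"
  using magnus_filtration_1 by fastforce

text \<open>The reversal of the inverse is an inverse of the reversal of \<open>1 + X\<^sub>i\<close>, which is \<open>1 + X\<^sub>i\<close> itself.\<close>

lemma inv_magnus_gen_rev: "(inv\<^bsub>magnus_group\<^esub> (magnus_gen i)) (rev w) = (inv\<^bsub>magnus_group\<^esub> (magnus_gen i)) w"
proof -
  let ?r = "inv\<^bsub>magnus_group\<^esub> (magnus_gen i)"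
  have gen: "(\<lambda>v. magnus_gen i (rev v)) = magnus_gen i" by (auto simp: magnus_gen_def)
  have "series_mult (\<lambda>v. ?r (rev v)) (magnus_gen i) = series_one"
  proof
    fix w
    have "series_mult (magnus_gen i) ?r (rev w) = series_one (rev w)"
      using magnus.r_inv[OF magnus_gen_carrier, of i] by simp
    then show "series_mult (\<lambda>v. ?r (rev v)) (magnus_gen i) w = series_one w"
      by (simp add: series_mult_rev gen series_one_def)
  qed
  moreover have inv: "series_mult (magnus_gen i) ?r = series_one"
    using magnus.r_inv[OF magnus_gen_carrier, of i] by simp
  ultimately have "(\<lambda>v. ?r (rev v)) = ?r"
    using series_mult_assoc[of "\<lambda>v. ?r (rev v)" "magnus_gen i" ?r] by simp
  then show ?thesis by metis
qed


section \<open>Evaluating words\<close>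

lemma word_value_Nil [simp]: "word_value G y [] = \<one>\<^bsub>G\<^esub>"
  by (simp add: word_value_def)

lemma word_value_Cons [simp]: "word_value G y (l # w) = letter_value G y l \<otimes>\<^bsub>G\<^esub> word_value G y w"
  by (simp add: word_value_def)

context group
begin

lemma letter_value_closed: "y ` {1..n} \<subseteq> carrier G \<Longrightarrow> fst l \<in> {1..n} \<Longrightarrow> letter_value G y l \<in> carrier G"
  by (cases l) (auto simp: image_subset_iff)

lemma word_value_closed: "y ` {1..n} \<subseteq> carrier G \<Longrightarrow> w \<in> words n \<Longrightarrow> word_value G y w \<in> carrier G"
  by (induction w) (auto simp: letter_value_closed)

lemma word_value_append:
  assumes "y ` {1..n} \<subseteq> carrier G" "u \<in> words n" "v \<in> words n"
  shows "word_value G y (u @ v) = word_value G y u \<otimes> word_value G y v"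
  using assms(2)
  by (induction u) (use assms in \<open>auto simp: word_value_closed letter_value_closed m_assoc\<close>)

lemma word_value_inverse_word:
  assumes "y ` {1..n} \<subseteq> carrier G" "w \<in> words n"
  shows "word_value G y (inverse_word w) = inv (word_value G y w)"
  using assms(2)
proof (induction w)
  case (Cons l w)
  obtain i b where l: "l = (i, b)" by fastforce
  have c: "y i \<in> carrier G" "word_value G y w \<in> carrier G" "w \<in> words n" "i \<in> {1..n}"
    using Cons.prems assms(1) l word_value_closed by auto
  have "word_value G y (inverse_word w @ [(i, \<not> b)]) = word_value G y (inverse_word w) \<otimes> word_value G y [(i, \<not> b)]"
    using c inverse_word_words by (intro word_value_append[OF assms(1)]) auto
  then show ?case using Cons.IH c by (simp add: inverse_word_def l inv_mult_group)
qed (simp add: inverse_word_def)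

lemma word_value_mem_generate:
  assumes "w \<in> words n"
  shows "word_value G y w \<in> generate G (y ` {1..n})"
  using assms
proof (induction w)
  case (Cons l w)
  then have "letter_value G y l \<in> generate G (y ` {1..n})"
    by (cases l) (auto intro: generate.incl generate.inv)
  then show ?case using Cons by (auto intro: generate.eng)
qed (auto intro: generate.one)

lemma word_value_free_rel:
  assumes y: "y ` {1..n} \<subseteq> carrier G" and "(u, v) \<in> free_rel n"
  shows "word_value G y u = word_value G y v"
proof -
  have cancel: "word_value G y a = word_value G y b" if ab: "(a, b) \<in> cancel n" for a b
  proof -
    obtain p q i c where *: "a = p @ [(i, c), (i, \<not> c)] @ q" "b = p @ q"
      "p \<in> words n" "q \<in> words n" "i \<in> {1..n}"
      using ab unfolding cancel_def by blast
    have "y i \<in> carrier G" "word_value G y q \<in> carrier G" using * y word_value_closed by auto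
    then have "word_value G y ([(i, c), (i, \<not> c)] @ q) = word_value G y q"
      by (auto simp: mult_inv_cancel)
    moreover have "[(i, c), (i, \<not> c)] @ q \<in> words n" using * by simp
    ultimately show ?thesis
      using word_value_append[OF y] * by metis
  qed
  have "(u, v) \<in> (cancel n \<union> (cancel n)\<inverse>)\<^sup>*" using assms(2) by (simp add: free_rel_def)
  then show ?thesis
    by (induction rule: rtrancl_induct) (auto dest: cancel)
qed

end

lemma hom_word_value:
  assumes "group G" "group H" "f \<in> hom G H" "y ` {1..n} \<subseteq> carrier G" "w \<in> words n"
  shows "f (word_value G y w) = word_value H (f \<circ> y) w"
proof -
  interpret f: group_hom G H f
    using assms(1-3) by (simp add: group_hom_def group_hom_axioms_def)
  show ?thesis
    using assms(5)
  proof (induction w)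
    case (Cons l w)
    obtain i b where l: "l = (i, b)" by fastforce
    have "letter_value G y l \<in> carrier G" "word_value G y w \<in> carrier G"
      using Cons.prems f.G.letter_value_closed[OF assms(4)] f.G.word_value_closed[OF assms(4)] by auto
    moreover have "f (letter_value G y l) = letter_value H (f \<circ> y) l"
      using Cons.prems image_subset_iff[THEN iffD1, OF assms(4)] l by simp
    ultimately show ?case using Cons by (simp del: comp_apply)
  qed simp
qed

lemma hom_commutator:
  assumes "group G" "group H" "f \<in> hom G H" "a \<in> carrier G" "b \<in> carrier G"
  shows "f (commutator G a b) = commutator H (f a) (f b)"
proof -
  interpret f: group_hom G H f
    using assms(1-3) by (simp add: group_hom_def group_hom_axioms_def)
  show ?thesis using assms(4,5) by (simp add: commutator_def)
qed

definition word_class :: "nat \<Rightarrow> word \<Rightarrow> word set" where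
  "word_class n w = free_rel n `` {w}"

text \<open>The universal property of the free group. Evaluation of words is constant on the classes of
  \<open>free_rel\<close>, so the image of a class is a singleton.\<close>

definition free_lift :: "('b, 'c) monoid_scheme \<Rightarrow> (nat \<Rightarrow> 'b) \<Rightarrow> word set \<Rightarrow> 'b" where
  "free_lift H y A = the_elem (word_value H y ` A)"

lemma word_class_closed: "w \<in> words n \<Longrightarrow> word_class n w \<in> carrier (free_group n)"
  by (auto simp: carrier_free_group word_class_def)

lemma carrier_free_groupE:
  assumes "a \<in> carrier (free_group n)"
  obtains w where "w \<in> words n" "a = word_class n w"
  using assms by (auto simp: carrier_free_group word_class_def)

lemma word_class_append:
  "u \<in> words n \<Longrightarrow> v \<in> words n \<Longrightarrow>
    word_class n (u @ v) = word_class n u \<otimes>\<^bsub>free_group n\<^esub> word_class n v"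
  by (simp add: word_class_def free_group_mult)

lemma word_class_letter [simp]: "word_class n [(i, True)] = free_gen n i"
  by (simp add: word_class_def free_gen_def)

lemma free_gen_closed: "free_gen n ` {1..n} \<subseteq> carrier (free_group n)"
  using word_class_closed[of "[(_, True)]" n] by auto

lemma word_value_free_gen:
  assumes "w \<in> words n"
  shows "word_value (free_group n) (free_gen n) w = word_class n w"
proof -
  interpret F: group "free_group n" by (rule group_free_group)
  have one: "word_class n [] = \<one>\<^bsub>free_group n\<^esub>" by (simp add: word_class_def free_group_def)
  have inv: "word_class n [(i, False)] = inv\<^bsub>free_group n\<^esub> (free_gen n i)" if i: "i \<in> {1..n}" for i
  proof (rule F.inv_equality[symmetric])
    have "([(i, False), (i, True)], []) \<in> free_rel n"
      using inverse_word_cancel[of "[(i, True)]" n] i by (simp add: inverse_word_def)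
    then have "word_class n ([(i, False)] @ [(i, True)]) = word_class n []"
      unfolding word_class_def by (simp add: equiv_class_eq[OF equiv_free_rel])
    then show "word_class n [(i, False)] \<otimes>\<^bsub>free_group n\<^esub> free_gen n i = \<one>\<^bsub>free_group n\<^esub>"
      using word_class_append[of "[(i, False)]" n "[(i, True)]"] i one by simp
  qed (use i word_class_closed[of "[(i, False)]" n] word_class_closed[of "[(i, True)]" n] in auto)
  show ?thesis
    using assms
  proof (induction w)
    case (Cons l w)
    obtain i b where l: "l = (i, b)" by fastforce
    have "word_class n ([l] @ w) = word_class n [l] \<otimes>\<^bsub>free_group n\<^esub> word_class n w"
      using Cons.prems by (intro word_class_append) auto
    moreover have "word_class n [l] = letter_value (free_group n) (free_gen n) l"
      using Cons.prems l inv by simp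
    ultimately show ?case using Cons by simp
  qed (simp add: one)
qed

lemma generate_free_gen: "generate (free_group n) (free_gen n ` {1..n}) = carrier (free_group n)"
proof -
  interpret F: group "free_group n" by (rule group_free_group)
  have "a \<in> generate (free_group n) (free_gen n ` {1..n})" if "a \<in> carrier (free_group n)" for a
    using that by (metis carrier_free_groupE word_value_free_gen F.word_value_mem_generate)
  then show ?thesis using F.generate_incl[OF free_gen_closed] by blast
qed

lemma free_lift_word_class:
  assumes "group H" "y ` {1..n} \<subseteq> carrier H" "w \<in> words n"
  shows "free_lift H y (word_class n w) = word_value H y w"
proof -
  have "word_value H y v = word_value H y w" if "v \<in> word_class n w" for v
    using group.word_value_free_rel[OF assms(1,2), of w v] that by (simp add: word_class_def)
  moreover have "w \<in> word_class n w"
    using assms(3) by (simp add: word_class_def free_rel_def)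
  ultimately have "word_value H y ` word_class n w = {word_value H y w}" by blast
  then show ?thesis by (simp add: free_lift_def)
qed

lemma free_lift_hom:
  assumes "group H" "y ` {1..n} \<subseteq> carrier H"
  shows "free_lift H y \<in> hom (free_group n) H"
proof (rule homI)
  interpret H: group H by fact
  note lift = free_lift_word_class[OF assms]
  fix a assume "a \<in> carrier (free_group n)"
  then obtain u where u: "u \<in> words n" "a = word_class n u" by (rule carrier_free_groupE)
  show "free_lift H y a \<in> carrier H" using u lift H.word_value_closed[OF assms(2)] by simp
  fix b assume "b \<in> carrier (free_group n)"
  then obtain v where v: "v \<in> words n" "b = word_class n v" by (rule carrier_free_groupE)
  show "free_lift H y (a \<otimes>\<^bsub>free_group n\<^esub> b) = free_lift H y a \<otimes>\<^bsub>H\<^esub> free_lift H y b"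
    using u v lift H.word_value_append[OF assms(2)] by (simp flip: word_class_append)
qed


section \<open>The Magnus representation of the free group\<close>

abbreviation magnus :: "word set \<Rightarrow> nat series" where
  "magnus \<equiv> free_lift magnus_group magnus_gen"

lemma magnus_word_class: "w \<in> words n \<Longrightarrow> magnus (word_class n w) = word_value magnus_group magnus_gen w"
  by (rule free_lift_word_class[OF group_magnus_group]) auto

lemma magnus_hom: "magnus \<in> hom (free_group n) magnus_group"
  by (rule free_lift_hom[OF group_magnus_group]) auto

lemma magnus_free_gen: "i \<in> {1..n} \<Longrightarrow> magnus (free_gen n i) = magnus_gen i"
  using magnus_word_class[of "[(i, True)]" n] by simp

lemma word_value_magnus_append:
  "word_value magnus_group magnus_gen (u @ v) =
    series_mult (word_value magnus_group magnus_gen u) (word_value magnus_group magnus_gen v)"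
  by (induction u) (simp_all add: series_mult_assoc)

text \<open>Reversing a word in the generators reverses all monomials of its Magnus expansion.\<close>

lemma word_value_magnus_rev:
  "word_value magnus_group magnus_gen (rev u) v = word_value magnus_group magnus_gen u (rev v)"
proof (induction u arbitrary: v)
  case (Cons l u)
  have "(\<lambda>v. letter_value magnus_group magnus_gen l (rev v)) = letter_value magnus_group magnus_gen l"
    by (cases l) (auto simp: inv_magnus_gen_rev, auto simp: magnus_gen_def)
  moreover have "word_value magnus_group magnus_gen (rev u) = (\<lambda>v. word_value magnus_group magnus_gen u (rev v))"
    using Cons.IH by blast
  ultimately show ?case by (simp add: word_value_magnus_append series_mult_rev)
qed (simp add: series_one_def)

lemma magnus_lower_central:
  assumes "m \<ge> 1" "a \<in> lower_central (free_group n) m"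
  shows "magnus a \<in> magnus_filtration m"
  using assms
proof (induction m arbitrary: a rule: nat_induct_at_least)
  interpret \<mu>: group_hom "free_group n" magnus_group magnus
    using group_free_group group_magnus_group magnus_hom by (simp add: group_hom_def group_hom_axioms_def)
  have gens: "magnus ` free_gen n ` {1..n} \<subseteq> magnus_filtration 1"
    using magnus_free_gen magnus_gen_filtration by auto
  have one: "magnus a \<in> magnus_filtration 1" if "a \<in> carrier (free_group n)" for a
  proof -
    have "magnus ` carrier (free_group n) = generate magnus_group (magnus ` free_gen n ` {1..n})"
      using \<mu>.generate_img[OF free_gen_closed] generate_free_gen by simp
    also have "\<dots> \<subseteq> magnus_filtration 1"
      using gens subgroup_magnus_filtration by (rule magnus.generate_subgroup_incl)
    finally show ?thesis using that by blast
  qed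
  {
    case base
    then show ?case using one by simp
  next
    case (Suc m)
    let ?C = "{commutator (free_group n) h g | h g. h \<in> lower_central (free_group n) m \<and> g \<in> carrier (free_group n)}"
    have C: "?C \<subseteq> carrier (free_group n)" using \<mu>.G.lower_central_subset by auto
    have "magnus (commutator (free_group n) h g) \<in> magnus_filtration (Suc m)"
      if "h \<in> lower_central (free_group n) m" "g \<in> carrier (free_group n)" for h g
      using commutator_magnus_filtration[OF Suc.IH[OF that(1)] one[OF that(2)] Suc.hyps] that
      by (simp add: hom_commutator[OF group_free_group group_magnus_group magnus_hom] \<mu>.G.lower_central_subset)
    then have "magnus ` ?C \<subseteq> magnus_filtration (Suc m)" by blast
    then have "generate magnus_group (magnus ` ?C) \<subseteq> magnus_filtration (Suc m)"
      using subgroup_magnus_filtration by (rule magnus.generate_subgroup_incl)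
    moreover have "magnus a \<in> magnus ` generate (free_group n) ?C"
      using Suc.prems \<mu>.G.lower_central_Suc[OF Suc.hyps] by blast
    ultimately show ?case using \<mu>.generate_img[OF C] by blast
  }
qed

text \<open>In \<open>(1 + f)(1 + g) = 1 + f + g + fg\<close> the product \<open>fg\<close> has larger order than \<open>f\<close> and \<open>g\<close>.
  So leading parts define a homomorphism from \<open>\<gamma>\<^sub>m / \<gamma>\<^bsub>m+1\<^esub>\<close> to the homogeneous polynomials of
  degree \<open>m\<close>.\<close>

lemma magnus_top_mult:
  assumes "m \<ge> 1" "a \<in> lower_central (free_group n) m" "b \<in> lower_central (free_group n) m" "length w = m"
  shows "magnus (a \<otimes>\<^bsub>free_group n\<^esub> b) w = magnus a w + magnus b w"
proof -
  interpret F: group "free_group n" by (rule group_free_group)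
  have "a \<in> carrier (free_group n)" "b \<in> carrier (free_group n)" using assms F.lower_central_subset by auto
  then have "magnus (a \<otimes>\<^bsub>free_group n\<^esub> b) = series_mult (magnus a) (magnus b)"
    using magnus_hom by (simp add: hom_def)
  moreover have "w \<noteq> []" using assms by auto
  ultimately show ?thesis
    using magnus_filtration_mult_top(1)[OF magnus_lower_central[OF assms(1,2)] assms(4), of "magnus b"]
      magnus_filtration_Nil[OF magnus_lower_central[OF assms(1,3)] assms(1)]
    by (simp add: series_one_def)
qed

lemma magnus_one [simp]: "magnus (\<one>\<^bsub>free_group n\<^esub>) = series_one"
proof -
  interpret \<mu>: group_hom "free_group n" magnus_group magnus
    using group_free_group group_magnus_group magnus_hom by (simp add: group_hom_def group_hom_axioms_def)
  show ?thesis using \<mu>.hom_one by simp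
qed

lemma magnus_top_inv:
  assumes "m \<ge> 1" "a \<in> lower_central (free_group n) m" "length w = m"
  shows "magnus (inv\<^bsub>free_group n\<^esub> a) w = - magnus a w"
proof -
  interpret F: group "free_group n" by (rule group_free_group)
  have "inv\<^bsub>free_group n\<^esub> a \<in> lower_central (free_group n) m"
    using assms(2) subgroup.m_inv_closed[OF F.subgroup_lower_central] by blast
  moreover have "w \<noteq> []" using assms by auto
  ultimately show ?thesis
    using magnus_top_mult[OF assms(1,2) _ assms(3), of "inv\<^bsub>free_group n\<^esub> a"] assms F.lower_central_subset
    by (simp add: series_one_def)
qed

lemma magnus_top_int_pow:
  assumes "m \<ge> 1" "a \<in> lower_central (free_group n) m" "length w = m"
  shows "magnus (a [^]\<^bsub>free_group n\<^esub> (s :: int)) w = s * magnus a w"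
proof -
  interpret F: group "free_group n" by (rule group_free_group)
  interpret L: subgroup "lower_central (free_group n) m" "free_group n" by (rule F.subgroup_lower_central)
  have w: "w \<noteq> []" using assms by auto
  have nat: "a [^]\<^bsub>free_group n\<^esub> t \<in> lower_central (free_group n) m \<and>
    magnus (a [^]\<^bsub>free_group n\<^esub> t) w = int t * magnus a w" for t :: nat
  proof (induction t)
    case (Suc t)
    then show ?case using assms(2) magnus_top_mult[OF assms(1) _ assms(2,3), of "a [^]\<^bsub>free_group n\<^esub> t"]
      by (simp add: algebra_simps)
  qed (simp add: w series_one_def)
  show ?thesis
  proof (cases s rule: int_cases2)
    case (nonneg t)
    then show ?thesis using nat by (simp add: int_pow_int)
  next
    case (nonpos t)
    then show ?thesis
      using nat[of t] magnus_top_inv[OF assms(1) _ assms(3)] assms(2) L.mem_carrier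
      by (simp add: F.int_pow_neg_int)
  qed
qed

lemma magnus_top_commutator:
  assumes "i \<ge> 1" "j \<ge> 1" "a \<in> lower_central (free_group n) i" "b \<in> lower_central (free_group n) j"
    and "length w = i + j"
  shows "magnus (commutator (free_group n) a b) w =
    magnus a (take i w) * magnus b (drop i w) - magnus b (take j w) * magnus a (drop j w)"
proof -
  interpret F: group "free_group n" by (rule group_free_group)
  show ?thesis
    using commutator_leading_part(2)[OF magnus_lower_central[OF assms(1,3)] magnus_lower_central[OF assms(2,4)] assms(1,2,5)]
      assms F.lower_central_subset
    by (simp add: hom_commutator[OF group_free_group group_magnus_group magnus_hom])
qed

lemma take_mono_lexord:
  fixes v w :: "'a::linorder list"
  assumes "v \<le> w" "length v = length w"
  shows "take i v \<le> take i w"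
proof (rule ccontr)
  assume "\<not> take i v \<le> take i w"
  then have "take i w @ drop i w < take i v @ drop i v"
    using assms(2) by (intro append_less_append_length) auto
  then show False using assms(1) by simp
qed

text \<open>The Magnus expansion of the Lyndon commutator of \<open>w\<close> is \<open>w\<close> plus larger words. For \<open>w = pq\<close>
  the product of the two expansions starts with \<open>pq\<close>, while the product in the other order
  contributes only words that are at least \<open>qp\<close>, and \<open>pq < qp\<close> because \<open>w\<close> is Lyndon.\<close>

lemma magnus_lyndon_commutator:
  assumes "w \<in> lists {1..n}" "lyndon w"
  shows "magnus (lyndon_commutator (free_group n) (free_gen n) w) w = 1 \<and>
    (\<forall>v < w. length v = length w \<longrightarrow> magnus (lyndon_commutator (free_group n) (free_gen n) w) v = 0)"
  using assms
proof (induction "length w" arbitrary: w rule: less_induct)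
  case less
  interpret F: group "free_group n" by (rule group_free_group)
  let ?c = "lyndon_commutator (free_group n) (free_gen n)"
  show ?case
  proof (cases "length w \<ge> 2")
    case True
    define p q where "p = left_factor w" and "q = right_factor w"
    note f = left_right_factor[OF True, folded p_def q_def]
    note lyn = lyndon_factors[OF less.prems(2) True, folded p_def q_def]
    have lists: "p \<in> lists {1..n}" "q \<in> lists {1..n}" using less.prems(1) f(1) by (metis append_in_lists_conv)+
    note P = less.hyps[OF f(4) lists(1) lyn(1)] and Q = less.hyps[OF f(5) lists(2) lyn(2)]
    have len: "length w = length p + length q" using f(1) by (metis length_append)
    have c: "?c w = commutator (free_group n) (?c p) (?c q)"
      using True by (subst lyndon_commutator.simps) (simp add: p_def q_def)
    have top: "magnus (?c w) v = magnus (?c p) (take (length p) v) * magnus (?c q) (drop (length p) v)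
        - magnus (?c q) (take (length q) v) * magnus (?c p) (drop (length q) v)"
      if "length v = length w" for v
      unfolding c using f(2,3) lists that len
      by (intro magnus_top_commutator F.lyndon_commutator_mem[OF free_gen_closed]) (auto simp: Suc_le_eq)
    have "w < q" using less.prems(2) right_factor_mem[OF True] unfolding lyndon_def q_def by blast
    then have "w @ [] < q @ p" using f(5) by (intro append_less_append_length) auto
    then have wqp: "w < q @ p" by simp
    have second: "magnus (?c q) (take (length q) v) * magnus (?c p) (drop (length q) v) = 0"
      if v: "v \<le> w" "length v = length w" for v
    proof -
      have tq: "take (length q) (q @ p) = q" by simp
      have "v < q @ p" using v(1) wqp by simp
      moreover have "length v = length (q @ p)" using v len by simp
      ultimately have "take (length q) v \<le> q"
        using take_mono_lexord[of v "q @ p" "length q"] by simp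
      moreover have "drop (length q) v < p" if "take (length q) v = q"
        using \<open>v < q @ p\<close> that append_take_drop_id[of "length q" v] append_less_append_iff by metis
      moreover have "length (take (length q) v) = length q" "length (drop (length q) v) = length p"
        using v len by auto
      ultimately show ?thesis using P Q by (metis mult_eq_0_iff order_le_less)
    qed
    have w: "take (length p) w = p" "drop (length p) w = q" using f(1) by (metis append_eq_conv_conj)+
    have "magnus (?c w) v = 0" if v: "v < w" "length v = length w" for v
    proof -
      have "take (length p) v \<le> p"
        using take_mono_lexord[of v w "length p"] v w by simp
      moreover have "drop (length p) v < q" if "take (length p) v = p"
        using \<open>v < w\<close> that append_take_drop_id[of "length p" v] append_less_append_iff f(1) by metis
      moreover have "length (take (length p) v) = length p" "length (drop (length p) v) = length q"
        using v len by auto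
      ultimately have "magnus (?c p) (take (length p) v) * magnus (?c q) (drop (length p) v) = 0"
        using P Q by (metis mult_eq_0_iff order_le_less)
      then show ?thesis using top[of v] second[of v] v by simp
    qed
    moreover have "magnus (?c w) w = 1" using top[of w] second[of w] w P Q by simp
    ultimately show ?thesis by blast
  next
    case False
    then obtain i where i: "w = [i]" using less.prems(2) by (cases w; cases "tl w") (auto simp: lyndon_def)
    then have "magnus (?c w) = magnus_gen i" using less.prems(1) magnus_free_gen by simp
    moreover have "v = [hd v]" if "length v = 1" for v :: "nat list" using that by (cases v) auto
    ultimately show ?thesis using i by (auto simp: magnus_gen_def)
  qed
qed

text \<open>By triangularity the Lyndon commutators of weight \<open>m\<close> have linearly independent leading
  parts. An element of \<open>\<gamma>\<^sub>m\<close> is a product of powers of them modulo \<open>\<gamma>\<^bsub>m+1\<^esub>\<close>; if its leading part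
  vanishes, the exponents vanish one after the other, starting with the least Lyndon word.\<close>

lemma magnus_top_zero:
  assumes "m \<ge> 1" "a \<in> lower_central (free_group n) m" "\<And>w. length w = m \<Longrightarrow> magnus a w = 0"
  shows "a \<in> lower_central (free_group n) (Suc m)"
proof -
  interpret F: group "free_group n" by (rule group_free_group)
  let ?c = "lyndon_commutator (free_group n) (free_gen n)"
  let ?L = "\<lambda>m. lower_central (free_group n) m"
  let ?W = "{w \<in> lists {1..n}. lyndon w \<and> length w = m}"
  have c: "?c w \<in> ?L m" if "w \<in> ?W" for w
    using F.lyndon_commutator_mem[OF free_gen_closed, of w] that by (auto simp: lyndon_def)
  have *: "a \<in> ?L (Suc m)"
    if "finite W" "W \<subseteq> ?W" "a \<in> generate (free_group n) (?L (Suc m) \<union> ?c ` W)"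
      "\<forall>w. length w = m \<longrightarrow> magnus a w = 0" for W a
    using that
  proof (induction W arbitrary: a rule: finite_linorder_min_induct)
    case empty
    then show ?case
      using F.generate_subgroup_incl[OF order_refl F.subgroup_lower_central] by fastforce
  next
    case (insert b W)
    let ?T = "generate (free_group n) (?L (Suc m) \<union> ?c ` W)"
    have b: "b \<in> lists {1..n}" "lyndon b" "length b = m" using insert.prems(1) by auto
    have cb: "?c b \<in> ?L m" using c insert.prems(1) by blast
    have gens: "?L (Suc m) \<union> ?c ` W \<subseteq> ?L m"
      using c insert.prems(1) F.lower_central_Suc_subset by blast
    then have gens': "?L (Suc m) \<union> ?c ` W \<subseteq> carrier (free_group n)"
      using F.lower_central_subset by blast
    have T: "?T \<subseteq> ?L m"
      using gens F.subgroup_lower_central by (rule F.generate_subgroup_incl)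
    have T_normal: "?T \<lhd> free_group n"
      by (rule F.normal_between_lower_central[OF assms(1) F.generate_is_subgroup[OF gens'] _ T])
        (auto intro: generate.incl)
    have H: "subgroup (generate (free_group n) {?c b}) (free_group n)"
      using cb F.lower_central_subset by (intro F.generate_is_subgroup) auto
    have TH: "subgroup (?T <#>\<^bsub>free_group n\<^esub> generate (free_group n) {?c b}) (free_group n)"
      using T_normal H by (rule F.mult_norm_subgroup)
    have one: "\<one>\<^bsub>free_group n\<^esub> \<in> ?T" "\<one>\<^bsub>free_group n\<^esub> \<in> generate (free_group n) {?c b}"
      by (auto intro: generate.one)
    let ?H = "generate (free_group n) {?c b}"
    have prod: "x \<otimes>\<^bsub>free_group n\<^esub> y \<in> ?T <#>\<^bsub>free_group n\<^esub> ?H" if "x \<in> ?T" "y \<in> ?H" for x y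
      using that unfolding set_mult_def by blast
    have "x \<in> ?T <#>\<^bsub>free_group n\<^esub> ?H" if x: "x \<in> ?L (Suc m) \<union> ?c ` W" for x
    proof -
      have "x \<in> carrier (free_group n)" using x gens' by blast
      moreover have "x \<in> ?T" using x by (rule generate.incl)
      ultimately show ?thesis using prod[OF _ one(2), of x] F.r_one[of x] by metis
    qed
    moreover have "?c b \<in> ?T <#>\<^bsub>free_group n\<^esub> ?H"
    proof -
      have "?c b \<in> carrier (free_group n)" using cb F.lower_central_subset by blast
      moreover have "?c b \<in> ?H" by (rule generate.incl) simp
      ultimately show ?thesis using prod[OF one(1), of "?c b"] F.l_one[of "?c b"] by metis
    qed
    ultimately have "generate (free_group n) (?L (Suc m) \<union> ?c ` insert b W)
        \<subseteq> ?T <#>\<^bsub>free_group n\<^esub> ?H"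
      by (intro F.generate_subgroup_incl[OF _ TH]) blast
    then obtain t h where th: "t \<in> ?T" "h \<in> ?H" "a = t \<otimes>\<^bsub>free_group n\<^esub> h"
      using insert.prems(2) unfolding set_mult_def by blast
    then obtain s :: int where s: "h = ?c b [^]\<^bsub>free_group n\<^esub> s"
      using F.generate_pow[OF F.lower_central_subset[OF cb]] by blast
    have "?H \<subseteq> ?L m"
      using cb by (intro F.generate_subgroup_incl F.subgroup_lower_central) simp
    then have h: "h \<in> ?L m" using th(2) by blast
    have zero: "magnus x b = 0" if "x \<in> ?L (Suc m) \<union> ?c ` W" for x
      using that
    proof
      assume "x \<in> ?L (Suc m)"
      then have "magnus x b = series_one b"
        using b(3) by (intro magnus_filtration_low[OF magnus_lower_central]) auto
      then show ?thesis using b(3) assms(1) by (auto simp: series_one_def)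
    next
      assume "x \<in> ?c ` W"
      then obtain w where w: "w \<in> W" "x = ?c w" by blast
      then have "w \<in> lists {1..n}" "lyndon w" "length w = m" "b < w"
        using insert.hyps(2) insert.prems(1) by auto
      then show ?thesis using magnus_lyndon_commutator[of w n] b(3) w(2) by simp
    qed
    have "magnus t b = 0"
    proof -
      have "x \<in> ?L m \<and> magnus x b = 0" if "x \<in> ?T" for x
        using that
      proof (induction rule: generate.induct)
        case one
        show ?case using b(3) assms(1) subgroup.one_closed[OF F.subgroup_lower_central]
          by (auto simp: series_one_def)
      next
        case (incl x)
        then have "magnus x b = 0"
          by (rule zero)
        then show ?case using incl gens by blast
      next
        case (inv x)
        then have "magnus x b = 0"
          by (rule zero)
        moreover have "x \<in> ?L m" using inv gens by blast
        ultimately show ?case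
          using magnus_top_inv[OF assms(1) _ b(3)] subgroup.m_inv_closed[OF F.subgroup_lower_central] by simp
      next
        case (eng x y)
        then show ?case
          using magnus_top_mult[OF assms(1) _ _ b(3)] subgroup.m_closed[OF F.subgroup_lower_central] by simp
      qed
      then show ?thesis using th(1) by blast
    qed
    moreover have "magnus h b = s"
      unfolding s using magnus_top_int_pow[OF assms(1) cb b(3)] magnus_lyndon_commutator[OF b(1,2)] by simp
    moreover have "magnus a b = magnus t b + magnus h b"
      unfolding th(3) using th(1) T h by (intro magnus_top_mult[OF assms(1) _ _ b(3)]) auto
    ultimately have "s = 0" using insert.prems(3) b(3) by simp
    then have "a = t" using th s T F.lower_central_subset by auto
    then show ?case using insert.IH[of a] insert.prems(1,3) th(1) by simp
  qed
  have "?W \<subseteq> {w. set w \<subseteq> {1..n} \<and> length w \<le> m}" by auto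
  then have "finite ?W" using finite_lists_length_le[of "{1..n}" m] by (rule finite_subset) simp
  moreover have "a \<in> generate (free_group n) (?L (Suc m) \<union> ?c ` ?W)"
    using assms(2) F.lower_central_eq_lyndon_span[OF free_gen_closed _ generate_free_gen assms(1)]
    by (simp add: F.lyndon_span_def)
  ultimately show ?thesis using assms(3) by (intro *) auto
qed

text \<open>An element whose expansion is \<open>1\<close> below degree \<open>m\<close> climbs the lower central series one step at
  a time up to \<open>\<gamma>\<^sub>m\<close>, since its parts of positive degree below \<open>m\<close> vanish.\<close>

lemma magnus_theorem:
  assumes "a \<in> carrier (free_group n)" "m \<ge> 1"
  shows "a \<in> lower_central (free_group n) m \<longleftrightarrow> magnus a \<in> magnus_filtration m"
proof
  show "a \<in> lower_central (free_group n) m" if "magnus a \<in> magnus_filtration m"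
    using assms(2) that
  proof (induction m rule: nat_induct_at_least)
    case base
    then show ?case using assms(1) by simp
  next
    case (Suc m)
    have low: "magnus a w = series_one w" if "length w < Suc m" for w
      using Suc.prems that by (rule magnus_filtration_low)
    then have "magnus a \<in> magnus_filtration m"
      using Suc.prems by (intro magnus_filtrationI) (auto simp: magnus_filtration_def)
    moreover have "magnus a w = 0" if "length w = m" for w
      using low[of w] that Suc.hyps by (auto simp: series_one_def)
    ultimately show ?case using Suc by (intro magnus_top_zero) auto
  qed
qed (rule magnus_lower_central[OF assms(2)])

text \<open>Reversal acts on Lie elements of degree \<open>m\<close> as the sign \<open>(-1)\<^bsup>m+1\<^esup>\<close>, since it fixes the
  letters and turns a bracket \<open>[h, g]\<close> into \<open>[g, h]\<close>.\<close>

lemma magnus_top_rev: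
  assumes "m \<ge> 1" "a \<in> lower_central (free_group n) m" "length w = m"
  shows "magnus a (rev w) = (- 1) ^ (m + 1) * magnus a w"
  using assms
proof (induction m arbitrary: a w rule: nat_induct_at_least)
  case base
  then show ?case by (cases w) auto
next
  case (Suc m)
  interpret F: group "free_group n" by (rule group_free_group)
  let ?L = "\<lambda>m. lower_central (free_group n) m"
  have comm: "magnus (commutator (free_group n) h g) (rev w) = (- 1) ^ (Suc m + 1) * magnus (commutator (free_group n) h g) w"
    if hg: "h \<in> ?L m" "g \<in> carrier (free_group n)" and w: "length w = Suc m" for h g w
  proof -
    have top: "magnus (commutator (free_group n) h g) v =
      magnus h (take m v) * magnus g (drop m v) - magnus g (take 1 v) * magnus h (drop 1 v)"
      if "length v = Suc m" for v
      using that hg Suc.hyps by (intro magnus_top_commutator) auto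
    have one: "rev v = v" if "length v = 1" for v :: "nat list" using that by (cases v) auto
    have "magnus h (take m (rev w)) = (- 1) ^ (m + 1) * magnus h (drop 1 w)"
      "magnus h (drop 1 (rev w)) = (- 1) ^ (m + 1) * magnus h (take m w)"
      using Suc.IH[OF hg(1), of "drop 1 w"] Suc.IH[OF hg(1), of "take m w"] w
      by (auto simp: take_rev drop_rev)
    moreover have "drop m (rev w) = take 1 w" "take 1 (rev w) = drop m w"
      using one[of "take 1 w"] one[of "drop m w"] w by (auto simp: take_rev drop_rev)
    ultimately show ?thesis using w by (simp add: top right_diff_distrib mult.left_commute mult.commute)
  qed
  have mem: "commutator (free_group n) h g \<in> ?L (Suc m)"
    if "h \<in> ?L m" "g \<in> carrier (free_group n)" for h g
    using Suc.hyps that by (rule F.commutator_lower_central_Suc)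
  have "a \<in> generate (free_group n) {commutator (free_group n) h g | h g. h \<in> ?L m \<and> g \<in> carrier (free_group n)}"
    using Suc.prems F.lower_central_Suc[OF Suc.hyps] by simp
  then have "a \<in> ?L (Suc m) \<and> (\<forall>w. length w = Suc m \<longrightarrow> magnus a (rev w) = (- 1) ^ (Suc m + 1) * magnus a w)"
  proof (induction rule: generate.induct)
    case one
    show ?case using subgroup.one_closed[OF F.subgroup_lower_central] by (auto simp: series_one_def)
  next
    case (incl x)
    then show ?case using comm mem by blast
  next
    case (inv x)
    then obtain h g where x: "x = commutator (free_group n) h g" "h \<in> ?L m" "g \<in> carrier (free_group n)" by blast
    show ?case
      using subgroup.m_inv_closed[OF F.subgroup_lower_central mem[OF x(2,3)]]
        magnus_top_inv[OF _ mem[OF x(2,3)]] comm[OF x(2,3)] x(1) by simp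
  next
    case (eng x y)
    then show ?case
      using magnus_top_mult[of "Suc m" x n y] subgroup.m_closed[OF F.subgroup_lower_central]
      by (simp add: distrib_left del: lower_central.simps)
  qed
  then show ?case using Suc.prems by blast
qed

text \<open>A leading part that commutes with two different letters vanishes: a word occurring in it
  would have to begin with both of them. Hence the center of a free nilpotent group of rank at
  least \<open>2\<close> is the last non-trivial term of its lower central series.\<close>

lemma commutes_modulo_imp_lower_central:
  assumes ij: "i \<in> {1..n}" "j \<in> {1..n}" "i \<noteq> j" and a: "a \<in> carrier (free_group n)"
    and "\<And>l. l \<in> {1..n} \<Longrightarrow> commutator (free_group n) a (free_gen n l) \<in> lower_central (free_group n) (Suc k)"
    and "m \<ge> 1" "m \<le> k"
  shows "a \<in> lower_central (free_group n) m"
  using assms(6,7)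
proof (induction m rule: nat_induct_at_least)
  case base
  then show ?case using a by simp
next
  case (Suc m)
  interpret F: group "free_group n" by (rule group_free_group)
  have am: "a \<in> lower_central (free_group n) m" using Suc by simp
  show ?case
  proof (rule magnus_top_zero[OF Suc.hyps am])
    fix w :: "nat list" assume w: "length w = m"
    \<comment> \<open>For a letter \<open>l\<close> that does not begin \<open>w\<close>, the coefficient of \<open>wl\<close> in the bracket of the
      leading part of \<open>a\<close> with \<open>X\<^sub>l\<close> is the coefficient of \<open>w\<close> in that leading part.\<close>
    obtain l where l: "l \<in> {1..n}" "hd w \<noteq> l" using ij by metis
    have gl: "free_gen n l \<in> lower_central (free_group n) 1" using l free_gen_closed[of n] by (simp add: image_subset_iff)
    let ?c = "commutator (free_group n) a (free_gen n l)"
    have "?c \<in> lower_central (free_group n) (Suc k)" using assms(5) l by blast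
    then have "magnus ?c (w @ [l]) = series_one (w @ [l])"
      using Suc.prems w by (intro magnus_filtration_low[OF magnus_lower_central]) auto
    moreover have "magnus ?c (w @ [l]) = magnus a w * magnus_gen l [l] - magnus_gen l [hd w] * magnus a (tl w @ [l])"
      using magnus_top_commutator[OF Suc.hyps _ am gl, of "w @ [l]"] w magnus_free_gen[OF l(1)] Suc.hyps
      by (cases w) auto
    ultimately show "magnus a w = 0" using l(2) by (simp add: magnus_gen_def series_one_def)
  qed
qed


section \<open>Automorphism groups and central automorphisms\<close>

context group
begin

lemma AutoGroup_simps:
  "carrier (AutoGroup G) = auto G"
  "f \<in> auto G \<Longrightarrow> g \<in> auto G \<Longrightarrow> f \<otimes>\<^bsub>AutoGroup G\<^esub> g = compose (carrier G) f g"
  "\<one>\<^bsub>AutoGroup G\<^esub> = (\<lambda>x \<in> carrier G. x)"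
  by (auto simp: AutoGroup_def BijGroup_def auto_def)

lemma auto_group_hom: "f \<in> auto G \<Longrightarrow> group_hom G G f"
  using is_group by (simp add: auto_def group_hom_def group_hom_axioms_def)

lemma auto_bij_betw: "f \<in> auto G \<Longrightarrow> bij_betw f (carrier G) (carrier G)"
  by (simp add: auto_def Bij_def)

lemma auto_eqI:
  assumes "f \<in> auto G" "g \<in> auto G" "\<And>x. x \<in> carrier G \<Longrightarrow> f x = g x"
  shows "f = g"
  using assms by (auto simp: auto_def Bij_def intro: extensionalityI)

lemma inv_auto:
  assumes "f \<in> auto G"
  shows "inv\<^bsub>AutoGroup G\<^esub> f \<in> auto G"
    and "x \<in> carrier G \<Longrightarrow> (inv\<^bsub>AutoGroup G\<^esub> f) (f x) = x"
    and "x \<in> carrier G \<Longrightarrow> f ((inv\<^bsub>AutoGroup G\<^esub> f) x) = x"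
proof -
  interpret A: group "AutoGroup G" by (rule AutoGroup)
  have f: "f \<in> carrier (AutoGroup G)" using assms by (simp add: AutoGroup_simps)
  show i: "inv\<^bsub>AutoGroup G\<^esub> f \<in> auto G" using A.inv_closed[OF f] by (simp add: AutoGroup_simps)
  assume x: "x \<in> carrier G"
  show "(inv\<^bsub>AutoGroup G\<^esub> f) (f x) = x"
    using fun_cong[OF A.l_inv[OF f], of x] x by (simp add: AutoGroup_simps i assms compose_def)
  show "f ((inv\<^bsub>AutoGroup G\<^esub> f) x) = x"
    using fun_cong[OF A.r_inv[OF f], of x] x by (simp add: AutoGroup_simps i assms compose_def)
qed

lemma subgroup_group_center: "subgroup (group_center G) G"
proof (rule subgroupI)
  show "group_center G \<noteq> {}" by (auto simp: group_center_def intro!: exI[of _ \<one>])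
  fix a assume "a \<in> group_center G"
  then have a: "a \<in> carrier G" "\<And>g. g \<in> carrier G \<Longrightarrow> a \<otimes> g = g \<otimes> a"
    by (auto simp: group_center_def)
  have "inv a \<otimes> g = g \<otimes> inv a" if g: "g \<in> carrier G" for g
  proof -
    have "inv a \<otimes> g = inv a \<otimes> (g \<otimes> a) \<otimes> inv a" using a(1) g by (simp add: m_assoc)
    also have "\<dots> = g \<otimes> inv a" using a(1) g by (simp add: mult_inv_cancel flip: a(2))
    finally show ?thesis .
  qed
  then show "inv a \<in> group_center G" using a(1) by (simp add: group_center_def)
  fix b assume "b \<in> group_center G"
  then have b: "b \<in> carrier G" "\<And>g. g \<in> carrier G \<Longrightarrow> b \<otimes> g = g \<otimes> b"
    by (auto simp: group_center_def)
  have "a \<otimes> b \<otimes> g = g \<otimes> (a \<otimes> b)" if g: "g \<in> carrier G" for g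
  proof -
    have "a \<otimes> b \<otimes> g = a \<otimes> (g \<otimes> b)" using a(1) b g by (simp add: m_assoc)
    also have "\<dots> = g \<otimes> a \<otimes> b" using a(2)[OF g] a(1) b(1) g by (simp flip: m_assoc)
    finally show ?thesis using a(1) b(1) g by (simp add: m_assoc)
  qed
  then show "a \<otimes> b \<in> group_center G" using a(1) b(1) by (simp add: group_center_def)
qed (auto simp: group_center_def)

lemma group_center_commutes:
  "z \<in> group_center G \<Longrightarrow> g \<in> carrier G \<Longrightarrow> z \<otimes> g = g \<otimes> z"
  by (simp add: group_center_def)

lemma central_autsD:
  assumes "f \<in> central_auts G" "g \<in> carrier G"
  obtains z where "z \<in> group_center G" "f g = z \<otimes> g"
proof -
  have "f \<in> auto G" using assms(1) by (simp add: central_auts_def)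
  then have "f g \<in> carrier G" using assms(2) by (auto simp: auto_def hom_def)
  then have "f g \<in> group_center G #> f g" by (rule rcos_self[OF _ subgroup_group_center])
  also have "\<dots> = group_center G #> g" using assms by (simp add: central_auts_def)
  finally show ?thesis using that by (auto simp: r_coset_def)
qed

lemma central_autsI:
  assumes "f \<in> auto G" "\<And>g. g \<in> carrier G \<Longrightarrow> \<exists>z \<in> group_center G. f g = z \<otimes> g"
  shows "f \<in> central_auts G"
proof -
  have "group_center G #> f g = group_center G #> g" if g: "g \<in> carrier G" for g
  proof -
    have "f g \<in> group_center G #> g" using assms(2)[OF g] by (auto simp: r_coset_def)
    then show ?thesis using repr_independence[OF _ g subgroup_group_center] by simp
  qed
  then show ?thesis using assms(1) by (simp add: central_auts_def)
qed

lemma subgroup_central_auts: "subgroup (central_auts G) (AutoGroup G)"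
proof -
  interpret A: group "AutoGroup G" by (rule AutoGroup)
  have maps: "f g \<in> carrier G" if "f \<in> auto G" "g \<in> carrier G" for f g
    using that by (auto simp: auto_def hom_def)
  show ?thesis
  proof (rule A.subgroupI)
    show "central_auts G \<subseteq> carrier (AutoGroup G)" by (auto simp: central_auts_def AutoGroup_simps)
    have "(\<lambda>x \<in> carrier G. x) \<in> central_auts G" using id_in_auto by (simp add: central_auts_def)
    then show "central_auts G \<noteq> {}" by blast
    fix f assume f: "f \<in> central_auts G"
    then have fa: "f \<in> auto G" by (simp add: central_auts_def)
    note i = inv_auto[OF fa]
    have "group_center G #> (inv\<^bsub>AutoGroup G\<^esub> f) g = group_center G #> g" if g: "g \<in> carrier G" for g
      using f maps[OF i(1) g] i(3)[OF g] unfolding central_auts_def by (metis (mono_tags, lifting) mem_Collect_eq)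
    then show "inv\<^bsub>AutoGroup G\<^esub> f \<in> central_auts G" using i(1) by (simp add: central_auts_def)
    fix h assume h: "h \<in> central_auts G"
    then have ha: "h \<in> auto G" by (simp add: central_auts_def)
    have "f \<otimes>\<^bsub>AutoGroup G\<^esub> h \<in> auto G"
      using A.m_closed[of f h] fa ha by (simp add: AutoGroup_simps)
    then show "f \<otimes>\<^bsub>AutoGroup G\<^esub> h \<in> central_auts G"
      using f h fa ha maps[OF ha] by (simp add: central_auts_def AutoGroup_simps compose_def)
  qed
qed

lemma commutator_mult_center_left:
  assumes "z \<in> group_center G" "a \<in> carrier G" "b \<in> carrier G"
  shows "commutator G (z \<otimes> a) b = commutator G a b"
proof -
  have z: "z \<in> carrier G" "z \<otimes> (a \<otimes> b \<otimes> inv a) = (a \<otimes> b \<otimes> inv a) \<otimes> z"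
    using assms by (auto simp: group_center_def)
  have "commutator G (z \<otimes> a) b = z \<otimes> (a \<otimes> b \<otimes> inv a) \<otimes> inv z \<otimes> inv b"
    using z(1) assms(2,3) by (simp add: commutator_def m_assoc inv_mult_group)
  also have "\<dots> = commutator G a b"
    unfolding z(2) using z(1) assms(2,3) by (simp add: commutator_def m_assoc mult_inv_cancel)
  finally show ?thesis .
qed

lemma commutator_mult_center_right:
  assumes "z \<in> group_center G" "a \<in> carrier G" "b \<in> carrier G"
  shows "commutator G a (z \<otimes> b) = commutator G a b"
proof -
  have "z \<in> carrier G" using assms by (simp add: group_center_def)
  then show ?thesis
    using commutator_mult_center_left[OF assms(1,3,2)] inv_commutator[of _ a] assms(2,3)
    by (metis m_closed)
qed

text \<open>Central factors drop out of a commutator.\<close>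

lemma central_aut_fixes_commutator:
  assumes "f \<in> central_auts G" "a \<in> carrier G" "b \<in> carrier G"
  shows "f (commutator G a b) = commutator G a b"
proof -
  obtain z where z: "z \<in> group_center G" "f a = z \<otimes> a" using assms(1,2) by (rule central_autsD)
  obtain z' where z': "z' \<in> group_center G" "f b = z' \<otimes> b" using assms(1,3) by (rule central_autsD)
  have hom: "f \<in> hom G G" using assms(1) by (simp add: central_auts_def auto_def)
  have "f (commutator G a b) = commutator G (z \<otimes> a) (z' \<otimes> b)"
    using hom_commutator[OF is_group is_group hom assms(2,3)] z z' by simp
  also have "\<dots> = commutator G a (z' \<otimes> b)"
    using z'(1) assms(3) by (intro commutator_mult_center_left[OF z(1) assms(2)]) (simp add: group_center_def)
  also have "\<dots> = commutator G a b" by (rule commutator_mult_center_right[OF z'(1) assms(2,3)])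
  finally show ?thesis .
qed

lemma inner_auto:
  assumes "g \<in> carrier G"
  shows "(\<lambda>x \<in> carrier G. g \<otimes> x \<otimes> inv g) \<in> auto G"
proof -
  have "bij_betw (\<lambda>x \<in> carrier G. g \<otimes> x \<otimes> inv g) (carrier G) (carrier G)"
    by (rule bij_betw_byWitness[where f' = "\<lambda>x. inv g \<otimes> x \<otimes> g"])
      (use assms in \<open>auto simp: m_assoc mult_inv_cancel\<close>)
  moreover have "(\<lambda>x \<in> carrier G. g \<otimes> x \<otimes> inv g) \<in> hom G G"
    by (rule homI) (use assms in \<open>auto simp: m_assoc mult_inv_cancel\<close>)
  ultimately show ?thesis by (simp add: auto_def Bij_def)
qed

lemma inner_auto_normal:
  assumes "g \<in> carrier G"
  shows "(\<lambda>x \<in> carrier G. g \<otimes> x \<otimes> inv g) \<in> normal_auts G"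
proof -
  have "(\<lambda>x \<in> carrier G. g \<otimes> x \<otimes> inv g) ` H = H" if "H \<lhd> G" for H
  proof -
    interpret H: normal H G by fact
    have "h = g \<otimes> (inv g \<otimes> h \<otimes> g) \<otimes> inv g" "inv g \<otimes> h \<otimes> g \<in> H" if "h \<in> H" for h
      using that assms H.inv_op_closed1 by (auto simp: m_assoc mult_inv_cancel)
    then show ?thesis
      using assms H.inv_op_closed2 by (auto simp: image_iff)
  qed
  then show ?thesis using inner_auto[OF assms] by (simp add: normal_auts_def)
qed

end

lemma (in comm_group) inversion_auto:
  shows "(\<lambda>x \<in> carrier G. inv x) \<in> auto G" "(\<lambda>x \<in> carrier G. inv x) \<in> normal_auts G"
    "(\<lambda>x \<in> carrier G. inv x) \<in> central_auts G"
proof -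
  have "bij_betw (\<lambda>x \<in> carrier G. inv x) (carrier G) (carrier G)"
    by (rule bij_betw_byWitness[where f' = "\<lambda>x. inv x"]) auto
  moreover have "(\<lambda>x \<in> carrier G. inv x) \<in> hom G G"
    by (rule homI) (auto simp: inv_mult)
  ultimately show auto: "(\<lambda>x \<in> carrier G. inv x) \<in> auto G" by (simp add: auto_def Bij_def)
  have "(\<lambda>x \<in> carrier G. inv x) ` H = H" if "H \<lhd> G" for H
  proof -
    interpret H: normal H G by fact
    have "h \<in> (\<lambda>x \<in> carrier G. inv x) ` H" if "h \<in> H" for h
      using that by (intro image_eqI[of _ _ "inv h"]) auto
    then show ?thesis by auto
  qed
  then show "(\<lambda>x \<in> carrier G. inv x) \<in> normal_auts G" using auto by (simp add: normal_auts_def)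
  have "inv g \<otimes> inv g \<in> group_center G \<and> inv g = inv g \<otimes> inv g \<otimes> g" if "g \<in> carrier G" for g
  proof
    show "inv g \<otimes> inv g \<in> group_center G"
      using that m_comm[of "inv g \<otimes> inv g"] by (simp add: group_center_def)
    show "inv g = inv g \<otimes> inv g \<otimes> g" using that by (simp add: m_assoc)
  qed
  then show "(\<lambda>x \<in> carrier G. inv x) \<in> central_auts G"
    using auto by (intro central_autsI) auto
qed


section \<open>The free nilpotent group\<close>

definition nil_class :: "nat \<Rightarrow> nat \<Rightarrow> word set \<Rightarrow> word set set" where
  "nil_class n k a = lower_central (free_group n) (k + 1) #>\<^bsub>free_group n\<^esub> a"

lemma nil_class_hom: "nil_class n k \<in> hom (free_group n) (free_nilpotent n k)"
  unfolding nil_class_def[abs_def] free_nilpotent_def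
  by (intro normal.r_coset_hom_Mod group.normal_lower_central group_free_group)

lemma group_hom_nil_class: "group_hom (free_group n) (free_nilpotent n k) (nil_class n k)"
  using group_free_group group_free_nilpotent nil_class_hom
  by (simp add: group_hom_def group_hom_axioms_def)

lemma carrier_free_nilpotent: "carrier (free_nilpotent n k) = nil_class n k ` carrier (free_group n)"
  by (simp add: free_nilpotent_def carrier_FactGroup nil_class_def[abs_def])

lemma nil_class_eq_one_iff:
  assumes "a \<in> carrier (free_group n)"
  shows "nil_class n k a = \<one>\<^bsub>free_nilpotent n k\<^esub> \<longleftrightarrow> a \<in> lower_central (free_group n) (k + 1)"
proof -
  interpret F: group "free_group n" by (rule group_free_group)
  show ?thesis
    using F.coset_join1[OF _ assms F.subgroup_lower_central] F.coset_join2[OF assms F.subgroup_lower_central]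
      F.lower_central_subset
    by (auto simp: nil_class_def free_nilpotent_def simp del: lower_central.simps)
qed

lemma nilpotent_gen_eq: "nilpotent_gen n k = nil_class n k \<circ> free_gen n"
  by (auto simp: nilpotent_gen_def nil_class_def)

lemma nilpotent_gen_closed: "nilpotent_gen n k ` {1..n} \<subseteq> carrier (free_nilpotent n k)"
  using free_gen_closed by (auto simp: nilpotent_gen_eq carrier_free_nilpotent)

lemma word_value_nilpotent_gen:
  assumes "w \<in> words n"
  shows "word_value (free_nilpotent n k) (nilpotent_gen n k) w = nil_class n k (word_class n w)"
  using hom_word_value[OF group_free_group group_free_nilpotent nil_class_hom free_gen_closed assms] assms
  by (simp add: nilpotent_gen_eq word_value_free_gen)

lemma palindromes_eq: "palindromes n k = {nil_class n k (word_class n w) | w. w \<in> words n \<and> rev w = w}"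
  using word_value_nilpotent_gen by (force simp: palindromes_def palindrome_word_def)

lemma carrier_free_nilpotent_wordE:
  assumes "g \<in> carrier (free_nilpotent n k)"
  obtains w where "w \<in> words n" "g = nil_class n k (word_class n w)"
  using assms by (auto simp: carrier_free_nilpotent elim: carrier_free_groupE)

lemma nilpotent_gen_palindrome:
  "i \<in> {1..n} \<Longrightarrow> nilpotent_gen n k i \<in> palindromes n k"
  unfolding palindromes_eq by (auto intro!: exI[of _ "[(i, True)]"] simp: nilpotent_gen_eq)

lemma lower_central_imp_center:
  assumes "k \<ge> 1" "a \<in> lower_central (free_group n) k"
  shows "nil_class n k a \<in> group_center (free_nilpotent n k)"
proof -
  interpret q: group_hom "free_group n" "free_nilpotent n k" "nil_class n k" by (rule group_hom_nil_class)
  have a: "a \<in> carrier (free_group n)" using assms(2) by (rule q.G.lower_central_subset)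
  have "nil_class n k a \<otimes>\<^bsub>free_nilpotent n k\<^esub> nil_class n k b = nil_class n k b \<otimes>\<^bsub>free_nilpotent n k\<^esub> nil_class n k a"
    if b: "b \<in> carrier (free_group n)" for b
  proof -
    have "nil_class n k (commutator (free_group n) a b) = \<one>\<^bsub>free_nilpotent n k\<^esub>"
      using q.G.commutator_lower_central_Suc(1)[OF assms b] a b
      by (subst nil_class_eq_one_iff) (simp_all del: lower_central.simps)
    then show ?thesis
      using a b hom_commutator[OF group_free_group group_free_nilpotent nil_class_hom a b]
      by (simp add: q.H.commutator_eq_one_iff)
  qed
  then show ?thesis using a by (auto simp: group_center_def carrier_free_nilpotent)
qed

lemma center_imp_lower_central:
  assumes "n \<ge> 2" "k \<ge> 1" "a \<in> carrier (free_group n)"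
    and comm: "\<And>l. l \<in> {1..n} \<Longrightarrow>
      nil_class n k a \<otimes>\<^bsub>free_nilpotent n k\<^esub> nilpotent_gen n k l =
      nilpotent_gen n k l \<otimes>\<^bsub>free_nilpotent n k\<^esub> nil_class n k a"
  shows "a \<in> lower_central (free_group n) k"
proof (rule commutes_modulo_imp_lower_central[where i = 1 and j = 2 and k = k])
  interpret q: group_hom "free_group n" "free_nilpotent n k" "nil_class n k" by (rule group_hom_nil_class)
  fix l assume l: "l \<in> {1..n}"
  then have x: "free_gen n l \<in> carrier (free_group n)" using free_gen_closed by blast
  have "nil_class n k (commutator (free_group n) a (free_gen n l)) = \<one>\<^bsub>free_nilpotent n k\<^esub>"
    using assms(3) x comm[OF l] hom_commutator[OF group_free_group group_free_nilpotent nil_class_hom assms(3) x]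
    by (simp add: q.H.commutator_eq_one_iff nilpotent_gen_eq)
  then show "commutator (free_group n) a (free_gen n l) \<in> lower_central (free_group n) (Suc k)"
    using assms(3) x by (subst (asm) nil_class_eq_one_iff) (simp_all del: lower_central.simps)
qed (use assms in auto)

lemma word_value_cong:
  "(\<And>i. i \<in> {1..n} \<Longrightarrow> y i = y' i) \<Longrightarrow> w \<in> words n \<Longrightarrow> word_value G y w = word_value G y' w"
  by (induction w) auto

lemma auto_eq_one_if_fixes_gens:
  assumes "f \<in> auto (free_nilpotent n k)" "\<And>i. i \<in> {1..n} \<Longrightarrow> f (nilpotent_gen n k i) = nilpotent_gen n k i"
  shows "f = \<one>\<^bsub>AutoGroup (free_nilpotent n k)\<^esub>"
proof -
  interpret N: group "free_nilpotent n k" by (rule group_free_nilpotent)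
  have "f g = g" if g: "g \<in> carrier (free_nilpotent n k)" for g
  proof -
    obtain w where w: "w \<in> words n" "g = nil_class n k (word_class n w)"
      using g by (rule carrier_free_nilpotent_wordE)
    have "f (word_value (free_nilpotent n k) (nilpotent_gen n k) w) =
        word_value (free_nilpotent n k) (f \<circ> nilpotent_gen n k) w"
      using assms(1) w by (intro hom_word_value[OF N.is_group N.is_group _ nilpotent_gen_closed]) (auto simp: auto_def)
    also have "\<dots> = word_value (free_nilpotent n k) (nilpotent_gen n k) w"
      using assms(2) w by (intro word_value_cong) auto
    finally show ?thesis using w by (simp add: word_value_nilpotent_gen)
  qed
  then show ?thesis
    unfolding N.AutoGroup_simps using assms(1) N.id_in_auto by (intro N.auto_eqI) auto
qed


section \<open>Palindromes\<close>

text \<open>Substituting palindromes for the letters of a palindrome gives a palindrome, so palindromic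
  automorphisms are closed under composition.\<close>

lemma palindromic_image:
  assumes "f \<in> palindromic_auts n k" "p \<in> palindromes n k"
  shows "f p \<in> palindromes n k"
proof -
  interpret N: group "free_nilpotent n k" by (rule group_free_nilpotent)
  let ?y = "nilpotent_gen n k"
  let ?v = "word_value (free_nilpotent n k) ?y"
  have fa: "f \<in> hom (free_nilpotent n k) (free_nilpotent n k)" "\<And>i. i \<in> {1..n} \<Longrightarrow> f (?y i) \<in> palindromes n k"
    using assms(1) by (auto simp: palindromic_auts_def auto_def)
  have "\<exists>w. w \<in> words n \<and> rev w = w \<and> f (?y i) = ?v w" if "i \<in> {1..n}" for i
    using fa(2)[OF that] by (auto simp: palindromes_def palindrome_word_def)
  then obtain s where s: "\<And>i. i \<in> {1..n} \<Longrightarrow> s i \<in> words n \<and> rev (s i) = s i \<and> f (?y i) = ?v (s i)"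
    by metis
  define t where "t l = (if snd l then s (fst l) else inverse_word (s (fst l)))" for l :: "nat \<times> bool"
  have rev_inverse: "rev (inverse_word u) = inverse_word u" if "rev u = u" for u
    using that by (metis inverse_word_def rev_map)
  have t: "t l \<in> words n \<and> rev (t l) = t l \<and> ?v (t l) = letter_value (free_nilpotent n k) (f \<circ> ?y) l"
    if "fst l \<in> {1..n}" for l
    using s[OF that] inverse_word_words[of "s (fst l)" n] N.word_value_inverse_word[OF nilpotent_gen_closed]
    by (cases l) (auto simp: t_def rev_inverse)
  obtain w where w: "w \<in> words n" "rev w = w" "p = ?v w"
    using assms(2) by (auto simp: palindromes_def palindrome_word_def)
  have sub: "concat (map t u) \<in> words n \<and> rev (concat (map t u)) = concat (map t (rev u)) \<and>
      ?v (concat (map t u)) = word_value (free_nilpotent n k) (f \<circ> ?y) u" if "u \<in> words n" for u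
    using that
  proof (induction u)
    case (Cons l u)
    then have "t l \<in> words n" "concat (map t u) \<in> words n" using t by auto
    then have "?v (t l @ concat (map t u)) = ?v (t l) \<otimes>\<^bsub>free_nilpotent n k\<^esub> ?v (concat (map t u))"
      by (rule N.word_value_append[OF nilpotent_gen_closed])
    then show ?case using Cons t by (simp del: comp_apply)
  qed simp
  have "f p = ?v (concat (map t w))"
    unfolding w(3) using hom_word_value[OF N.is_group N.is_group fa(1) nilpotent_gen_closed w(1)] sub[OF w(1)] by simp
  moreover have "rev (concat (map t w)) = concat (map t w)" using sub[OF w(1)] w(2) by simp
  ultimately show ?thesis using sub[OF w(1)] by (auto simp: palindromes_def palindrome_word_def)
qed

text \<open>For odd \<open>k\<close> the sign in \<open>magnus_top_rev\<close> is \<open>1\<close>, so a word representing an element of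
  \<open>\<gamma>\<^sub>k\<close> and its reversal have the same expansion up to degree \<open>k\<close>. By the theorem of Magnus they
  agree modulo \<open>\<gamma>\<^bsub>k+1\<^esub>\<close>.\<close>

lemma nil_class_rev:
  assumes "odd k" "u \<in> words n" "word_class n u \<in> lower_central (free_group n) k"
  shows "nil_class n k (word_class n (rev u)) = nil_class n k (word_class n u)"
proof -
  interpret q: group_hom "free_group n" "free_nilpotent n k" "nil_class n k" by (rule group_hom_nil_class)
  have k: "k \<ge> 1" using assms(1) by (cases k) auto
  have ru: "rev u \<in> words n" using assms(2) by (auto simp: words_def)
  let ?a = "word_class n (rev u)" and ?b = "word_class n u"
  have ab: "?a \<in> carrier (free_group n)" "?b \<in> carrier (free_group n)"
    using ru assms(2) word_class_closed by auto
  have rev: "magnus ?a v = magnus ?b (rev v)" for v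
    using ru assms(2) by (simp add: magnus_word_class word_value_magnus_rev)
  have "magnus ?a \<in> magnus_filtration k"
  proof (rule magnus_filtrationI)
    show "magnus ?a \<in> carrier magnus_group" using magnus_hom ab by (auto simp: hom_def)
    show "magnus ?a v = series_one v" if "length v < k" for v
      using magnus_filtration_low[OF magnus_lower_central[OF k assms(3)], of "rev v"] that rev
      by (simp add: series_one_def)
  qed
  then have a: "?a \<in> lower_central (free_group n) k" using magnus_theorem[OF ab(1) k] by simp
  let ?d = "?a \<otimes>\<^bsub>free_group n\<^esub> inv\<^bsub>free_group n\<^esub> ?b"
  have ib: "inv\<^bsub>free_group n\<^esub> ?b \<in> lower_central (free_group n) k"
    using assms(3) subgroup.m_inv_closed[OF q.G.subgroup_lower_central] by blast
  have "?d \<in> lower_central (free_group n) (Suc k)"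
  proof (rule magnus_top_zero[OF k])
    show "?d \<in> lower_central (free_group n) k"
      using a ib subgroup.m_closed[OF q.G.subgroup_lower_central] by blast
    fix v :: "nat list" assume v: "length v = k"
    show "magnus ?d v = 0"
      using magnus_top_mult[OF k a ib v] magnus_top_inv[OF k assms(3) v] magnus_top_rev[OF k assms(3) v] rev assms(1)
      by simp
  qed
  then have "nil_class n k ?d = \<one>\<^bsub>free_nilpotent n k\<^esub>"
    using ab by (subst nil_class_eq_one_iff) (simp_all del: lower_central.simps)
  then show ?thesis using ab q.H.inv_equality[of "nil_class n k ?a" "inv\<^bsub>free_nilpotent n k\<^esub> nil_class n k ?b"] by simp
qed

lemma palindrome_sandwich:
  assumes "odd k" "z \<in> lower_central (free_group n) k" "p \<in> palindromes n k"
  shows "nil_class n k z \<otimes>\<^bsub>free_nilpotent n k\<^esub> p \<otimes>\<^bsub>free_nilpotent n k\<^esub> nil_class n k z \<in> palindromes n k"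
proof -
  interpret q: group_hom "free_group n" "free_nilpotent n k" "nil_class n k" by (rule group_hom_nil_class)
  obtain u where u: "u \<in> words n" "z = word_class n u"
    using q.G.lower_central_subset[OF assms(2)] by (rule carrier_free_groupE)
  obtain w where w: "w \<in> words n" "rev w = w" "p = nil_class n k (word_class n w)"
    using assms(3) by (auto simp: palindromes_eq)
  have ru: "rev u \<in> words n" using u by (auto simp: words_def)
  have "nil_class n k (word_class n (u @ w @ rev u)) =
    nil_class n k z \<otimes>\<^bsub>free_nilpotent n k\<^esub> p \<otimes>\<^bsub>free_nilpotent n k\<^esub> nil_class n k z"
    using u w ru nil_class_rev[OF assms(1) u(1)] assms(2) word_class_closed
    by (simp add: word_class_append q.H.m_assoc)
  moreover have "u @ w @ rev u \<in> words n" "rev (u @ w @ rev u) = u @ w @ rev u" using u w ru by auto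
  ultimately show ?thesis unfolding palindromes_eq by (metis (mono_tags, lifting) mem_Collect_eq)
qed


section \<open>Central palindromic automorphisms in rank at least two\<close>

lemma central_aut_gen:
  assumes "n \<ge> 2" "k \<ge> 1" "f \<in> central_auts (free_nilpotent n k)" "i \<in> {1..n}"
  obtains z where "z \<in> lower_central (free_group n) k"
    "f (nilpotent_gen n k i) = nil_class n k z \<otimes>\<^bsub>free_nilpotent n k\<^esub> nilpotent_gen n k i"
proof -
  interpret N: group "free_nilpotent n k" by (rule group_free_nilpotent)
  have y: "nilpotent_gen n k l \<in> carrier (free_nilpotent n k)" if "l \<in> {1..n}" for l
    using that nilpotent_gen_closed by blast
  obtain c where c: "c \<in> group_center (free_nilpotent n k)"
    "f (nilpotent_gen n k i) = c \<otimes>\<^bsub>free_nilpotent n k\<^esub> nilpotent_gen n k i"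
    using N.central_autsD[OF assms(3) y[OF assms(4)]] by blast
  then obtain z where z: "z \<in> carrier (free_group n)" "c = nil_class n k z"
    by (auto simp: group_center_def carrier_free_nilpotent)
  have "z \<in> lower_central (free_group n) k"
    using c(1) z y by (intro center_imp_lower_central[OF assms(1,2) z(1)]) (auto simp: group_center_def)
  then show ?thesis using that c z by blast
qed

text \<open>Let \<open>k\<close> be even and let \<open>z x\<^sub>i\<close> be a palindrome with \<open>z \<in> \<gamma>\<^sub>k\<close>. In degree \<open>k\<close> its Magnus
  expansion is that of \<open>z\<close>. It is invariant under reversal because of the palindrome, and reversal
  changes its sign because it is a Lie element of even degree.\<close>

lemma even_palindrome_imp_trivial:
  assumes "even k" "k \<ge> 1" "i \<in> {1..n}" "z \<in> lower_central (free_group n) k"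
    and "nil_class n k z \<otimes>\<^bsub>free_nilpotent n k\<^esub> nilpotent_gen n k i \<in> palindromes n k"
  shows "nil_class n k z = \<one>\<^bsub>free_nilpotent n k\<^esub>"
proof -
  interpret q: group_hom "free_group n" "free_nilpotent n k" "nil_class n k" by (rule group_hom_nil_class)
  have z: "z \<in> carrier (free_group n)" using assms(4) by (rule q.G.lower_central_subset)
  have x: "free_gen n i \<in> carrier (free_group n)" using assms(3) free_gen_closed by blast
  obtain w where w: "w \<in> words n" "rev w = w"
    "nil_class n k z \<otimes>\<^bsub>free_nilpotent n k\<^esub> nilpotent_gen n k i = nil_class n k (word_class n w)"
    using assms(5) by (auto simp: palindromes_eq)
  let ?p = "word_class n w" and ?g = "z \<otimes>\<^bsub>free_group n\<^esub> free_gen n i"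
  let ?d = "?p \<otimes>\<^bsub>free_group n\<^esub> inv\<^bsub>free_group n\<^esub> ?g"
  have p: "?p \<in> carrier (free_group n)" using w(1) by (rule word_class_closed)
  have g: "?g \<in> carrier (free_group n)" using z x by simp
  have "nil_class n k ?g = nil_class n k ?p" using w(3) z x by (simp add: nilpotent_gen_eq)
  then have "nil_class n k ?d = \<one>\<^bsub>free_nilpotent n k\<^esub>" using p g by (simp del: q.hom_mult add: q.hom_mult[OF p])
  then have d: "?d \<in> lower_central (free_group n) (Suc k)"
    using p g by (subst (asm) nil_class_eq_one_iff) (simp_all del: lower_central.simps)
  have dg: "?d \<otimes>\<^bsub>free_group n\<^esub> ?g = ?p" using p g by (simp add: q.G.m_assoc del: q.G.inv_mult_group)
  have "magnus ?p = series_mult (magnus ?d) (magnus ?g)"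
    using hom_mult[OF magnus_hom[of n], of ?d ?g] p g
    by (simp only: dg magnus_group_simps q.G.m_closed q.G.inv_closed)
  then have low: "magnus ?p v = magnus ?g v" if "length v = k" for v
    using magnus_filtration_mult_low(1)[OF magnus_lower_central[OF _ d], of v "magnus ?g"] that by simp
  have "magnus ?g = series_mult (magnus z) (magnus_gen i)"
    using magnus_hom[of n] z x magnus_free_gen[OF assms(3)] by (simp add: hom_def)
  then have top: "magnus ?p v = magnus z v" if "length v = k" for v
    using magnus_filtration_mult_top(1)[OF magnus_lower_central[OF assms(2,4)], of v "magnus_gen i"] that low[of v] assms(1,2)
    by (auto simp: magnus_gen_def series_one_def)
  have "magnus ?p (rev v) = magnus ?p v" for v
    using w word_value_magnus_rev[of w v] by (simp add: magnus_word_class)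
  then have "magnus z v = 0" if "length v = k" for v
    using magnus_top_rev[OF assms(2,4) that] top[of v] top[of "rev v"] that assms(1) by simp
  then have "z \<in> lower_central (free_group n) (Suc k)"
    using assms(2,4) by (intro magnus_top_zero) auto
  then show ?thesis using z by (subst nil_class_eq_one_iff) (simp_all del: lower_central.simps)
qed

lemma even_central_palindromic_trivial:
  assumes "n \<ge> 2" "k \<ge> 1" "even k" "f \<in> central_palindromic_auts n k"
  shows "f = \<one>\<^bsub>AutoGroup (free_nilpotent n k)\<^esub>"
proof (rule auto_eq_one_if_fixes_gens)
  interpret N: group "free_nilpotent n k" by (rule group_free_nilpotent)
  show "f \<in> auto (free_nilpotent n k)"
    using assms(4) by (simp add: central_palindromic_auts_def palindromic_auts_def)
  fix i assume i: "i \<in> {1..n}"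
  have f: "f \<in> central_auts (free_nilpotent n k)" "f (nilpotent_gen n k i) \<in> palindromes n k"
    using assms(4) i by (auto simp: central_palindromic_auts_def palindromic_auts_def)
  obtain z where z: "z \<in> lower_central (free_group n) k"
    "f (nilpotent_gen n k i) = nil_class n k z \<otimes>\<^bsub>free_nilpotent n k\<^esub> nilpotent_gen n k i"
    using central_aut_gen[OF assms(1,2) f(1) i] by blast
  have "nil_class n k z = \<one>\<^bsub>free_nilpotent n k\<^esub>"
    using even_palindrome_imp_trivial[OF assms(3,2) i z(1)] f(2) z(2) by simp
  then show "f (nilpotent_gen n k i) = nilpotent_gen n k i"
    using z(2) i nilpotent_gen_closed[of n k] by (simp add: image_subset_iff)
qed

text \<open>If a central automorphism sends \<open>x\<^sub>i\<close> to \<open>z x\<^sub>i\<close>, then its inverse sends \<open>x\<^sub>i\<close> to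
  \<open>z\<inverse> x\<^sub>i = z\<inverse> (z x\<^sub>i) z\<inverse>\<close>, since it fixes commutators and hence \<open>z\<close>.\<close>

lemma odd_inverse_palindromic:
  assumes "n \<ge> 2" "k \<ge> 2" "odd k" "f \<in> central_palindromic_auts n k" "i \<in> {1..n}"
  shows "(inv\<^bsub>AutoGroup (free_nilpotent n k)\<^esub> f) (nilpotent_gen n k i) \<in> palindromes n k"
proof -
  interpret q: group_hom "free_group n" "free_nilpotent n k" "nil_class n k" by (rule group_hom_nil_class)
  interpret Z: subgroup "group_center (free_nilpotent n k)" "free_nilpotent n k" by (rule q.H.subgroup_group_center)
  let ?y = "nilpotent_gen n k i"
  have y: "?y \<in> carrier (free_nilpotent n k)" using assms(5) nilpotent_gen_closed by blast
  have f: "f \<in> central_auts (free_nilpotent n k)" "f ?y \<in> palindromes n k" "f \<in> auto (free_nilpotent n k)"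
    using assms(4,5) by (auto simp: central_palindromic_auts_def palindromic_auts_def)
  interpret f: group_hom "free_nilpotent n k" "free_nilpotent n k" f
    using f(3) by (rule q.H.auto_group_hom)
  obtain z where z: "z \<in> lower_central (free_group n) k"
    "f ?y = nil_class n k z \<otimes>\<^bsub>free_nilpotent n k\<^esub> ?y"
    using central_aut_gen[OF assms(1) _ f(1) assms(5)] assms(2) by auto
  have fixed: "f (nil_class n k a) = nil_class n k a" if "a \<in> lower_central (free_group n) k" for a
  proof -
    obtain m where m: "k = Suc m" "m \<ge> 1" using assms(2) by (cases k) auto
    let ?C = "{commutator (free_group n) h g | h g. h \<in> lower_central (free_group n) m \<and> g \<in> carrier (free_group n)}"
    have C: "f (nil_class n k c) = nil_class n k c \<and> c \<in> carrier (free_group n)" if c: "c \<in> ?C" for c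
    proof -
      obtain h g where c: "c = commutator (free_group n) h g" "h \<in> carrier (free_group n)" "g \<in> carrier (free_group n)"
        using c q.G.lower_central_subset by blast
      have "nil_class n k c = commutator (free_nilpotent n k) (nil_class n k h) (nil_class n k g)"
        unfolding c(1) using c(2,3) by (rule hom_commutator[OF group_free_group group_free_nilpotent nil_class_hom])
      then show ?thesis using q.H.central_aut_fixes_commutator[OF f(1)] c by simp
    qed
    have "a \<in> generate (free_group n) ?C" using that m(1) q.G.lower_central_Suc[OF m(2)] by metis
    then have "f (nil_class n k a) = nil_class n k a \<and> a \<in> carrier (free_group n)"
    proof (induction rule: generate.induct)
      case (incl c)
      then show ?case by (rule C)
    next
      case (inv c)
      then show ?case using C[OF inv] by simp
    next
      case (eng c d)
      then show ?case by simp
    qed simp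
    then show ?thesis by blast
  qed
  let ?z = "nil_class n k z" and ?z' = "nil_class n k (inv\<^bsub>free_group n\<^esub> z)"
  have zc: "z \<in> carrier (free_group n)" using z(1) by (rule q.G.lower_central_subset)
  have iz: "inv\<^bsub>free_group n\<^esub> z \<in> lower_central (free_group n) k"
    using z(1) subgroup.m_inv_closed[OF q.G.subgroup_lower_central] by blast
  have "f (?z' \<otimes>\<^bsub>free_nilpotent n k\<^esub> ?y) = ?y"
    using fixed[OF iz] z(2) zc y by (simp add: q.H.mult_inv_cancel)
  then have "(inv\<^bsub>AutoGroup (free_nilpotent n k)\<^esub> f) ?y = ?z' \<otimes>\<^bsub>free_nilpotent n k\<^esub> ?y"
    using q.H.inv_auto(2)[OF f(3), of "?z' \<otimes>\<^bsub>free_nilpotent n k\<^esub> ?y"] zc y by simp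
  also have "\<dots> = ?z' \<otimes>\<^bsub>free_nilpotent n k\<^esub> f ?y \<otimes>\<^bsub>free_nilpotent n k\<^esub> ?z'"
  proof -
    have "?z' \<in> group_center (free_nilpotent n k)"
      using assms(2) iz by (intro lower_central_imp_center) auto
    then have "?z' \<otimes>\<^bsub>free_nilpotent n k\<^esub> ?y = ?y \<otimes>\<^bsub>free_nilpotent n k\<^esub> ?z'"
      using y by (rule q.H.group_center_commutes)
    moreover have "?z' \<otimes>\<^bsub>free_nilpotent n k\<^esub> f ?y = ?y"
      using z(2) zc y by (simp add: q.H.mult_inv_cancel)
    ultimately show ?thesis by simp
  qed
  also have "\<dots> \<in> palindromes n k" using assms(3) iz f(2) by (rule palindrome_sandwich)
  finally show ?thesis .
qed

lemma lyndon_replicate: "lyndon (replicate t 1 @ [2 :: nat])"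
proof (induction t)
  case (Suc t)
  have "[] < replicate m 1 @ [2 :: nat]" for m by (cases m) auto
  then have "[1 :: nat] < replicate t 1 @ [2]" by (cases t) auto
  then show ?case using lyndon_append[OF lyndon_letter Suc.IH, of 1] by simp
qed (simp add: lyndon_letter)

text \<open>For odd \<open>k \<ge> 3\<close> conjugation by a square \<open>h\<^sup>2\<close> with \<open>h \<in> \<gamma>\<^bsub>k-1\<^esub>\<close> sends \<open>x\<^sub>i\<close> to
  \<open>[h, x\<^sub>i]\<^sup>2 x\<^sub>i = [h, x\<^sub>i] x\<^sub>i [h, x\<^sub>i]\<close>, which is a palindrome. It is not the identity when the
  leading part of \<open>h\<close> is non-zero, as for the Lyndon commutator of \<open>1\<cdots>12\<close>.\<close>

lemma odd_exists_inner:
  assumes "n \<ge> 2" "k \<ge> 3" "odd k"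
  shows "\<exists>f \<in> central_palindromic_auts n k \<inter> normal_auts (free_nilpotent n k).
    f \<noteq> \<one>\<^bsub>AutoGroup (free_nilpotent n k)\<^esub>"
proof -
  interpret q: group_hom "free_group n" "free_nilpotent n k" "nil_class n k" by (rule group_hom_nil_class)
  let ?N = "free_nilpotent n k" and ?F = "free_group n"
  define w where "w = replicate (k - 2) 1 @ [2 :: nat]"
  have w: "w \<in> lists {1..n}" "lyndon w" "length w = k - 1"
    using assms(1,2) lyndon_replicate by (auto simp: w_def)
  define a where "a = lyndon_commutator ?F (free_gen n) w"
  have a: "a \<in> lower_central ?F (k - 1)" "a \<in> carrier ?F"
    using q.G.lyndon_commutator_mem[OF free_gen_closed w(1)] w q.G.lower_central_subset
    by (auto simp: a_def lyndon_def)
  let ?h = "nil_class n k a"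
  let ?g = "?h \<otimes>\<^bsub>?N\<^esub> ?h"
  define f where "f = (\<lambda>x \<in> carrier ?N. ?g \<otimes>\<^bsub>?N\<^esub> x \<otimes>\<^bsub>?N\<^esub> inv\<^bsub>?N\<^esub> ?g)"
  have g: "?g \<in> carrier ?N" using a by simp
  have f: "f \<in> auto ?N" "f \<in> normal_auts ?N"
    unfolding f_def using q.H.inner_auto[OF g] q.H.inner_auto_normal[OF g] by auto
  have f_eq: "f (nil_class n k b) = nil_class n k u \<otimes>\<^bsub>?N\<^esub> nil_class n k b \<otimes>\<^bsub>?N\<^esub> nil_class n k u"
      "nil_class n k u \<in> group_center ?N" "u \<in> lower_central ?F k"
    if b: "b \<in> carrier ?F" and u: "u = commutator ?F a b" for b u
  proof -
    let ?u = "nil_class n k u" and ?b = "nil_class n k b"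
    have uc: "u \<in> carrier ?F" using u a b by simp
    have "u \<in> lower_central ?F (Suc (k - 1))"
      unfolding u using assms(2) a b by (intro q.G.commutator_lower_central_Suc) auto
    then show uk: "u \<in> lower_central ?F k" using assms(2) by (simp del: lower_central.simps)
    then show uz: "?u \<in> group_center ?N" using assms(2) by (intro lower_central_imp_center) auto
    have comm: "?u \<otimes>\<^bsub>?N\<^esub> x = x \<otimes>\<^bsub>?N\<^esub> ?u" if "x \<in> carrier ?N" for x
      using uz that by (simp add: group_center_def)
    have C: "?u \<in> carrier ?N" "?b \<in> carrier ?N" "?h \<in> carrier ?N" using uc b a by auto
    have conj: "?h \<otimes>\<^bsub>?N\<^esub> ?b \<otimes>\<^bsub>?N\<^esub> inv\<^bsub>?N\<^esub> ?h = ?u \<otimes>\<^bsub>?N\<^esub> ?b"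
      using q.H.conj_eq_commutator_mult[OF C(3,2)] hom_commutator[OF group_free_group group_free_nilpotent nil_class_hom a(2) b] u
      by simp
    have "f ?b = ?h \<otimes>\<^bsub>?N\<^esub> (?h \<otimes>\<^bsub>?N\<^esub> ?b \<otimes>\<^bsub>?N\<^esub> inv\<^bsub>?N\<^esub> ?h) \<otimes>\<^bsub>?N\<^esub> inv\<^bsub>?N\<^esub> ?h"
      using C by (simp add: f_def q.H.m_assoc q.H.inv_mult_group)
    also have "\<dots> = (?h \<otimes>\<^bsub>?N\<^esub> ?u) \<otimes>\<^bsub>?N\<^esub> ?b \<otimes>\<^bsub>?N\<^esub> inv\<^bsub>?N\<^esub> ?h"
      unfolding conj using C by (simp add: q.H.m_assoc)
    also have "\<dots> = ?u \<otimes>\<^bsub>?N\<^esub> (?h \<otimes>\<^bsub>?N\<^esub> ?b \<otimes>\<^bsub>?N\<^esub> inv\<^bsub>?N\<^esub> ?h)"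
      unfolding comm[OF C(3), symmetric] using C by (simp add: q.H.m_assoc)
    also have "\<dots> = ?u \<otimes>\<^bsub>?N\<^esub> ?b \<otimes>\<^bsub>?N\<^esub> ?u"
      unfolding conj using C comm[OF C(2)] by (metis q.H.m_assoc)
    finally show "f ?b = ?u \<otimes>\<^bsub>?N\<^esub> ?b \<otimes>\<^bsub>?N\<^esub> ?u" .
  qed
  have "f \<in> central_auts ?N"
  proof (rule q.H.central_autsI[OF f(1)])
    fix x assume "x \<in> carrier ?N"
    then obtain b where b: "b \<in> carrier ?F" "x = nil_class n k b" by (auto simp: carrier_free_nilpotent)
    let ?u = "nil_class n k (commutator ?F a b)"
    have "?u \<in> carrier ?N" "x \<in> carrier ?N" using a b by auto
    moreover have "?u \<otimes>\<^bsub>?N\<^esub> x = x \<otimes>\<^bsub>?N\<^esub> ?u" using f_eq(2)[OF b(1) refl] b by (simp add: group_center_def)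
    ultimately have "f x = (?u \<otimes>\<^bsub>?N\<^esub> ?u) \<otimes>\<^bsub>?N\<^esub> x"
      using f_eq(1)[OF b(1) refl] b(2) by (metis q.H.m_assoc)
    then show "\<exists>z \<in> group_center ?N. f x = z \<otimes>\<^bsub>?N\<^esub> x"
      using f_eq(2)[OF b(1) refl] subgroup.m_closed[OF q.H.subgroup_group_center] by blast
  qed
  moreover have "f (nilpotent_gen n k i) \<in> palindromes n k" if i: "i \<in> {1..n}" for i
  proof -
    have x: "free_gen n i \<in> carrier ?F" using i free_gen_closed by blast
    show ?thesis
      using f_eq(1)[OF x refl] palindrome_sandwich[OF assms(3) f_eq(3)[OF x refl] nilpotent_gen_palindrome[OF i]]
      by (simp add: nilpotent_gen_eq)
  qed
  moreover have "f \<noteq> \<one>\<^bsub>AutoGroup ?N\<^esub>"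
  proof
    assume one: "f = \<one>\<^bsub>AutoGroup ?N\<^esub>"
    have "?g \<otimes>\<^bsub>?N\<^esub> x = x \<otimes>\<^bsub>?N\<^esub> ?g" if x: "x \<in> carrier ?N" for x
    proof -
      have "?g \<otimes>\<^bsub>?N\<^esub> x \<otimes>\<^bsub>?N\<^esub> inv\<^bsub>?N\<^esub> ?g = x"
        using fun_cong[OF one, of x] x by (simp add: f_def q.H.AutoGroup_simps)
      then show ?thesis using x g by (metis q.H.inv_solve_right' q.H.m_closed)
    qed
    then have "a \<otimes>\<^bsub>?F\<^esub> a \<in> lower_central ?F k"
      using a assms(1,2) nilpotent_gen_closed[of n k]
      by (intro center_imp_lower_central) (auto simp: image_subset_iff)
    then have "magnus (a \<otimes>\<^bsub>?F\<^esub> a) w = series_one w"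
      using assms(2) w(3) by (intro magnus_filtration_low[OF magnus_lower_central]) auto
    moreover have "magnus (a \<otimes>\<^bsub>?F\<^esub> a) w = 2"
      using magnus_top_mult[OF _ a(1) a(1) w(3)] assms(2) magnus_lyndon_commutator[OF w(1,2)]
      by (simp add: a_def)
    ultimately show False by (simp add: series_one_def split: if_splits)
  qed
  ultimately show ?thesis using f by (auto simp: central_palindromic_auts_def palindromic_auts_def)
qed


section \<open>The abelian case\<close>

lemma comm_group_free_nilpotent:
  assumes "k = 1 \<or> n = 1"
  shows "comm_group (free_nilpotent n k)"
proof -
  interpret q: group_hom "free_group n" "free_nilpotent n k" "nil_class n k" by (rule group_hom_nil_class)
  have "commutator (free_group n) a b \<in> lower_central (free_group n) (k + 1)"
    if ab: "a \<in> carrier (free_group n)" "b \<in> carrier (free_group n)" for a b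
  proof (cases "k = 1")
    case True
    then show ?thesis using q.G.commutator_lower_central_Suc(1)[of 1 a b] ab by (simp del: lower_central.simps(3))
  next
    case False
    then have n: "n = 1" using assms by simp
    have gen: "generate (free_group n) {free_gen n 1} = carrier (free_group n)"
      using generate_free_gen[of n] n by simp
    have x: "free_gen n 1 \<in> carrier (free_group n)" using free_gen_closed[of n] n by simp
    note one = q.G.one_is_normal
    have "commutator (free_group n) (free_gen n 1) b \<in> {\<one>\<^bsub>free_group n\<^esub>}"
      by (rule q.G.commutator_generate_right[OF one x, of "{free_gen n 1}"])
        (use x ab gen q.G.commutator_self in auto)
    then have "commutator (free_group n) a b \<in> {\<one>\<^bsub>free_group n\<^esub>}"
      using q.G.commutator_generate_left[OF one ab(2), of "{free_gen n 1}" a] x ab gen by auto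
    then show ?thesis using subgroup.one_closed[OF q.G.subgroup_lower_central] by (simp del: lower_central.simps)
  qed
  then have one: "nil_class n k (commutator (free_group n) a b) = \<one>\<^bsub>free_nilpotent n k\<^esub>"
    if "a \<in> carrier (free_group n)" "b \<in> carrier (free_group n)" for a b
    using that by (simp add: nil_class_eq_one_iff del: lower_central.simps)
  have "nil_class n k a \<otimes>\<^bsub>free_nilpotent n k\<^esub> nil_class n k b = nil_class n k b \<otimes>\<^bsub>free_nilpotent n k\<^esub> nil_class n k a"
    if ab: "a \<in> carrier (free_group n)" "b \<in> carrier (free_group n)" for a b
  proof -
    have "commutator (free_nilpotent n k) (nil_class n k a) (nil_class n k b) = \<one>\<^bsub>free_nilpotent n k\<^esub>"
      using one[OF ab] hom_commutator[OF group_free_group group_free_nilpotent nil_class_hom[of n k] ab] by simp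
    then show ?thesis using ab by (simp add: q.H.commutator_eq_one_iff)
  qed
  then show ?thesis
    by (intro q.H.group_comm_groupI) (auto simp: carrier_free_nilpotent)
qed

lemma palindrome_halves:
  assumes "rev w = w"
  obtains u v where "w = u @ v @ rev u" "length v \<le> 1"
proof -
  define t where "t = length w div 2"
  define v where "v = take (length w - 2 * t) (drop t w)"
  have "rev (take t w) = drop (length w - t) w"
    using assms by (metis rev_take)
  moreover have "drop (length w - 2 * t) (drop t w) = drop (length w - t) w"
    by (simp add: t_def)
  ultimately have "w = take t w @ v @ rev (take t w)"
    unfolding v_def by (metis append_take_drop_id)
  moreover have "length v \<le> 1" by (auto simp: v_def t_def)
  ultimately show ?thesis by (rule that)
qed

text \<open>In the abelian case the palindromes are the elements \<open>m\<^sup>2\<close> and \<open>m\<^sup>2 x\<^sub>i\<close>: a palindrome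
  consists of a word, at most one letter, and the reversed word, and \<open>x\<^sub>i\<inverse>\<close> differs from \<open>x\<^sub>i\<close> by
  a square.\<close>

lemma abelian_palindromes:
  assumes "comm_group (free_nilpotent n k)"
  shows "palindromes n k = {m \<otimes>\<^bsub>free_nilpotent n k\<^esub> m \<otimes>\<^bsub>free_nilpotent n k\<^esub> c | m c.
    m \<in> carrier (free_nilpotent n k) \<and> c \<in> insert \<one>\<^bsub>free_nilpotent n k\<^esub> (nilpotent_gen n k ` {1..n})}"
    (is "_ = ?S")
proof -
  interpret N: comm_group "free_nilpotent n k" by fact
  let ?y = "nilpotent_gen n k"
  let ?v = "word_value (free_nilpotent n k) ?y"
  note y = nilpotent_gen_closed[of n k]
  note closed = N.word_value_closed[OF y] N.letter_value_closed[OF y]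
  have rev_words: "rev u \<in> words n" if "u \<in> words n" for u using that by (auto simp: words_def)
  have rev: "?v (rev u) = ?v u" if "u \<in> words n" for u
    using that
  proof (induction u)
    case (Cons l u)
    then have u: "u \<in> words n" "[l] \<in> words n" by auto
    have "?v (rev u @ [l]) = ?v (rev u) \<otimes>\<^bsub>free_nilpotent n k\<^esub> ?v [l]"
      using u rev_words by (intro N.word_value_append[OF y])
    then show ?case using Cons u closed by (simp add: N.m_comm)
  qed simp
  have sand: "?v (u @ v @ rev u) = ?v u \<otimes>\<^bsub>free_nilpotent n k\<^esub> ?v u \<otimes>\<^bsub>free_nilpotent n k\<^esub> ?v v"
    if "u \<in> words n" "v \<in> words n" for u v
    using that rev_words closed rev by (simp add: N.word_value_append[OF y] N.m_ac)
  show ?thesis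
  proof (intro equalityI subsetI)
    fix p assume "p \<in> palindromes n k"
    then obtain w where w: "w \<in> words n" "rev w = w" "p = ?v w"
      by (auto simp: palindromes_def palindrome_word_def)
    obtain u v where uv: "w = u @ v @ rev u" "length v \<le> 1" using palindrome_halves[OF w(2)] by blast
    then have words: "u \<in> words n" "v \<in> words n" using w(1) by auto
    have p: "p = ?v u \<otimes>\<^bsub>free_nilpotent n k\<^esub> ?v u \<otimes>\<^bsub>free_nilpotent n k\<^esub> ?v v"
      using w(3) uv(1) sand[OF words] by simp
    consider "v = []" | i where "v = [(i, True)]" "i \<in> {1..n}" | i where "v = [(i, False)]" "i \<in> {1..n}"
      using uv(2) words(2) by (cases v) (auto, metis (full_types))
    then show "p \<in> ?S"
    proof cases
      case 1
      then have "p = ?v u \<otimes>\<^bsub>free_nilpotent n k\<^esub> ?v u \<otimes>\<^bsub>free_nilpotent n k\<^esub> \<one>\<^bsub>free_nilpotent n k\<^esub>"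
        using p by simp
      then show ?thesis using closed(1)[OF words(1)] by blast
    next
      case (2 i)
      then have "?y i \<in> carrier (free_nilpotent n k)" using y by blast
      then have "p = ?v u \<otimes>\<^bsub>free_nilpotent n k\<^esub> ?v u \<otimes>\<^bsub>free_nilpotent n k\<^esub> ?y i" using p 2 by simp
      then show ?thesis using closed(1)[OF words(1)] 2(2) by blast
    next
      case (3 i)
      then have yi: "?y i \<in> carrier (free_nilpotent n k)" using y by blast
      let ?m = "?v u \<otimes>\<^bsub>free_nilpotent n k\<^esub> inv\<^bsub>free_nilpotent n k\<^esub> ?y i"
      have "?m \<otimes>\<^bsub>free_nilpotent n k\<^esub> ?m \<otimes>\<^bsub>free_nilpotent n k\<^esub> ?y i = ?m \<otimes>\<^bsub>free_nilpotent n k\<^esub> ?v u"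
        using yi closed(1)[OF words(1)] by (simp add: N.m_assoc)
      then have "p = ?m \<otimes>\<^bsub>free_nilpotent n k\<^esub> ?m \<otimes>\<^bsub>free_nilpotent n k\<^esub> ?y i"
        using p 3 yi closed(1)[OF words(1)] by (simp add: N.m_ac)
      moreover have "?m \<in> carrier (free_nilpotent n k)" using yi closed(1)[OF words(1)] by simp
      ultimately show ?thesis using 3(2) by blast
    qed
  next
    fix p assume "p \<in> ?S"
    then obtain m c where mc: "p = m \<otimes>\<^bsub>free_nilpotent n k\<^esub> m \<otimes>\<^bsub>free_nilpotent n k\<^esub> c"
      "m \<in> carrier (free_nilpotent n k)" "c \<in> insert \<one>\<^bsub>free_nilpotent n k\<^esub> (?y ` {1..n})" by blast
    obtain u where u: "u \<in> words n" "m = ?v u"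
      using mc(2) carrier_free_nilpotent_wordE word_value_nilpotent_gen by metis
    have "\<exists>v \<in> words n. rev v = v \<and> c = ?v v"
      using mc(3)
    proof
      assume "c = \<one>\<^bsub>free_nilpotent n k\<^esub>"
      then show ?thesis by (intro bexI[of _ "[]"]) auto
    next
      assume "c \<in> ?y ` {1..n}"
      then obtain i where i: "i \<in> {1..n}" "c = ?y i" by blast
      then have "?y i \<in> carrier (free_nilpotent n k)" using y by blast
      then have "c = ?v [(i, True)]" using i(2) by simp
      then show ?thesis using i(1) by (intro bexI[of _ "[(i, True)]"]) simp_all
    qed
    then obtain v where v: "v \<in> words n" "rev v = v" "c = ?v v" by blast
    then have "p = ?v (u @ v @ rev u)" using sand[OF u(1) v(1)] mc(1) u(2) by simp
    then show "p \<in> palindromes n k"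
      unfolding palindromes_def palindrome_word_def using u(1) v rev_words by auto
  qed
qed

text \<open>The finitely many cosets of the squares that consist of palindromes are permuted by a
  palindromic automorphism, so the inverse automorphism permutes them as well.\<close>

lemma abelian_inverse_palindromic:
  assumes "comm_group (free_nilpotent n k)" "f \<in> palindromic_auts n k" "i \<in> {1..n}"
  shows "(inv\<^bsub>AutoGroup (free_nilpotent n k)\<^esub> f) (nilpotent_gen n k i) \<in> palindromes n k"
proof -
  let ?N = "free_nilpotent n k"
  interpret N: comm_group ?N by fact
  have f: "f \<in> auto ?N" using assms(2) by (simp add: palindromic_auts_def)
  interpret f: group_hom ?N ?N f using f by (rule N.auto_group_hom)
  define C where "C = insert \<one>\<^bsub>?N\<^esub> (nilpotent_gen n k ` {1..n})"
  \<comment> \<open>\<open>E c\<close> is the coset of \<open>c\<close> modulo the subgroup of squares.\<close>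
  define E where "E c = {m \<otimes>\<^bsub>?N\<^esub> m \<otimes>\<^bsub>?N\<^esub> c | m. m \<in> carrier ?N}" for c
  have pal: "palindromes n k = \<Union> (E ` C)"
    unfolding abelian_palindromes[OF assms(1)] C_def E_def by blast
  have C: "c \<in> carrier ?N" if "c \<in> C" for c using that nilpotent_gen_closed[of n k] by (auto simp: C_def)
  have self: "c \<in> E c" if "c \<in> carrier ?N" for c
    using that by (auto simp: E_def intro!: exI[of _ "\<one>\<^bsub>?N\<^esub>"])
  have E_carrier: "E c \<subseteq> carrier ?N" if "c \<in> carrier ?N" for c using that by (auto simp: E_def)
  have E_eq: "E d = E c" if c: "c \<in> carrier ?N" and d: "d \<in> E c" for c d
  proof -
    obtain m where m: "m \<in> carrier ?N" "d = m \<otimes>\<^bsub>?N\<^esub> m \<otimes>\<^bsub>?N\<^esub> c" using d by (auto simp: E_def)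
    have "x \<otimes>\<^bsub>?N\<^esub> x \<otimes>\<^bsub>?N\<^esub> d = (x \<otimes>\<^bsub>?N\<^esub> m) \<otimes>\<^bsub>?N\<^esub> (x \<otimes>\<^bsub>?N\<^esub> m) \<otimes>\<^bsub>?N\<^esub> c" if "x \<in> carrier ?N" for x
      using that m \<open>c \<in> carrier ?N\<close> by (simp add: N.m_ac)
    moreover have "x \<otimes>\<^bsub>?N\<^esub> x \<otimes>\<^bsub>?N\<^esub> c = (x \<otimes>\<^bsub>?N\<^esub> inv\<^bsub>?N\<^esub> m) \<otimes>\<^bsub>?N\<^esub> (x \<otimes>\<^bsub>?N\<^esub> inv\<^bsub>?N\<^esub> m) \<otimes>\<^bsub>?N\<^esub> d"
      if "x \<in> carrier ?N" for x
    proof -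
      have "(x \<otimes>\<^bsub>?N\<^esub> inv\<^bsub>?N\<^esub> m) \<otimes>\<^bsub>?N\<^esub> (x \<otimes>\<^bsub>?N\<^esub> inv\<^bsub>?N\<^esub> m) \<otimes>\<^bsub>?N\<^esub> d =
        x \<otimes>\<^bsub>?N\<^esub> x \<otimes>\<^bsub>?N\<^esub> c \<otimes>\<^bsub>?N\<^esub> (inv\<^bsub>?N\<^esub> m \<otimes>\<^bsub>?N\<^esub> m) \<otimes>\<^bsub>?N\<^esub> (inv\<^bsub>?N\<^esub> m \<otimes>\<^bsub>?N\<^esub> m)"
        unfolding m(2) using that m(1) \<open>c \<in> carrier ?N\<close> by (simp add: N.m_ac del: N.l_inv N.r_inv)
      then show ?thesis using that m(1) \<open>c \<in> carrier ?N\<close> by simp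
    qed
    ultimately show ?thesis using m(1) unfolding E_def by (auto, blast+)
  qed
  have image: "f ` E c = E (f c)" if c: "c \<in> carrier ?N" for c
  proof -
    have onto: "f ` carrier ?N = carrier ?N" using N.auto_bij_betw[OF f] by (simp add: bij_betw_def)
    have "f ` E c = {f m \<otimes>\<^bsub>?N\<^esub> f m \<otimes>\<^bsub>?N\<^esub> f c | m. m \<in> carrier ?N}"
      unfolding E_def using c by (auto simp: image_iff) (metis N.m_closed f.hom_mult)
    also have "\<dots> = {m \<otimes>\<^bsub>?N\<^esub> m \<otimes>\<^bsub>?N\<^esub> f c | m. m \<in> f ` carrier ?N}" by blast
    finally show ?thesis by (simp add: E_def onto)
  qed
  have "f ` E c \<in> E ` C" if c: "c \<in> C" for c
  proof -
    have "f c \<in> palindromes n k"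
      using palindromic_image[OF assms(2), of c] c self[OF C[OF c]] pal by blast
    then obtain d where d: "d \<in> C" "f c \<in> E d" using pal by blast
    show ?thesis unfolding image[OF C[OF c]] E_eq[OF C[OF d(1)] d(2)] using d(1) by (rule imageI)
  qed
  then have "(`) f ` (E ` C) \<subseteq> E ` C" by blast
  moreover have "inj_on ((`) f) (E ` C)"
  proof (rule inj_on_image)
    have "\<Union> (E ` C) \<subseteq> carrier ?N" using E_carrier C by blast
    then show "inj_on f (\<Union> (E ` C))"
      using N.auto_bij_betw[OF f] inj_on_subset by (auto simp: bij_betw_def)
  qed
  moreover have "finite (E ` C)" by (simp add: C_def)
  ultimately have permuted: "(`) f ` (E ` C) = E ` C" by (rule endo_inj_surj[rotated])
  have y: "nilpotent_gen n k i \<in> C" using assms(3) by (simp add: C_def)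
  then have "E (nilpotent_gen n k i) \<in> (`) f ` (E ` C)" unfolding permuted by (rule imageI)
  then obtain c where c: "c \<in> C" "E (nilpotent_gen n k i) = f ` E c" by (elim imageE) simp
  then obtain x where x: "x \<in> E c" "nilpotent_gen n k i = f x" using self[OF C[OF y]] by blast
  then have "(inv\<^bsub>AutoGroup ?N\<^esub> f) (nilpotent_gen n k i) = x"
    using N.inv_auto(2)[OF f, of x] E_carrier[OF C[OF c(1)]] by auto
  then show ?thesis using x(1) c(1) pal by blast
qed

lemma abelian_exists_inversion:
  assumes "comm_group (free_nilpotent n k)" "n \<ge> 1" "k \<ge> 1"
  shows "\<exists>f \<in> central_palindromic_auts n k \<inter> normal_auts (free_nilpotent n k).
    f \<noteq> \<one>\<^bsub>AutoGroup (free_nilpotent n k)\<^esub>"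
proof -
  interpret q: group_hom "free_group n" "free_nilpotent n k" "nil_class n k" by (rule group_hom_nil_class)
  interpret N: comm_group "free_nilpotent n k" by fact
  let ?N = "free_nilpotent n k"
  let ?f = "\<lambda>x \<in> carrier ?N. inv\<^bsub>?N\<^esub> x"
  have y: "nilpotent_gen n k i \<in> carrier ?N" if "i \<in> {1..n}" for i using that nilpotent_gen_closed by blast
  have "?f (nilpotent_gen n k i) \<in> palindromes n k" if i: "i \<in> {1..n}" for i
  proof -
    have "?f (nilpotent_gen n k i) = word_value ?N (nilpotent_gen n k) [(i, False)]" using y[OF i] by simp
    moreover have "[(i, False)] \<in> words n \<and> rev [(i, False)] = [(i, False)]" using i by simp
    ultimately show ?thesis unfolding palindromes_def palindrome_word_def by blast
  qed
  then have "?f \<in> central_palindromic_auts n k \<inter> normal_auts ?N"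
    using N.inversion_auto by (simp add: central_palindromic_auts_def palindromic_auts_def)
  moreover have "?f \<noteq> \<one>\<^bsub>AutoGroup ?N\<^esub>"
  proof
    assume one: "?f = \<one>\<^bsub>AutoGroup ?N\<^esub>"
    have 1: "1 \<in> {1..n}" using assms(2) by simp
    have x: "free_gen n 1 \<in> carrier (free_group n)" using 1 free_gen_closed by blast
    have "inv\<^bsub>?N\<^esub> (nilpotent_gen n k 1) = nilpotent_gen n k 1"
      using fun_cong[OF one, of "nilpotent_gen n k 1"] y[OF 1] by (simp add: q.H.AutoGroup_simps)
    then have "nil_class n k (free_gen n 1 \<otimes>\<^bsub>free_group n\<^esub> free_gen n 1) = \<one>\<^bsub>?N\<^esub>"
      using x q.H.r_inv[OF y[OF 1]] by (simp add: nilpotent_gen_eq)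
    then have "free_gen n 1 \<otimes>\<^bsub>free_group n\<^esub> free_gen n 1 \<in> lower_central (free_group n) (k + 1)"
      using x by (subst (asm) nil_class_eq_one_iff) simp_all
    then have "magnus (free_gen n 1 \<otimes>\<^bsub>free_group n\<^esub> free_gen n 1) [1] = series_one [1 :: nat]"
      using assms(3) by (intro magnus_filtration_low[OF magnus_lower_central]) auto
    moreover have "magnus (free_gen n 1 \<otimes>\<^bsub>free_group n\<^esub> free_gen n 1) [1 :: nat] = 2"
      using magnus_top_mult[of 1 "free_gen n 1" n "free_gen n 1" "[1]"] x magnus_free_gen[OF 1]
      by (simp add: magnus_gen_def)
    ultimately show False by (simp add: series_one_def)
  qed
  ultimately show ?thesis by blast
qed


section \<open>The group of central palindromic automorphisms\<close>

lemma one_central_palindromic: "\<one>\<^bsub>AutoGroup (free_nilpotent n k)\<^esub> \<in> central_palindromic_auts n k"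
proof -
  interpret N: group "free_nilpotent n k" by (rule group_free_nilpotent)
  have "\<one>\<^bsub>AutoGroup (free_nilpotent n k)\<^esub> \<in> central_auts (free_nilpotent n k)"
    by (rule subgroup.one_closed[OF N.subgroup_central_auts])
  moreover have "(\<lambda>x \<in> carrier (free_nilpotent n k). x) \<in> palindromic_auts n k"
    using N.id_in_auto nilpotent_gen_closed[of n k] nilpotent_gen_palindrome[of _ n k]
    by (auto simp: palindromic_auts_def image_subset_iff)
  ultimately show ?thesis by (simp add: central_palindromic_auts_def N.AutoGroup_simps)
qed

lemma subgroup_central_palindromic_auts:
  assumes "n \<ge> 1" "k \<ge> 1"
  shows "subgroup (central_palindromic_auts n k) (AutoGroup (free_nilpotent n k))"
proof -
  let ?N = "free_nilpotent n k" and ?A = "AutoGroup (free_nilpotent n k)"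
  interpret N: group ?N by (rule group_free_nilpotent)
  interpret A: group ?A by (rule N.AutoGroup)
  have pal: "f \<in> palindromic_auts n k" "f \<in> central_auts ?N" "f \<in> auto ?N"
    if "f \<in> central_palindromic_auts n k" for f
    using that by (auto simp: central_palindromic_auts_def palindromic_auts_def)
  show ?thesis
  proof (rule A.subgroupI)
    show "central_palindromic_auts n k \<subseteq> carrier ?A" using pal by (auto simp: N.AutoGroup_simps)
    show "central_palindromic_auts n k \<noteq> {}" using one_central_palindromic by blast
    fix f assume f: "f \<in> central_palindromic_auts n k"
    note fp = pal[OF f]
    have central: "inv\<^bsub>?A\<^esub> f \<in> central_auts ?N"
      using fp(2) by (rule subgroup.m_inv_closed[OF N.subgroup_central_auts])
    consider "k = 1 \<or> n = 1" | "n \<ge> 2" "even k" | "n \<ge> 2" "k \<ge> 2" "odd k"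
      using assms by linarith
    then show "inv\<^bsub>?A\<^esub> f \<in> central_palindromic_auts n k"
    proof cases
      case 1
      then show ?thesis
        using abelian_inverse_palindromic[OF comm_group_free_nilpotent fp(1)] central N.inv_auto(1)[OF fp(3)]
        by (auto simp: central_palindromic_auts_def palindromic_auts_def)
    next
      case 2
      then show ?thesis
        using even_central_palindromic_trivial[OF 2(1) assms(2) 2(2) f] one_central_palindromic by simp
    next
      case 3
      then show ?thesis
        using odd_inverse_palindromic[OF 3 f] central N.inv_auto(1)[OF fp(3)]
        by (auto simp: central_palindromic_auts_def palindromic_auts_def)
    qed
    fix g assume g: "g \<in> central_palindromic_auts n k"
    note gp = pal[OF g]
    have "f \<otimes>\<^bsub>?A\<^esub> g \<in> central_auts ?N"
      using fp(2) gp(2) by (rule subgroup.m_closed[OF N.subgroup_central_auts])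
    moreover have "(f \<otimes>\<^bsub>?A\<^esub> g) (nilpotent_gen n k i) \<in> palindromes n k" if i: "i \<in> {1..n}" for i
    proof -
      have "(f \<otimes>\<^bsub>?A\<^esub> g) (nilpotent_gen n k i) = f (g (nilpotent_gen n k i))"
        using i nilpotent_gen_closed[of n k] fp(3) gp(3)
        by (simp add: N.AutoGroup_simps compose_def image_subset_iff)
      then show ?thesis
        using palindromic_image[OF fp(1)] gp(1) i by (simp add: palindromic_auts_def)
    qed
    ultimately show "f \<otimes>\<^bsub>?A\<^esub> g \<in> central_palindromic_auts n k"
      by (auto simp: central_palindromic_auts_def palindromic_auts_def central_auts_def)
  qed
qed

theorem theorem2p6:
  fixes n k :: nat
  assumes "n \<ge> 1" and "k \<ge> 1"
  shows "subgroup (central_palindromic_auts n k) (AutoGroup (free_nilpotent n k)) \<and>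
    (even k \<and> n \<ge> 2 \<longrightarrow>
       central_palindromic_auts n k = {\<one>\<^bsub>AutoGroup (free_nilpotent n k)\<^esub>}) \<and>
    (odd k \<longrightarrow>
       central_palindromic_auts n k \<noteq> {\<one>\<^bsub>AutoGroup (free_nilpotent n k)\<^esub>} \<and>
       central_palindromic_auts n k \<inter> normal_auts (free_nilpotent n k)
         \<noteq> {\<one>\<^bsub>AutoGroup (free_nilpotent n k)\<^esub>})"
proof (intro conjI impI)
  show "subgroup (central_palindromic_auts n k) (AutoGroup (free_nilpotent n k))"
    using assms by (rule subgroup_central_palindromic_auts)
  show "central_palindromic_auts n k = {\<one>\<^bsub>AutoGroup (free_nilpotent n k)\<^esub>}" if "even k \<and> n \<ge> 2"
    using that assms even_central_palindromic_trivial one_central_palindromic by blast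
  assume k: "odd k"
  have "\<exists>f \<in> central_palindromic_auts n k \<inter> normal_auts (free_nilpotent n k).
    f \<noteq> \<one>\<^bsub>AutoGroup (free_nilpotent n k)\<^esub>"
  proof (cases "k = 1 \<or> n = 1")
    case True
    then show ?thesis using abelian_exists_inversion[OF comm_group_free_nilpotent assms] by blast
  next
    case False
    moreover from this k have "k \<ge> 3" using assms(2) by presburger
    ultimately show ?thesis using assms(1) k by (intro odd_exists_inner) auto
  qed
  then obtain f where "f \<in> central_palindromic_auts n k" "f \<in> normal_auts (free_nilpotent n k)"
    "f \<noteq> \<one>\<^bsub>AutoGroup (free_nilpotent n k)\<^esub>" by blast
  then show "central_palindromic_auts n k \<noteq> {\<one>\<^bsub>AutoGroup (free_nilpotent n k)\<^esub>}"
    and "central_palindromic_auts n k \<inter> normal_auts (free_nilpotent n k)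
         \<noteq> {\<one>\<^bsub>AutoGroup (free_nilpotent n k)\<^esub>}"
    by auto
qed

end
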